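(* Let $p$ be a prime, $f\ge1$, and let $L/\mathbb{Q}_{p^f}(\zeta_p)$ be a strongly separable totally ramified extension of degree $n=[L:\mathbb{Q}_{p^f}(\zeta_p)]$. Then $$\text{Lower-Convex-Hull}\big(\{(p^{\beta_L(i)-1},\,p^{\beta_L(i)-1}i): i\in I_L\}\cup\{(n,n)\}\big)=\mathrm{Newt}(L/\mathbb{Q}_{p^f}(\zeta_p)).$$
   Context: Local fields: non-archimedean, non-discrete, locally compact; $v_K$ normalized valuation, residue characteristic $p$, residue field of size $p^{f_K}$, $\mu_p(K)=\{\alpha\in K:\alpha^p=1\}$, $U_i(K)=1+m_K^i$, and $U_\bullet(K)$ is the $\mathbb{Z}_p$-module $U_1(K)$ with filtration $(U_i(K))_{i\ge1}$. $\mathbb{Q}_{p^f}$ is the degree $f$ unramified extension of $\mathbb{Q}_p$. An extension $F/E$ of local fields of residue characteristic $p$ is strongly separable if $v_F(\delta_{F/E})<v_F(p)$, $\delta_{F/E}$ being the different. Newton polygon: for a totally ramified separable extension $L/K$ of degree $n$, write $L=K[x]/g(x)$ with $g$ Eisenstein of degree $n$ over $K$, let $\pi$ be a root of $g$ in a separable closure, and let $g_{\mathrm{twist}}(t)=g(\pi t+\pi)=\sum_kc_kt^k\in K(\pi)[t]$. $\mathrm{Newt}(L/K)$ is the Newton polygon of $g_{\mathrm{twist}}$, i.e. the lower convex hull of the points $(k,v_{K(\pi)}(c_k))$ with $c_k\ne0$; it does not depend on the choices of $g$ and $\pi$. Lower-Convex-Hull of a finite set of points in the plane is the lower boundary of its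 convex hull. Definition of $(I_L,\beta_L)$: a shift is a strictly increasing $\rho:\mathbb{Z}_{\ge1}\to\mathbb{Z}_{\ge1}$ with $\rho(1)>1$; $T_\rho=\mathbb{Z}_{\ge1}\setminus\rho(\mathbb{Z}_{\ge1})$; if $T_\rho$ is finite, $e^*=\max(T_\rho)+1$, $T_\rho^*=T_\rho\cup\{e^*\}$. $\rho_{e,p}(i)=\min\{i+e,pi\}$. An extended $\rho$-jump set is a pair $(I,\beta)$ with $I\subseteq T_\rho^*$ finite and $\beta:I\to\mathbb{Z}_{\ge1}$ strictly decreasing such that $i\mapsto\rho^{\beta(i)}(i)$ is strictly increasing on $I$. A filtered $\mathbb{Z}_p$-module $M_\bullet$ is a sequence $M_1\supseteq M_2\supseteq\cdots$ of $\mathbb{Z}_p$-modules with $\bigcap_iM_i=\{0\}$; its weight map $w(x)=\sup\{i:x\in M_i\}$ determines the filtration; morphisms are $\mathbb{Z}_p$-linear maps $\phi$ with $\phi(M_i)\subseteq N_i$ for all $i$. Products and sums carry the termwise filtration, quotients by closed submodules the image filtration. $S_i$ is $\mathbb{Z}_p$ with weight $w(x)=\rho^{\mathrm{ord}_p(x)}(i)$ ($w(0)=\infty$); $M_\rho=\prod_{i\in T_\rho}S_i$, $M_\rho^*=\prod_{i\in T_\rho^*}S_i$. $v_{(I,\beta)}=(x_j)_{j\in T_\rho^*}\in M_\rho^*$ has $x_j=0$ for $j\notin I$, $x_j=p^{\beta(j)}$ for $j\in I$. For a local field $L$ with $\mu_p(L)\ne\{1\}$ and $\rho_L=\rho_{v_L(p),p}$,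 $(I_L,\beta_L)$ is the unique extended $\rho_L$-jump set with $U_\bullet(L)\simeq M_{\rho_L}^{f_L-1}\oplus(M_{\rho_L}^*/\mathbb{Z}_pv_{(I_L,\beta_L)})$ as filtered modules. *)

theory Defs
  imports "HOL-Analysis.Analysis" "HOL-Computational_Algebra.Computational_Algebra"
    "HOL-Algebra.AbelCoset" "HOL-Algebra.Module"
begin

section \<open>Local fields\<close>

text \<open>
  A valuation is a map \<open>v :: 'a \<Rightarrow> int\<close> whose value at \<open>0\<close> is arbitrary and never used;
  \<open>val_ext\<close> is the same valuation with value \<open>\<infinity>\<close> at \<open>0\<close>.  The condition on an element of
  valuation \<open>1\<close> says that the valuation is normalized; in particular it is non-trivial.
\<close>

definition normalized_valuation :: "('a::field \<Rightarrow> int) \<Rightarrow> bool" where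
  "normalized_valuation v \<longleftrightarrow>
     (\<forall>x y. x \<noteq> 0 \<longrightarrow> y \<noteq> 0 \<longrightarrow> v (x * y) = v x + v y) \<and>
     (\<forall>x y. x \<noteq> 0 \<longrightarrow> y \<noteq> 0 \<longrightarrow> x + y \<noteq> 0 \<longrightarrow> min (v x) (v y) \<le> v (x + y)) \<and>
     (\<exists>x. x \<noteq> 0 \<and> v x = 1)"

definition val_ext :: "('a::field \<Rightarrow> int) \<Rightarrow> 'a \<Rightarrow> ereal" where
  "val_ext v x = (if x = 0 then \<infinity> else ereal (of_int (v x)))"

definition max_pow :: "('a::field \<Rightarrow> int) \<Rightarrow> int \<Rightarrow> 'a set" where
  "max_pow v i = {x. x = 0 \<or> i \<le> v x}"

abbreviation val_ring :: "('a::field \<Rightarrow> int) \<Rightarrow> 'a set" where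
  "val_ring v \<equiv> max_pow v 0"

definition vdist :: "('a::field \<Rightarrow> int) \<Rightarrow> 'a \<Rightarrow> 'a \<Rightarrow> real" where
  "vdist v x y = (if x = y then 0 else 2 powr (- of_int (v (x - y))))"

definition local_field :: "('a::field \<Rightarrow> int) \<Rightarrow> bool" where
  "local_field v \<longleftrightarrow>
     normalized_valuation v \<and>
     locally_compact_space (Metric_space.mtopology UNIV (vdist v))"

lemma normalized_valuation_uminus:
  assumes "normalized_valuation v" "x \<noteq> 0"
  shows "v (- x) = v x"
proof -
  have mult: "\<And>x y. x \<noteq> 0 \<Longrightarrow> y \<noteq> 0 \<Longrightarrow> v (x * y) = v x + v y"
    using assms(1) by (auto simp: normalized_valuation_def)
  have "v 1 = 0"
    using mult[of 1 1] by simp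
  then have "v (- 1) = 0"
    using mult[of "- 1" "- 1"] by simp
  then show ?thesis
    using mult[of "- 1" x] assms(2) by simp
qed

lemma Metric_space_vdist:
  assumes "normalized_valuation v"
  shows "Metric_space UNIV (vdist v)"
proof
  have ultra: "\<And>x y. x \<noteq> 0 \<Longrightarrow> y \<noteq> 0 \<Longrightarrow> x + y \<noteq> 0 \<Longrightarrow> min (v x) (v y) \<le> v (x + y)"
    using assms by (auto simp: normalized_valuation_def)
  fix x y z :: 'a
  show "0 \<le> vdist v x y"
    by (simp add: vdist_def)
  show "vdist v x y = vdist v y x"
    using normalized_valuation_uminus[OF assms, of "x - y"] by (simp add: vdist_def)
  show "vdist v x y = 0 \<longleftrightarrow> x = y"
    by (simp add: vdist_def)
  show "vdist v x z \<le> vdist v x y + vdist v y z"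
  proof (cases "x = y \<or> y = z \<or> x = z")
    case False
    then have "min (v (x - y)) (v (y - z)) \<le> v ((x - y) + (y - z))"
      using ultra[of "x - y" "y - z"] by simp
    then have "v (x - y) \<le> v (x - z) \<or> v (y - z) \<le> v (x - z)"
      by (simp add: min_def split: if_splits)
    then have "2 powr (- of_int (v (x - z))) \<le> (2::real) powr (- of_int (v (x - y))) \<or>
               2 powr (- of_int (v (x - z))) \<le> (2::real) powr (- of_int (v (y - z)))"
      by auto
    moreover have "0 < (2::real) powr (- of_int (v (x - y)))" "0 < (2::real) powr (- of_int (v (y - z)))"
      by simp_all
    ultimately have "2 powr (- of_int (v (x - z)))
        \<le> (2::real) powr (- of_int (v (x - y))) + 2 powr (- of_int (v (y - z)))"
      by linarith
    then show ?thesis using False by (simp add: vdist_def)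
  qed (auto simp: vdist_def)
qed

text \<open>The exponent \<open>d\<close> such that the residue field has \<open>p ^ d\<close> elements.\<close>

definition residue_degree :: "nat \<Rightarrow> ('a::field \<Rightarrow> int) \<Rightarrow> nat" where
  "residue_degree p v =
     (THE d. card (val_ring v // {(x, y). x \<in> val_ring v \<and> y \<in> val_ring v \<and> x - y \<in> max_pow v 1})
             = p ^ d)"

text \<open>
  \<open>is_Qp p v\<close>: the valued field is the completion of the rationals at the \<open>p\<close>-adic valuation,
  characterized as a complete valued field in which the rationals are dense and on which the
  valuation induces the \<open>p\<close>-adic one (by multiplicativity it is enough to prescribe it on the
  integers).
\<close>

definition is_Qp :: "nat \<Rightarrow> ('q::field_char_0 \<Rightarrow> int) \<Rightarrow> bool" where
  "is_Qp p v \<longleftrightarrow>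
     normalized_valuation v \<and>
     Metric_space.mcomplete UNIV (vdist v) \<and>
     (\<forall>m::int. m \<noteq> 0 \<longrightarrow> v (of_int m) = int (multiplicity (int p) m)) \<and>
     (\<forall>x N. \<exists>r::rat. x - of_rat r \<in> max_pow v N)"


section \<open>Extensions\<close>

text \<open>An extension is given by a field embedding \<open>\<iota>\<close>, making the top field a vector space over
  the bottom one.\<close>

definition ext_scale :: "('k::field \<Rightarrow> 'l::field) \<Rightarrow> 'k \<Rightarrow> 'l \<Rightarrow> 'l" where
  "ext_scale \<iota> a x = \<iota> a * x"

definition field_embedding :: "('k::field \<Rightarrow> 'l::field) \<Rightarrow> bool" where
  "field_embedding \<iota> \<longleftrightarrow>
     \<iota> 1 = 1 \<and> (\<forall>x y. \<iota> (x + y) = \<iota> x + \<iota> y) \<and> (\<forall>x y. \<iota> (x * y) = \<iota> x * \<iota> y)"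

lemma vector_space_ext_scale: "field_embedding \<iota> \<Longrightarrow> vector_space (ext_scale \<iota>)"
  by unfold_locales (auto simp: ext_scale_def field_embedding_def algebra_simps)

definition ext_degree :: "('k::field \<Rightarrow> 'l::field) \<Rightarrow> nat" where
  "ext_degree \<iota> = vector_space.dim (ext_scale \<iota>) UNIV"

text \<open>Finiteness is stated separately, because \<open>dim\<close> is \<open>0\<close> in the infinite-dimensional case.\<close>

definition local_field_ext ::
  "('k::field \<Rightarrow> int) \<Rightarrow> ('l::field \<Rightarrow> int) \<Rightarrow> ('k \<Rightarrow> 'l) \<Rightarrow> bool" where
  "local_field_ext vK vL \<iota> \<longleftrightarrow>
     local_field vK \<and> local_field vL \<and> field_embedding \<iota> \<and>
     (\<exists>B. finite B \<and> Modules.module.span (ext_scale \<iota>) B = UNIV) \<and>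
     (\<exists>e::nat. 0 < e \<and> (\<forall>x. x \<noteq> 0 \<longrightarrow> vL (\<iota> x) = int e * vK x))"

definition ram_index ::
  "('k::field \<Rightarrow> int) \<Rightarrow> ('l::field \<Rightarrow> int) \<Rightarrow> ('k \<Rightarrow> 'l) \<Rightarrow> nat" where
  "ram_index vK vL \<iota> = (THE e. \<forall>x. x \<noteq> 0 \<longrightarrow> vL (\<iota> x) = int e * vK x)"

text \<open>Residue fields are finite, so no separability condition is needed here.\<close>

definition unramified_ext ::
  "('k::field \<Rightarrow> int) \<Rightarrow> ('l::field \<Rightarrow> int) \<Rightarrow> ('k \<Rightarrow> 'l) \<Rightarrow> bool" where
  "unramified_ext vK vL \<iota> \<longleftrightarrow> local_field_ext vK vL \<iota> \<and> ram_index vK vL \<iota> = 1"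

definition totally_ramified_ext ::
  "('k::field \<Rightarrow> int) \<Rightarrow> ('l::field \<Rightarrow> int) \<Rightarrow> ('k \<Rightarrow> 'l) \<Rightarrow> bool" where
  "totally_ramified_ext vK vL \<iota> \<longleftrightarrow>
     local_field_ext vK vL \<iota> \<and> ram_index vK vL \<iota> = ext_degree \<iota>"

definition is_subfield :: "'a::field set \<Rightarrow> bool" where
  "is_subfield S \<longleftrightarrow>
     1 \<in> S \<and> (\<forall>x\<in>S. \<forall>y\<in>S. x - y \<in> S \<and> x * y \<in> S) \<and> (\<forall>x\<in>S. inverse x \<in> S)"

definition adjoin :: "'a::field set \<Rightarrow> 'a \<Rightarrow> 'a set" where
  "adjoin F z = \<Inter>{S. is_subfield S \<and> F \<subseteq> S \<and> z \<in> S}"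

text \<open>The trace of multiplication by \<open>x\<close>, computed in some basis.\<close>

definition ext_trace :: "('k::field \<Rightarrow> 'l::field) \<Rightarrow> 'l \<Rightarrow> 'k" where
  "ext_trace \<iota> x =
     (let B = (SOME B. \<not> Modules.module.dependent (ext_scale \<iota>) B \<and>
                       Modules.module.span (ext_scale \<iota>) B = UNIV)
      in \<Sum>b\<in>B. Modules.module.representation (ext_scale \<iota>) B (x * b) b)"

definition codifferent ::
  "('k::field \<Rightarrow> int) \<Rightarrow> ('l::field \<Rightarrow> int) \<Rightarrow> ('k \<Rightarrow> 'l) \<Rightarrow> 'l set" where
  "codifferent vK vL \<iota> = {x. \<forall>y\<in>val_ring vL. ext_trace \<iota> (x * y) \<in> val_ring vK}"

definition different ::
  "('k::field \<Rightarrow> int) \<Rightarrow> ('l::field \<Rightarrow> int) \<Rightarrow> ('k \<Rightarrow> 'l) \<Rightarrow> 'l set" where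
  "different vK vL \<iota> = {z. \<forall>x\<in>codifferent vK vL \<iota>. z * x \<in> val_ring vL}"

text \<open>The valuation of an ideal is the least valuation of its elements.\<close>

definition strongly_separable ::
  "nat \<Rightarrow> ('k::field \<Rightarrow> int) \<Rightarrow> ('l::field \<Rightarrow> int) \<Rightarrow> ('k \<Rightarrow> 'l) \<Rightarrow> bool" where
  "strongly_separable p vK vL \<iota> \<longleftrightarrow>
     (INF z\<in>different vK vL \<iota>. val_ext vL z) < val_ext vL (of_nat p)"


section \<open>Newton polygons\<close>

definition lower_convex_hull :: "(real \<times> real) set \<Rightarrow> (real \<times> real) set" where
  "lower_convex_hull S =
     {(x, y). (x, y) \<in> convex hull S \<and> (\<forall>y'. (x, y') \<in> convex hull S \<longrightarrow> y \<le> y')}"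

definition newton_polygon :: "('l::field \<Rightarrow> int) \<Rightarrow> 'l poly \<Rightarrow> (real \<times> real) set" where
  "newton_polygon v h = lower_convex_hull {(real k, real_of_int (v (coeff h k))) | k. coeff h k \<noteq> 0}"

definition eisenstein :: "('k::field \<Rightarrow> int) \<Rightarrow> 'k poly \<Rightarrow> bool" where
  "eisenstein v g \<longleftrightarrow>
     0 < degree g \<and> lead_coeff g = 1 \<and>
     (\<forall>i<degree g. coeff g i \<in> max_pow v 1) \<and>
     coeff g 0 \<noteq> 0 \<and> v (coeff g 0) = 1"

text \<open>\<open>L = K[x]/g(x)\<close> with \<open>g\<close> Eisenstein of degree \<open>[L:K]\<close>, where \<open>\<pi>\<close> is the class of \<open>x\<close>:
  evaluation at \<open>\<pi>\<close> maps \<open>K[x]\<close> onto \<open>L\<close> with kernel \<open>(g)\<close>.\<close>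

definition eisenstein_presentation ::
  "('k::field \<Rightarrow> int) \<Rightarrow> ('k \<Rightarrow> 'l::field) \<Rightarrow> 'k poly \<Rightarrow> 'l \<Rightarrow> bool" where
  "eisenstein_presentation vK \<iota> g \<pi> \<longleftrightarrow>
     eisenstein vK g \<and> degree g = ext_degree \<iota> \<and>
     range (\<lambda>h. poly (map_poly \<iota> h) \<pi>) = UNIV \<and>
     (\<forall>h. poly (map_poly \<iota> h) \<pi> = 0 \<longleftrightarrow> g dvd h)"

definition twist :: "('k::field \<Rightarrow> 'l::field) \<Rightarrow> 'k poly \<Rightarrow> 'l \<Rightarrow> 'l poly" where
  "twist \<iota> g \<pi> = pcompose (map_poly \<iota> g) [:\<pi>, \<pi>:]"

text \<open>The polygon does not depend on the Eisenstein presentation, hence the definite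
  description.\<close>

definition Newt ::
  "('k::field \<Rightarrow> int) \<Rightarrow> ('l::field \<Rightarrow> int) \<Rightarrow> ('k \<Rightarrow> 'l) \<Rightarrow> (real \<times> real) set" where
  "Newt vK vL \<iota> =
     (THE P. \<exists>g \<pi>. eisenstein_presentation vK \<iota> g \<pi> \<and> P = newton_polygon vL (twist \<iota> g \<pi>))"


section \<open>Jump sets\<close>

text \<open>Positive integers are natural numbers \<open>\<ge> 1\<close>; the value of a shift at \<open>0\<close> plays no role.\<close>

definition rho :: "nat \<Rightarrow> nat \<Rightarrow> nat \<Rightarrow> nat" where
  "rho e p i = min (i + e) (p * i)"

definition T_set :: "(nat \<Rightarrow> nat) \<Rightarrow> nat set" where
  "T_set \<rho> = {1..} - \<rho> ` {1..}"

definition e_star :: "(nat \<Rightarrow> nat) \<Rightarrow> nat" where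
  "e_star \<rho> = Max (T_set \<rho>) + 1"

definition T_star :: "(nat \<Rightarrow> nat) \<Rightarrow> nat set" where
  "T_star \<rho> = T_set \<rho> \<union> {e_star \<rho>}"

text \<open>The values of \<open>\<beta>\<close> outside \<open>I\<close> play no role.\<close>

definition extended_jump_set :: "(nat \<Rightarrow> nat) \<Rightarrow> nat set \<Rightarrow> (nat \<Rightarrow> nat) \<Rightarrow> bool" where
  "extended_jump_set \<rho> I \<beta> \<longleftrightarrow>
     finite I \<and> I \<subseteq> T_star \<rho> \<and> (\<forall>i\<in>I. 1 \<le> \<beta> i) \<and>
     strict_antimono_on I \<beta> \<and> strict_mono_on I (\<lambda>i. (\<rho> ^^ \<beta> i) i)"


section \<open>Filtered modules over the p-adic integers\<close>

text \<open>The filtration is only considered at indices \<open>\<ge> 1\<close>.  The ring multiplication and unit in a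
  HOL-Algebra module record are irrelevant for modules and left undefined below.\<close>

record ('r, 'm) fmodule = "('r, 'm) module" +
  filt :: "nat \<Rightarrow> 'm set"

definition fmod_hom ::
  "'r set \<Rightarrow> ('r, 'm) fmodule \<Rightarrow> ('r, 'n) fmodule \<Rightarrow> ('m \<Rightarrow> 'n) set" where
  "fmod_hom R M N = {h \<in> carrier M \<rightarrow> carrier N.
     (\<forall>x\<in>carrier M. \<forall>y\<in>carrier M. h (x \<oplus>\<^bsub>M\<^esub> y) = h x \<oplus>\<^bsub>N\<^esub> h y) \<and>
     (\<forall>a\<in>R. \<forall>x\<in>carrier M. h (a \<odot>\<^bsub>M\<^esub> x) = a \<odot>\<^bsub>N\<^esub> h x) \<and>
     (\<forall>i\<ge>1. h ` filt M i \<subseteq> filt N i)}"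

definition fmod_iso :: "'r set \<Rightarrow> ('r, 'm) fmodule \<Rightarrow> ('r, 'n) fmodule \<Rightarrow> bool" where
  "fmod_iso R M N \<longleftrightarrow> (\<exists>h \<in> fmod_hom R M N. \<exists>k \<in> fmod_hom R N M.
     (\<forall>x\<in>carrier M. k (h x) = x) \<and> (\<forall>y\<in>carrier N. h (k y) = y))"

definition fmod_prod :: "'i set \<Rightarrow> ('i \<Rightarrow> ('r, 'm) fmodule) \<Rightarrow> ('r, 'i \<Rightarrow> 'm) fmodule" where
  "fmod_prod J M =
     \<lparr>carrier = (\<Pi>\<^sub>E j\<in>J. carrier (M j)), mult = undefined, one = undefined,
      zero = (\<lambda>j\<in>J. \<zero>\<^bsub>M j\<^esub>), add = (\<lambda>x y. \<lambda>j\<in>J. x j \<oplus>\<^bsub>M j\<^esub> y j),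
      smult = (\<lambda>a x. \<lambda>j\<in>J. a \<odot>\<^bsub>M j\<^esub> x j), filt = (\<lambda>i. \<Pi>\<^sub>E j\<in>J. filt (M j) i)\<rparr>"

definition fmod_sum ::
  "('r, 'm) fmodule \<Rightarrow> ('r, 'n) fmodule \<Rightarrow> ('r, 'm \<times> 'n) fmodule" where
  "fmod_sum M N =
     \<lparr>carrier = carrier M \<times> carrier N, mult = undefined, one = undefined,
      zero = (\<zero>\<^bsub>M\<^esub>, \<zero>\<^bsub>N\<^esub>), add = (\<lambda>x y. (fst x \<oplus>\<^bsub>M\<^esub> fst y, snd x \<oplus>\<^bsub>N\<^esub> snd y)),
      smult = (\<lambda>a x. (a \<odot>\<^bsub>M\<^esub> fst x, a \<odot>\<^bsub>N\<^esub> snd x)), filt = (\<lambda>i. filt M i \<times> filt N i)\<rparr>"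

text \<open>Cosets of the submodule \<open>N\<close>; the scalar multiple of the coset \<open>N + x\<close> is
  \<open>N + a (N + x) = N + a x\<close>.\<close>

definition fmod_quot :: "('r, 'm) fmodule \<Rightarrow> 'm set \<Rightarrow> ('r, 'm set) fmodule" where
  "fmod_quot M N =
     \<lparr>carrier = a_rcosets\<^bsub>M\<^esub> N, mult = undefined, one = undefined,
      zero = N, add = set_add M,
      smult = (\<lambda>a X. N <+>\<^bsub>M\<^esub> ((\<lambda>x. a \<odot>\<^bsub>M\<^esub> x) ` X)),
      filt = (\<lambda>i. (\<lambda>x. N +>\<^bsub>M\<^esub> x) ` filt M i)\<rparr>"

text \<open>The ring of \<open>p\<close>-adic integers is the valuation ring of a model \<open>vQ\<close> of the \<open>p\<close>-adic
  numbers, in which \<open>vQ\<close> is \<open>ord\<^sub>p\<close>.\<close>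

definition S_mod :: "('q::field \<Rightarrow> int) \<Rightarrow> (nat \<Rightarrow> nat) \<Rightarrow> nat \<Rightarrow> ('q, 'q) fmodule" where
  "S_mod vQ \<rho> i =
     \<lparr>carrier = val_ring vQ, mult = undefined, one = undefined,
      zero = 0, add = (+), smult = (*),
      filt = (\<lambda>k. {x \<in> val_ring vQ. x = 0 \<or> k \<le> (\<rho> ^^ nat (vQ x)) i})\<rparr>"

definition M_rho :: "('q::field \<Rightarrow> int) \<Rightarrow> (nat \<Rightarrow> nat) \<Rightarrow> ('q, nat \<Rightarrow> 'q) fmodule" where
  "M_rho vQ \<rho> = fmod_prod (T_set \<rho>) (S_mod vQ \<rho>)"

definition M_rho_star :: "('q::field \<Rightarrow> int) \<Rightarrow> (nat \<Rightarrow> nat) \<Rightarrow> ('q, nat \<Rightarrow> 'q) fmodule" where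
  "M_rho_star vQ \<rho> = fmod_prod (T_star \<rho>) (S_mod vQ \<rho>)"

definition jump_vector ::
  "nat \<Rightarrow> (nat \<Rightarrow> nat) \<Rightarrow> nat set \<Rightarrow> (nat \<Rightarrow> nat) \<Rightarrow> nat \<Rightarrow> 'q::field" where
  "jump_vector p \<rho> I \<beta> = (\<lambda>j\<in>T_star \<rho>. if j \<in> I then of_nat p ^ \<beta> j else 0)"

definition cyclic_submodule :: "'r set \<Rightarrow> ('r, 'm) fmodule \<Rightarrow> 'm \<Rightarrow> 'm set" where
  "cyclic_submodule R M x = (\<lambda>a. a \<odot>\<^bsub>M\<^esub> x) ` R"

text \<open>The unit filtration; the action of a \<open>p\<close>-adic integer \<open>a\<close> is \<open>u \<mapsto> u^a\<close>, the limit of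
  \<open>u ^ k\<close> for natural numbers \<open>k\<close> tending \<open>p\<close>-adically to \<open>a\<close>.\<close>

definition unit_group :: "('l::field \<Rightarrow> int) \<Rightarrow> nat \<Rightarrow> 'l set" where
  "unit_group v i = {u. u - 1 \<in> max_pow v (int i)}"

definition padic_power :: "('q::field \<Rightarrow> int) \<Rightarrow> ('l::field \<Rightarrow> int) \<Rightarrow> 'q \<Rightarrow> 'l \<Rightarrow> 'l" where
  "padic_power vQ vL a u =
     (THE w. \<forall>N. \<exists>m. \<forall>k::nat. of_nat k - a \<in> max_pow vQ m \<longrightarrow> u ^ k - w \<in> max_pow vL N)"

definition U_mod :: "('q::field \<Rightarrow> int) \<Rightarrow> ('l::field \<Rightarrow> int) \<Rightarrow> ('q, 'l) fmodule" where
  "U_mod vQ vL =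
     \<lparr>carrier = unit_group vL 1, mult = undefined, one = undefined,
      zero = 1, add = (*), smult = padic_power vQ vL, filt = unit_group vL\<rparr>"

text \<open>\<open>(I, \<beta>)\<close> is the jump set of the local field \<open>L\<close> (of characteristic \<open>0\<close> and residue
  characteristic \<open>p\<close>, containing a non-trivial \<open>p\<close>-th root of unity).\<close>

definition is_jump_set_of ::
  "nat \<Rightarrow> ('q::field \<Rightarrow> int) \<Rightarrow> ('l::field \<Rightarrow> int) \<Rightarrow> nat set \<Rightarrow> (nat \<Rightarrow> nat) \<Rightarrow> bool" where
  "is_jump_set_of p vQ vL I \<beta> \<longleftrightarrow>
     (let \<rho> = rho (nat (vL (of_nat p))) p;
          Ms = M_rho_star vQ \<rho>
      in extended_jump_set \<rho> I \<beta> \<and>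
         fmod_iso (val_ring vQ) (U_mod vQ vL)
           (fmod_sum
              (fmod_prod {..<residue_degree p vL - 1} (\<lambda>_. M_rho vQ \<rho>))
              (fmod_quot Ms (cyclic_submodule (val_ring vQ) Ms (jump_vector p \<rho> I \<beta>)))))"

end

(*
  Let e = v_L(p) = n (p - 1) and let pi be a root of an Eisenstein polynomial g = sum a_j X^j.
  Both polygons are read off the staircase

    m_s = min { v_L(a_j pi^j) : 1 <= j <= n, p^s does not divide j },   s >= 1.

  On the module side, zeta_p corresponds to a unit multiple of v_(I,beta) / p, so the largest
  weight of zeta_p u^(p^s), u in U_1(L), is the minimum of rho^(beta(i)-1)(i) over beta(i) <= s.
  On the field side the same number is m_s.  Indeed zeta_p - 1 is a uniformizer of Q_(p^f)(zeta_p), and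
  g(pi) = 0 expresses it as a combination of the powers pi^j, 1 <= j <= n.  Modulo p the elements
  congruent to p^s-th powers form a ring; an induction along the pi-adic filtration shows that
  zeta_p - 1 lies in it modulo pi^(m_s), and it does not modulo pi^(m_s + 1) because p^s does not
  divide m_s.  Strong separability, through v_L(g'(pi)), gives m_s <= e, so that this
  characteristic p argument applies.  Finally the coefficient of t^k in g(pi t + pi) is
  sum_j binom(j,k) a_j pi^j, whose valuation is compared with m_s by divisibility of binom(j,k).
*)
theory Submission
  imports Defs "HOL-Algebra.Exponent"
begin

section \<open>Normalized valuations\<close>

text \<open>In the code \<open>e\<close> is a ramification index, for L/K equal to n = [L:K], and
  v_L(p) is written \<open>e * (p - 1)\<close>; the overview uses e for v_L(p). The filtered
  isomorphism is only known to exist, so just intrinsic data can cross it: the weights attained on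
  the cosets \<zeta>U_1^(p^s), with \<zeta> recognised on the module side as an element of order p.
  The resulting numbers m_s fix the hull, not the points, and no matching of jumps with vertices is
  set up. The hulls are compared by domination instead: a point lies above a hull if that hull has a
  point to its left and one to its right, neither of them higher. The one on the right is always (n,
  n), whose ordinate is minimal on both sides because m_s \<ge> n; adjoining it to the jump points
  supplies the right end of the polygon.\<close>

locale nval =
  fixes v :: "'a::field \<Rightarrow> int"
  assumes nval: "normalized_valuation v"
begin

lemma val_mult: "x \<noteq> 0 \<Longrightarrow> y \<noteq> 0 \<Longrightarrow> v (x * y) = v x + v y"
  using nval by (simp add: normalized_valuation_def)

lemma val_add: "x \<noteq> 0 \<Longrightarrow> y \<noteq> 0 \<Longrightarrow> x + y \<noteq> 0 \<Longrightarrow> min (v x) (v y) \<le> v (x + y)"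
  using nval by (simp add: normalized_valuation_def)

lemma ex_uniformizer: "\<exists>x. x \<noteq> 0 \<and> v x = 1"
  using nval by (simp add: normalized_valuation_def)

lemma val_one [simp]: "v 1 = 0"
  using val_mult[of 1 1] by simp

lemma val_uminus [simp]: "v (- x) = v x"
  by (cases "x = 0") (auto simp: normalized_valuation_uminus[OF nval])

lemma val_power: "x \<noteq> 0 \<Longrightarrow> v (x ^ k) = int k * v x"
  by (induction k) (auto simp: val_mult algebra_simps)

lemma val_inverse: "x \<noteq> 0 \<Longrightarrow> v (inverse x) = - v x"
  using val_mult[of x "inverse x"] by simp

lemma val_divide: "x \<noteq> 0 \<Longrightarrow> y \<noteq> 0 \<Longrightarrow> v (x / y) = v x - v y"
  by (simp add: divide_inverse val_mult val_inverse)

lemma zero_in_max_pow [simp]: "0 \<in> max_pow v i"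
  by (simp add: max_pow_def)

lemma one_in_val_ring [simp]: "1 \<in> max_pow v 0"
  by (simp add: max_pow_def)

lemma max_pow_add: "x \<in> max_pow v i \<Longrightarrow> y \<in> max_pow v i \<Longrightarrow> x + y \<in> max_pow v i"
  using val_add[of x y] by (cases "x = 0"; cases "y = 0"; cases "x + y = 0") (auto simp: max_pow_def)

lemma max_pow_uminus [simp]: "- x \<in> max_pow v i \<longleftrightarrow> x \<in> max_pow v i"
  by (simp add: max_pow_def)

lemma max_pow_diff: "x \<in> max_pow v i \<Longrightarrow> y \<in> max_pow v i \<Longrightarrow> x - y \<in> max_pow v i"
  using max_pow_add[of x i "- y"] by simp

lemma max_pow_sum: "(\<And>j. j \<in> J \<Longrightarrow> f j \<in> max_pow v i) \<Longrightarrow> (\<Sum>j\<in>J. f j) \<in> max_pow v i"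
  by (induction J rule: infinite_finite_induct) (auto intro: max_pow_add)

lemma max_pow_mult: "x \<in> max_pow v i \<Longrightarrow> y \<in> max_pow v j \<Longrightarrow> x * y \<in> max_pow v (i + j)"
  by (cases "x = 0 \<or> y = 0") (auto simp: max_pow_def val_mult)

lemma max_pow_mult_left: "x \<in> max_pow v 0 \<Longrightarrow> y \<in> max_pow v j \<Longrightarrow> x * y \<in> max_pow v j"
  using max_pow_mult[of x 0 y j] by simp

lemma max_pow_mult_right: "x \<in> max_pow v i \<Longrightarrow> y \<in> max_pow v 0 \<Longrightarrow> x * y \<in> max_pow v i"
  using max_pow_mult[of x i y 0] by simp

lemma max_pow_anti: "i \<le> j \<Longrightarrow> x \<in> max_pow v j \<Longrightarrow> x \<in> max_pow v i"
  by (auto simp: max_pow_def)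

lemma max_pow_power: "x \<in> max_pow v i \<Longrightarrow> x ^ k \<in> max_pow v (int k * i)"
  by (cases "x = 0") (auto simp: max_pow_def val_power power_0_left mult_left_mono)

lemma val_ring_power: "x \<in> max_pow v 0 \<Longrightarrow> x ^ k \<in> max_pow v 0"
  using max_pow_power[of x 0 k] by simp

lemma of_nat_in_val_ring [simp]: "of_nat k \<in> max_pow v 0"
  by (induction k) (auto intro: max_pow_add)

lemma max_pow_cong: "x - y \<in> max_pow v i \<Longrightarrow> x \<in> max_pow v i \<longleftrightarrow> y \<in> max_pow v i"
  using max_pow_diff[of x i "x - y"] max_pow_add[of "x - y" i y] by auto

lemma val_add_eq:
  assumes "x \<noteq> 0" "y \<in> max_pow v (v x + 1)"
  shows "x + y \<noteq> 0 \<and> v (x + y) = v x"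
proof (cases "y = 0")
  case False
  then have vy: "v x < v y" using assms by (simp add: max_pow_def)
  have nz: "x + y \<noteq> 0"
  proof
    assume "x + y = 0"
    then have "y = - x" by (simp add: add_eq_0_iff)
    then show False using vy by simp
  qed
  have "min (v x) (v y) \<le> v (x + y)" using val_add assms(1) False nz by blast
  moreover have "min (v (x + y)) (v (- y)) \<le> v (x + y + - y)"
    using val_add[of "x + y" "- y"] assms(1) False nz by simp
  ultimately show ?thesis using nz vy by (simp add: min_def split: if_splits)
qed (use assms in auto)

lemma val_sum_distinct:
  assumes "finite J" "J \<noteq> {}" "\<And>j. j \<in> J \<Longrightarrow> f j \<noteq> 0" "inj_on (\<lambda>j. v (f j)) J"
  shows "(\<Sum>j\<in>J. f j) \<noteq> 0 \<and> v (\<Sum>j\<in>J. f j) = Min ((\<lambda>j. v (f j)) ` J)"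
  using assms
proof (induction J rule: finite_ne_induct)
  case (insert x J)
  let ?s = "\<Sum>j\<in>J. f j" and ?M = "Min ((\<lambda>j. v (f j)) ` J)"
  have IH: "?s \<noteq> 0" "v ?s = ?M" and fx: "f x \<noteq> 0" using insert by auto
  have "?M \<in> (\<lambda>j. v (f j)) ` J" using insert by (intro Min_in) auto
  then obtain j where "j \<in> J" "?M = v (f j)" by blast
  then have ne: "?M \<noteq> v (f x)" using insert.hyps insert.prems(2) by (auto simp: inj_on_def)
  have eq: "Min ((\<lambda>j. v (f j)) ` insert x J) = min (v (f x)) ?M" using insert by simp
  have ins: "(\<Sum>j\<in>insert x J. f j) = f x + ?s" using insert by simp
  show ?case
  proof (cases "v (f x) < ?M")
    case True
    then have "?s \<in> max_pow v (v (f x) + 1)" using IH by (simp add: max_pow_def)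
    then show ?thesis using val_add_eq[OF fx] True unfolding eq ins by (simp add: min_def)
  next
    case False
    then have "f x \<in> max_pow v (v ?s + 1)" using IH ne by (simp add: max_pow_def)
    from val_add_eq[OF IH(1) this] show ?thesis
      using False IH ne unfolding eq ins by (simp add: min_def add.commute)
  qed
qed auto

lemma unit_group_nonzero: "1 \<le> i \<Longrightarrow> u \<in> unit_group v i \<Longrightarrow> u \<noteq> 0"
  by (auto simp: unit_group_def max_pow_def)

lemma unit_group_val:
  assumes "1 \<le> i" "u \<in> unit_group v i" shows "v u = 0"
  using val_add_eq[of 1 "u - 1"] assms max_pow_anti[of 1 "int i" "u - 1"]
  by (simp add: unit_group_def)

lemma unit_group_anti: "i \<le> j \<Longrightarrow> u \<in> unit_group v j \<Longrightarrow> u \<in> unit_group v i"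
  using max_pow_anti[of "int i" "int j" "u - 1"] by (simp add: unit_group_def)

lemma unit_group_iff: "x \<noteq> 0 \<Longrightarrow> v x = 0 \<Longrightarrow> x * y - x \<in> max_pow v i \<longleftrightarrow> y - 1 \<in> max_pow v i"
  by (cases "y = 1") (auto simp: max_pow_def val_mult right_diff_distrib[symmetric, of x y 1, simplified])

end

text \<open>The inner binomial coefficients are divisible by p, and the quotient sum w starts with
  its k = 1 term y^(p-2). Recording this as the second equation shows that w is a unit when y = 1
  and x lies in the maximal ideal, which is how the valuation of \<zeta> - 1 is found.\<close>

lemma (in nval) binomial_prime_cong:
  assumes "prime p" "x \<in> max_pow v 0" "y \<in> max_pow v 0"
  obtains w w' where "w \<in> max_pow v 0" "w' \<in> max_pow v 0"
    "(x + y) ^ p = x ^ p + y ^ p + of_nat p * x * y * w" "w = y ^ (p - 2) + x * w'"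
proof -
  have p: "p \<ge> 2" using assms(1) prime_ge_2_nat by blast
  define w where "w = (\<Sum>k\<in>{1..<p}. of_nat ((p choose k) div p) * x ^ (k - 1) * y ^ (p - k - 1))"
  have "(x + y) ^ p = (\<Sum>k\<le>p. of_nat (p choose k) * x ^ k * y ^ (p - k))"
    by (simp add: binomial_ring)
  also have "{..p} = insert 0 (insert p {1..<p})" using p by auto
  also have "(\<Sum>k\<in>insert 0 (insert p {1..<p}). of_nat (p choose k) * x ^ k * y ^ (p - k))
    = y ^ p + (x ^ p + (\<Sum>k\<in>{1..<p}. of_nat (p choose k) * x ^ k * y ^ (p - k)))"
    using p by simp
  also have "(\<Sum>k\<in>{1..<p}. of_nat (p choose k) * x ^ k * y ^ (p - k)) = of_nat p * x * y * w"
    unfolding w_def sum_distrib_left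
  proof (rule sum.cong)
    fix k assume k: "k \<in> {1..<p}"
    then have "p dvd p choose k" using dvd_choose_prime[of k p] assms(1) by auto
    then have "(of_nat (p choose k) :: 'a) = of_nat p * of_nat ((p choose k) div p)"
      by (metis dvd_mult_div_cancel of_nat_mult)
    moreover have "x ^ k = x * x ^ (k - 1)" "y ^ (p - k) = y * y ^ (p - k - 1)"
      using k by (auto simp: power_eq_if)
    ultimately show "of_nat (p choose k) * x ^ k * y ^ (p - k)
      = of_nat p * x * y * (of_nat ((p choose k) div p) * x ^ (k - 1) * y ^ (p - k - 1))"
      by (simp add: mult_ac)
  qed simp
  finally have eq: "(x + y) ^ p = x ^ p + y ^ p + of_nat p * x * y * w" by (simp add: add_ac)
  have "w \<in> max_pow v 0" unfolding w_def
    by (intro max_pow_sum max_pow_mult_left val_ring_power assms of_nat_in_val_ring)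
  moreover define w' where "w' = (\<Sum>k\<in>{2..<p}. of_nat ((p choose k) div p) * x ^ (k - 2) * y ^ (p - k - 1))"
  have "w' \<in> max_pow v 0" unfolding w'_def
    by (intro max_pow_sum max_pow_mult_left val_ring_power assms of_nat_in_val_ring)
  moreover have "w = y ^ (p - 2) + x * w'"
  proof -
    have "x * (of_nat ((p choose k) div p) * x ^ (k - 2) * y ^ (p - k - 1))
        = of_nat ((p choose k) div p) * x ^ (k - 1) * y ^ (p - k - 1)" if "k \<in> {2..<p}" for k
    proof -
      have "k - 1 = Suc (k - 2)" using that by auto
      then have "x ^ (k - 1) = x * x ^ (k - 2)" by simp
      then show ?thesis by (simp add: mult_ac)
    qed
    then have "x * w' = (\<Sum>k\<in>{2..<p}. of_nat ((p choose k) div p) * x ^ (k - 1) * y ^ (p - k - 1))"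
      unfolding w'_def sum_distrib_left by (intro sum.cong) auto
    moreover have "{1..<p} = insert 1 {2..<p}" using p by auto
    ultimately show ?thesis using p by (simp add: w_def numeral_2_eq_2)
  qed
  ultimately show ?thesis using that eq by blast
qed

section \<open>Distance to powers in the module of a jump set\<close>

lemma M_rho_star_simps:
  "x \<oplus>\<^bsub>M_rho_star vQ \<rho>\<^esub> y = (\<lambda>j\<in>T_star \<rho>. x j + y j)"
  "a \<odot>\<^bsub>M_rho_star vQ \<rho>\<^esub> x = (\<lambda>j\<in>T_star \<rho>. a * x j)"
  "carrier (M_rho_star vQ \<rho>) = (T_star \<rho> \<rightarrow>\<^sub>E val_ring vQ)"
  "filt (M_rho_star vQ \<rho>) k = (\<Pi>\<^sub>E j\<in>T_star \<rho>. {x \<in> val_ring vQ. x = 0 \<or> k \<le> (\<rho> ^^ nat (vQ x)) j})"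
  by (simp_all add: M_rho_star_def fmod_prod_def S_mod_def)

lemma M_rho_power_simps:
  "x \<oplus>\<^bsub>fmod_prod J (\<lambda>_. M_rho vQ \<rho>)\<^esub> y = (\<lambda>i\<in>J. \<lambda>j\<in>T_set \<rho>. x i j + y i j)"
  "carrier (fmod_prod J (\<lambda>_. M_rho vQ \<rho>)) = (J \<rightarrow>\<^sub>E T_set \<rho> \<rightarrow>\<^sub>E val_ring vQ)"
  "filt (fmod_prod J (\<lambda>_. M_rho vQ \<rho>)) k =
     (J \<rightarrow>\<^sub>E (\<Pi>\<^sub>E j\<in>T_set \<rho>. {x \<in> val_ring vQ. x = 0 \<or> k \<le> (\<rho> ^^ nat (vQ x)) j}))"
  by (simp_all add: M_rho_def fmod_prod_def S_mod_def)

text \<open>Coset arithmetic is done in coordinates on the sets themselves: no module or group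
  locale is established for these records, so the three coset lemmas stand in for the laws of the
  quotient.\<close>

lemma cyclic_coset_eqD:
  fixes vQ :: "'q::field_char_0 \<Rightarrow> int"
  assumes "normalized_valuation vQ" and "y \<in> carrier (M_rho_star vQ \<rho>)"
    and "cyclic_submodule (val_ring vQ) (M_rho_star vQ \<rho>) w +>\<^bsub>M_rho_star vQ \<rho>\<^esub> x =
         cyclic_submodule (val_ring vQ) (M_rho_star vQ \<rho>) w +>\<^bsub>M_rho_star vQ \<rho>\<^esub> y"
  shows "\<exists>a\<in>val_ring vQ. y = (\<lambda>j\<in>T_star \<rho>. a * w j + x j)"
proof -
  interpret nval vQ by standard fact
  have y: "restrict y (T_star \<rho>) = y"
    using assms(2) by (simp add: M_rho_star_simps PiE_restrict)
  have "(\<lambda>j\<in>T_star \<rho>. 0) \<in> cyclic_submodule (val_ring vQ) (M_rho_star vQ \<rho>) w"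
    by (auto simp: cyclic_submodule_def M_rho_star_simps fun_eq_iff intro!: image_eqI[of _ _ 0])
  then have "y \<in> cyclic_submodule (val_ring vQ) (M_rho_star vQ \<rho>) w +>\<^bsub>M_rho_star vQ \<rho>\<^esub> y"
    unfolding a_r_coset_def' by (rule UN_I) (simp add: M_rho_star_simps y cong: restrict_cong)
  then have "y \<in> cyclic_submodule (val_ring vQ) (M_rho_star vQ \<rho>) w +>\<^bsub>M_rho_star vQ \<rho>\<^esub> x"
    using assms(3) by simp
  then show ?thesis
    unfolding a_r_coset_def' cyclic_submodule_def M_rho_star_simps by (auto simp: fun_eq_iff)
qed

lemma cyclic_coset_shift:
  fixes vQ :: "'q::field_char_0 \<Rightarrow> int"
  assumes "normalized_valuation vQ" and "a \<in> val_ring vQ"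
  shows "cyclic_submodule (val_ring vQ) (M_rho_star vQ \<rho>) w +>\<^bsub>M_rho_star vQ \<rho>\<^esub> (\<lambda>j\<in>T_star \<rho>. a * w j + x j) =
         cyclic_submodule (val_ring vQ) (M_rho_star vQ \<rho>) w +>\<^bsub>M_rho_star vQ \<rho>\<^esub> x"
proof -
  interpret nval vQ by standard fact
  have 1: "\<exists>c\<in>val_ring vQ. (\<lambda>j\<in>T_star \<rho>. b * w j + (a * w j + x j)) = (\<lambda>j\<in>T_star \<rho>. c * w j + x j)"
    if "b \<in> val_ring vQ" for b
    using max_pow_add[OF that assms(2)] by (intro bexI[of _ "b + a"]) (auto simp: algebra_simps fun_eq_iff)
  have 2: "\<exists>c\<in>val_ring vQ. (\<lambda>j\<in>T_star \<rho>. b * w j + x j) = (\<lambda>j\<in>T_star \<rho>. c * w j + (a * w j + x j))"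
    if "b \<in> val_ring vQ" for b
    using max_pow_diff[OF that assms(2)] by (intro bexI[of _ "b - a"]) (auto simp: algebra_simps fun_eq_iff)
  show ?thesis
    unfolding a_r_coset_def' cyclic_submodule_def M_rho_star_simps
    using 1 2 by (auto simp: fun_eq_iff cong: restrict_cong)
qed

lemma cyclic_coset_add:
  fixes vQ :: "'q::field_char_0 \<Rightarrow> int"
  assumes "normalized_valuation vQ"
  shows "(cyclic_submodule (val_ring vQ) (M_rho_star vQ \<rho>) w +>\<^bsub>M_rho_star vQ \<rho>\<^esub> x) <+>\<^bsub>M_rho_star vQ \<rho>\<^esub>
         (cyclic_submodule (val_ring vQ) (M_rho_star vQ \<rho>) w +>\<^bsub>M_rho_star vQ \<rho>\<^esub> y) =
         cyclic_submodule (val_ring vQ) (M_rho_star vQ \<rho>) w +>\<^bsub>M_rho_star vQ \<rho>\<^esub> (\<lambda>j\<in>T_star \<rho>. x j + y j)"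
proof -
  interpret nval vQ by standard fact
  have 1: "\<exists>c\<in>val_ring vQ. (\<lambda>j\<in>T_star \<rho>. (a * w j + x j) + (b * w j + y j)) =
      (\<lambda>j\<in>T_star \<rho>. c * w j + (x j + y j))"
    if "a \<in> val_ring vQ" "b \<in> val_ring vQ" for a b
    using max_pow_add[OF that] by (intro bexI[of _ "a + b"]) (auto simp: algebra_simps fun_eq_iff)
  have 2: "\<exists>a\<in>val_ring vQ. \<exists>b\<in>val_ring vQ. (\<lambda>j\<in>T_star \<rho>. c * w j + (x j + y j)) =
      (\<lambda>j\<in>T_star \<rho>. (a * w j + x j) + (b * w j + y j))" if "c \<in> val_ring vQ" for c
    using that by (intro bexI[of _ c] bexI[of _ 0]) (auto simp: algebra_simps fun_eq_iff)
  show ?thesis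
    unfolding a_r_coset_def' set_add_def' cyclic_submodule_def M_rho_star_simps
    using 1 2 by (auto simp: fun_eq_iff cong: restrict_cong)
qed

text \<open>The isomorphism presents U_1 by coordinate vectors modulo multiples of w =
  v_(I,\<beta>). As z has order p, p times its vector is a multiple c w, and c is a unit because z
  is not trivial; so z is represented by c w / p, with entry c p^(\<beta>(i)-1) at i in I. Changing
  z by a p^s-th power and the vector by a multiple of w adds p^s b_i + c' p^\<beta>(i). This leaves
  the order of the entry alone if \<beta>(i) \<le> s, and can cancel the entry otherwise.\<close>

lemma jump_module_iff:
  fixes vQ :: "'q::field_char_0 \<Rightarrow> int" and vL :: "'l::field \<Rightarrow> int"
  assumes vQ: "normalized_valuation vQ" and vL: "normalized_valuation vL"
    and vp: "vQ (of_nat p) = 1" and p: "prime p"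
    and z: "z ^ p = 1" "z \<noteq> 1" "z \<in> unit_group vL 1"
    and ejs: "extended_jump_set \<rho> I \<beta>"
    and iso: "fmod_iso (val_ring vQ) (U_mod vQ vL)
        (fmod_sum (fmod_prod J (\<lambda>_. M_rho vQ \<rho>))
           (fmod_quot (M_rho_star vQ \<rho>)
             (cyclic_submodule (val_ring vQ) (M_rho_star vQ \<rho>) (jump_vector p \<rho> I \<beta>))))"
    and k: "1 \<le> k"
  shows "(\<exists>u\<in>unit_group vL 1. z * u ^ (p ^ s) \<in> unit_group vL k) \<longleftrightarrow>
         (\<forall>i\<in>I. \<beta> i \<le> s \<longrightarrow> k \<le> (\<rho> ^^ (\<beta> i - 1)) i)"
proof -
  interpret Q: nval vQ by standard fact
  interpret L: nval vL by standard fact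
  let ?O = "val_ring vQ" and ?T = "T_star \<rho>" and ?w = "jump_vector p \<rho> I \<beta> :: nat \<Rightarrow> 'q"
  define Ms where "Ms = M_rho_star vQ \<rho>"
  define D where "D = fmod_prod J (\<lambda>_. M_rho vQ \<rho>)"
  define V where "V = cyclic_submodule ?O Ms ?w"
  let ?N = "fmod_sum D (fmod_quot Ms V)"
  have IT: "I \<subseteq> ?T" and beta1: "\<And>i. i \<in> I \<Longrightarrow> 1 \<le> \<beta> i"
    using ejs by (auto simp: extended_jump_set_def)
  have w: "?w j = (if j \<in> I then of_nat p ^ \<beta> j else 0)" if "j \<in> ?T" for j
    using that by (simp add: jump_vector_def)
  have p0: "(of_nat p :: 'q) \<noteq> 0" using p prime_gt_0_nat[of p] by simp
  have vpp: "vQ (of_nat p ^ m) = int m" for m using Q.val_power[OF p0] vp by simp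
  have ppow: "(of_nat p :: 'q) ^ \<beta> j = of_nat p * of_nat p ^ (\<beta> j - 1)" if "j \<in> I" for j
    using beta1[OF that] by (cases "\<beta> j") auto
  obtain h g where h: "h \<in> fmod_hom ?O (U_mod vQ vL) ?N" and g: "g \<in> fmod_hom ?O ?N (U_mod vQ vL)"
    and gh: "\<And>x. x \<in> carrier (U_mod vQ vL) \<Longrightarrow> g (h x) = x"
    and hg: "\<And>y. y \<in> carrier ?N \<Longrightarrow> h (g y) = y"
    using iso unfolding fmod_iso_def D_def V_def Ms_def by blast
  have carrN: "carrier ?N = carrier D \<times> (\<lambda>x. V +>\<^bsub>Ms\<^esub> x) ` carrier Ms"
    by (auto simp: fmod_sum_def fmod_quot_def A_RCOSETS_def')
  have filtN: "filt ?N i = filt D i \<times> (\<lambda>x. V +>\<^bsub>Ms\<^esub> x) ` filt Ms i" for i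
    by (simp add: fmod_sum_def fmod_quot_def)
  have filt_sub: "filt Ms i \<subseteq> carrier Ms" "filt D i \<subseteq> carrier D" for i
    unfolding Ms_def D_def M_rho_star_simps M_rho_power_simps
    by (blast intro!: PiE_mono)+
  have filt_Ms: "x j = 0 \<or> i \<le> (\<rho> ^^ nat (vQ (x j))) j" if "x \<in> filt Ms i" "j \<in> ?T" for x i j
    using that unfolding Ms_def M_rho_star_simps by (blast dest: PiE_mem)
  have addN: "(a, V +>\<^bsub>Ms\<^esub> x) \<oplus>\<^bsub>?N\<^esub> (b, V +>\<^bsub>Ms\<^esub> y) = (a \<oplus>\<^bsub>D\<^esub> b, V +>\<^bsub>Ms\<^esub> (x \<oplus>\<^bsub>Ms\<^esub> y))" for a b x y
    using cyclic_coset_add[OF vQ, of \<rho> ?w x y]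
    by (simp add: fmod_sum_def fmod_quot_def Ms_def V_def M_rho_star_simps)
  \<comment> \<open>The inverse isomorphism read on representatives. Its fibres are the translates
    by multiples of \<open>?w\<close>, so equalities in U_1 become equalities of coordinates up to
    one p-adic integer.\<close>
  define F where "F = (\<lambda>a x. g (a, V +>\<^bsub>Ms\<^esub> x))"
  have F_carr: "F a x \<in> unit_group vL 1" if "a \<in> carrier D" "x \<in> carrier Ms" for a x
    using g that by (auto simp: F_def fmod_hom_def carrN U_mod_def)
  have F_add: "F (a \<oplus>\<^bsub>D\<^esub> b) (x \<oplus>\<^bsub>Ms\<^esub> y) = F a x * F b y"
    if "a \<in> carrier D" "x \<in> carrier Ms" "b \<in> carrier D" "y \<in> carrier Ms" for a b x y
    using g that by (auto simp: F_def addN[symmetric] fmod_hom_def carrN U_mod_def)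
  have F_surj: "\<exists>a\<in>carrier D. \<exists>x\<in>carrier Ms. F a x = u" if "u \<in> unit_group vL 1" for u
  proof -
    have "h u \<in> carrier ?N" using h that by (auto simp: fmod_hom_def U_mod_def)
    moreover have "g (h u) = u" using gh that by (simp add: U_mod_def)
    ultimately show ?thesis unfolding F_def carrN by force
  qed
  have F_shift: "F a (\<lambda>j\<in>?T. c * ?w j + x j) = F a x" if "c \<in> ?O" for a c x
    using cyclic_coset_shift[OF vQ that, of \<rho> ?w x] by (simp add: F_def V_def Ms_def)
  have F_inj: "a = b \<and> (\<exists>c\<in>?O. y = (\<lambda>j\<in>?T. c * ?w j + x j))"
    if "a \<in> carrier D" "x \<in> carrier Ms" "b \<in> carrier D" "y \<in> carrier Ms" "F a x = F b y" for a b x y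
  proof -
    have "h (F a x) = h (F b y)" using that by simp
    then have "a = b" "V +>\<^bsub>Ms\<^esub> x = V +>\<^bsub>Ms\<^esub> y"
      using hg[of "(a, V +>\<^bsub>Ms\<^esub> x)"] hg[of "(b, V +>\<^bsub>Ms\<^esub> y)"] that by (auto simp: F_def carrN)
    then show ?thesis using cyclic_coset_eqD[OF vQ, of y \<rho> ?w x] that by (simp add: V_def Ms_def)
  qed
  have F_filt: "F a x \<in> unit_group vL k" if "a \<in> filt D k" "x \<in> filt Ms k" for a x
  proof -
    have "g ` filt ?N k \<subseteq> unit_group vL k" using g k by (auto simp: fmod_hom_def U_mod_def)
    moreover have "(a, V +>\<^bsub>Ms\<^esub> x) \<in> filt ?N k" using that by (simp add: filtN)
    ultimately show ?thesis by (auto simp: F_def)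
  qed
  have F_filtD: "\<exists>c\<in>?O. (\<lambda>j\<in>?T. c * ?w j + x j) \<in> filt Ms k"
    if "a \<in> carrier D" "x \<in> carrier Ms" "F a x \<in> unit_group vL k" for a x
  proof -
    have "h ` unit_group vL k \<subseteq> filt ?N k" using h k by (auto simp: fmod_hom_def U_mod_def)
    then have "h (F a x) \<in> filt ?N k" using that by blast
    moreover have "h (F a x) = (a, V +>\<^bsub>Ms\<^esub> x)" using hg that by (simp add: F_def carrN)
    ultimately obtain y where y: "y \<in> filt Ms k" "V +>\<^bsub>Ms\<^esub> x = V +>\<^bsub>Ms\<^esub> y" by (auto simp: filtN)
    then show ?thesis using cyclic_coset_eqD[OF vQ, of y \<rho> ?w x] filt_sub by (auto simp: V_def Ms_def)
  qed
  \<comment> \<open>m-fold multiples written out in coordinates; additivity of \<open>F\<close>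
    turns them into m-th powers by induction, and m = 0 gives the zero vector.\<close>
  define mD where "mD = (\<lambda>m a. \<lambda>i\<in>J. \<lambda>j\<in>T_set \<rho>. (of_nat m :: 'q) * a i j)"
  define mM where "mM = (\<lambda>m x. \<lambda>j\<in>?T. (of_nat m :: 'q) * x j)"
  have mD_carr: "mD m a \<in> carrier D" if "a \<in> carrier D" for m a
    using that unfolding D_def M_rho_power_simps mD_def
    by (intro restrict_PiE_iff[THEN iffD2] ballI Q.max_pow_mult_left Q.of_nat_in_val_ring) (blast dest: PiE_mem)
  have mM_carr: "mM m x \<in> carrier Ms" if "x \<in> carrier Ms" for m x
    using that unfolding Ms_def M_rho_star_simps mM_def
    by (intro restrict_PiE_iff[THEN iffD2] ballI Q.max_pow_mult_left Q.of_nat_in_val_ring) (blast dest: PiE_mem)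
  have add_carr: "x \<oplus>\<^bsub>Ms\<^esub> y \<in> carrier Ms" if "x \<in> carrier Ms" "y \<in> carrier Ms" for x y
    using that unfolding Ms_def M_rho_star_simps
    by (intro restrict_PiE_iff[THEN iffD2] ballI Q.max_pow_add) (blast dest: PiE_mem)+
  have addD_carr: "x \<oplus>\<^bsub>D\<^esub> y \<in> carrier D" if "x \<in> carrier D" "y \<in> carrier D" for x y
    using that unfolding D_def M_rho_power_simps
    by (intro restrict_PiE_iff[THEN iffD2] ballI Q.max_pow_add) (blast dest: PiE_mem)+
  have mD_Suc: "mD (Suc m) a = a \<oplus>\<^bsub>D\<^esub> mD m a" and mM_Suc: "mM (Suc m) x = x \<oplus>\<^bsub>Ms\<^esub> mM m x" for m a x
    by (auto simp: mD_def mM_def D_def Ms_def M_rho_power_simps M_rho_star_simps fun_eq_iff algebra_simps)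
  have F_0: "F (mD 0 a) (mM 0 x) = 1" if "a \<in> carrier D" "x \<in> carrier Ms" for a x
  proof -
    have "mD 0 a \<oplus>\<^bsub>D\<^esub> mD 0 a = mD 0 a" "mM 0 x \<oplus>\<^bsub>Ms\<^esub> mM 0 x = mM 0 x"
      by (auto simp: mD_def mM_def D_def Ms_def M_rho_power_simps M_rho_star_simps fun_eq_iff)
    then have "F (mD 0 a) (mM 0 x) * F (mD 0 a) (mM 0 x) = F (mD 0 a) (mM 0 x)"
      using F_add[of "mD 0 a" "mM 0 x" "mD 0 a" "mM 0 x"] mD_carr mM_carr that by simp
    moreover have "F (mD 0 a) (mM 0 x) \<noteq> 0"
      using L.unit_group_nonzero[of 1] F_carr mD_carr mM_carr that by simp
    ultimately show ?thesis by simp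
  qed
  have F_pow: "F (mD m a) (mM m x) = F a x ^ m" if "a \<in> carrier D" "x \<in> carrier Ms" for m a x
  proof (induction m)
    case (Suc m)
    then show ?case using F_add[of a x "mD m a" "mM m x"] that mD_carr mM_carr by (simp add: mD_Suc mM_Suc)
  qed (simp add: F_0 that)

  obtain a1 a2 where a: "a1 \<in> carrier D" "a2 \<in> carrier Ms" and za: "F a1 a2 = z"
    using F_surj[OF z(3)] by blast
  \<comment> \<open>Both sides are 1, so p times the vector of z is a multiple c of
    \<open>?w\<close>. The summand D is free of torsion, hence \<open>a1\<close> vanishes.\<close>
  have "F (mD p a1) (mM p a2) = F (mD 0 a1) (mM 0 a2)"
    using F_pow[OF a, of p] F_0[OF a] z(1) za by simp
  then have "mD 0 a1 = mD p a1 \<and> (\<exists>c\<in>?O. mM p a2 = (\<lambda>j\<in>?T. c * ?w j + mM 0 a2 j))"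
    using F_inj[of "mD 0 a1" "mM 0 a2" "mD p a1" "mM p a2"] mD_carr mM_carr a by simp
  then obtain c where c: "c \<in> ?O" and mp: "mD 0 a1 = mD p a1"
    "mM p a2 = (\<lambda>j\<in>?T. c * ?w j + mM 0 a2 j)" by blast
  have a1_0: "a1 = mD 0 a1"
  proof (intro ext)
    fix i j
    have "mD 0 a1 i j = mD p a1 i j" using mp by simp
    then show "a1 i j = mD 0 a1 i j"
      using a(1) p0 by (auto simp: mD_def D_def M_rho_power_simps PiE_iff extensional_def split: if_splits)
  qed
  have a2_c: "a2 j = (if j \<in> I then c * of_nat p ^ (\<beta> j - 1) else 0)" if j: "j \<in> ?T" for j
  proof -
    have "of_nat p * a2 j = c * ?w j" using fun_cong[OF mp(2), of j] j by (simp add: mM_def)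
    then show ?thesis using w[OF j] p0 ppow[of j] by (cases "j \<in> I") auto
  qed
  \<comment> \<open>If p divided c, the vector of z would itself be the multiple c/p of
    \<open>?w\<close>, forcing z = 1.\<close>
  have c_unit: "c \<noteq> 0 \<and> vQ c = 0"
  proof (rule ccontr)
    assume "\<not> ?thesis"
    then have "c \<in> max_pow vQ 1" using c by (auto simp: max_pow_def)
    then have cp: "c / of_nat p \<in> ?O"
      using p0 vp by (cases "c = 0") (auto simp: max_pow_def Q.val_divide)
    have "a2 = (\<lambda>j\<in>?T. c / of_nat p * ?w j + mM 0 a2 j)"
    proof
      fix j
      show "a2 j = (\<lambda>j\<in>?T. c / of_nat p * ?w j + mM 0 a2 j) j"
        using a(2) a2_c[of j] w[of j] p0 ppow[of j]
        by (cases "j \<in> ?T"; cases "j \<in> I") (auto simp: mM_def Ms_def M_rho_star_simps PiE_iff extensional_def)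
    qed
    then have "F a1 a2 = F (mD 0 a1) (mM 0 a2)" using F_shift[OF cp, of a1 "mM 0 a2"] a1_0 by simp
    then show False using F_0[OF a] za z(2) by simp
  qed
  show ?thesis
  proof
    assume "\<exists>u\<in>unit_group vL 1. z * u ^ p ^ s \<in> unit_group vL k"
    then obtain u where u: "u \<in> unit_group vL 1" "z * u ^ p ^ s \<in> unit_group vL k" by blast
    obtain b1 b2 where b: "b1 \<in> carrier D" "b2 \<in> carrier Ms" "F b1 b2 = u" using F_surj u(1) by blast
    have "F (a1 \<oplus>\<^bsub>D\<^esub> mD (p ^ s) b1) (a2 \<oplus>\<^bsub>Ms\<^esub> mM (p ^ s) b2) = z * u ^ p ^ s"
      using F_add a b mD_carr mM_carr za F_pow by simp
    then obtain c' where c': "c' \<in> ?O"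
      "(\<lambda>j\<in>?T. c' * ?w j + (a2 \<oplus>\<^bsub>Ms\<^esub> mM (p ^ s) b2) j) \<in> filt Ms k"
      using F_filtD[of "a1 \<oplus>\<^bsub>D\<^esub> mD (p ^ s) b1" "a2 \<oplus>\<^bsub>Ms\<^esub> mM (p ^ s) b2"] u a b mD_carr mM_carr
        add_carr addD_carr by auto
    show "\<forall>i\<in>I. \<beta> i \<le> s \<longrightarrow> k \<le> (\<rho> ^^ (\<beta> i - 1)) i"
    proof (intro ballI impI)
      fix i assume i: "i \<in> I" "\<beta> i \<le> s"
      then have iT: "i \<in> ?T" using IT by blast
      \<comment> \<open>Entry i of a general representative of z u^(p^s) is ?y + ?r. Here ?y has
        order exactly \<beta>(i) - 1, and ?r has order at least \<beta>(i) because \<beta>(i) \<le>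
        s.\<close>
      let ?y = "c * of_nat p ^ (\<beta> i - 1)" and ?r = "of_nat p ^ s * b2 i + c' * of_nat p ^ \<beta> i"
      have y: "?y \<noteq> 0" "vQ ?y = int (\<beta> i - 1)" using c_unit p0 vpp by (auto simp: Q.val_mult)
      have "b2 i \<in> ?O" using b(2) iT by (auto simp: Ms_def M_rho_star_simps)
      moreover have "of_nat p ^ s \<in> max_pow vQ (int (\<beta> i))" "of_nat p ^ \<beta> i \<in> max_pow vQ (int (\<beta> i))"
        using vpp i by (auto simp: max_pow_def)
      ultimately have "?r \<in> max_pow vQ (vQ ?y + 1)"
        using y(2) beta1[OF i(1)] c'(1) Q.max_pow_add Q.max_pow_mult_left Q.max_pow_mult_right by simp
      then have yr: "?y + ?r \<noteq> 0" "vQ (?y + ?r) = int (\<beta> i - 1)" using Q.val_add_eq[OF y(1)] y(2) by auto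
      have "(\<lambda>j\<in>?T. c' * ?w j + (a2 \<oplus>\<^bsub>Ms\<^esub> mM (p ^ s) b2) j) i = ?y + ?r"
        using iT i a2_c[OF iT] w[OF iT] by (simp add: Ms_def M_rho_star_simps mM_def)
      then show "k \<le> (\<rho> ^^ (\<beta> i - 1)) i"
        using filt_Ms[OF c'(2) iT] yr by (simp only: nat_int) blast
    qed
  next
    assume le: "\<forall>i\<in>I. \<beta> i \<le> s \<longrightarrow> k \<le> (\<rho> ^^ (\<beta> i - 1)) i"
    \<comment> \<open>Chosen so that p^s times it cancels the entries of \<open>a2\<close> with s <
      \<beta>(j), where \<beta>(j) - 1 - s is a true difference.\<close>
    define b2 where "b2 = (\<lambda>j\<in>?T. if j \<in> I \<and> s < \<beta> j then - (c * of_nat p ^ (\<beta> j - 1 - s)) else 0)"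
    have b2: "b2 \<in> carrier Ms"
      using c by (auto simp: b2_def Ms_def M_rho_star_simps intro!: Q.max_pow_mult_left Q.val_ring_power)
    have "a2 \<oplus>\<^bsub>Ms\<^esub> mM (p ^ s) b2 \<in> filt Ms k"
      unfolding Ms_def M_rho_star_simps
    proof (rule PiE_I)
      fix j assume j: "j \<in> ?T"
      have "of_nat p ^ s * of_nat p ^ (\<beta> j - 1 - s) = (of_nat p ^ (\<beta> j - 1) :: 'q)" if "s < \<beta> j"
        using that by (simp add: power_add[symmetric])
      then have eq: "(\<lambda>j\<in>?T. a2 j + mM (p ^ s) b2 j) j
          = (if j \<in> I \<and> \<beta> j \<le> s then c * of_nat p ^ (\<beta> j - 1) else 0)"
        using j a2_c[OF j] by (auto simp: mM_def b2_def mult.left_commute)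
      have "vQ (c * of_nat p ^ (\<beta> j - 1)) = int (\<beta> j - 1)"
        using c_unit p0 vpp by (auto simp: Q.val_mult)
      then show "(\<lambda>j\<in>?T. a2 j + mM (p ^ s) b2 j) j \<in> {x \<in> ?O. x = 0 \<or> k \<le> (\<rho> ^^ nat (vQ x)) j}"
        unfolding eq using le c by (auto intro!: Q.max_pow_mult_left Q.val_ring_power)
    qed auto
    moreover have "a1 \<oplus>\<^bsub>D\<^esub> mD (p ^ s) a1 \<in> filt D k"
      using a1_0 by (auto simp: D_def M_rho_power_simps mD_def fun_eq_iff)
    ultimately have "F (a1 \<oplus>\<^bsub>D\<^esub> mD (p ^ s) a1) (a2 \<oplus>\<^bsub>Ms\<^esub> mM (p ^ s) b2) \<in> unit_group vL k"
      using F_filt by blast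
    moreover have "F (a1 \<oplus>\<^bsub>D\<^esub> mD (p ^ s) a1) (a2 \<oplus>\<^bsub>Ms\<^esub> mM (p ^ s) b2) = z * F a1 b2 ^ p ^ s"
      using F_add a b2 mD_carr mM_carr za F_pow by simp
    ultimately show "\<exists>u\<in>unit_group vL 1. z * u ^ p ^ s \<in> unit_group vL k"
      using F_carr[OF a(1) b2] by auto
  qed
qed

section \<open>Frobenius congruences\<close>

context nval
begin

lemma power_cong:
  assumes "x \<in> max_pow v 0" "y \<in> max_pow v 0" "x - y \<in> max_pow v k"
  shows "x ^ m - y ^ m \<in> max_pow v k"
proof (induction m)
  case (Suc m)
  have "x ^ Suc m - y ^ Suc m = x * (x ^ m - y ^ m) + (x - y) * y ^ m" by (simp add: algebra_simps)
  then show ?case using Suc assms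
    by (auto intro!: max_pow_add max_pow_mult_left[of x] max_pow_mult_right[of "x - y"] val_ring_power)
qed simp

lemma frobenius_add_cong:
  assumes p: "prime p" "of_nat p \<in> max_pow v k" and k: "0 \<le> k"
    and xy: "x \<in> max_pow v 0" "y \<in> max_pow v 0"
  shows "(x + y) ^ p ^ m - (x ^ p ^ m + y ^ p ^ m) \<in> max_pow v k"
proof (induction m)
  case (Suc m)
  let ?X = "x ^ p ^ m" and ?Y = "y ^ p ^ m" and ?S = "(x + y) ^ p ^ m"
  have O: "?X \<in> max_pow v 0" "?Y \<in> max_pow v 0" "?S \<in> max_pow v 0" "?X + ?Y \<in> max_pow v 0"
    using xy by (auto intro!: val_ring_power max_pow_add)
  have 1: "?S ^ p - (?X + ?Y) ^ p \<in> max_pow v k" by (rule power_cong) (use O Suc in auto)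
  obtain w where w: "w \<in> max_pow v 0" "(?X + ?Y) ^ p = ?X ^ p + ?Y ^ p + of_nat p * ?X * ?Y * w"
    using binomial_prime_cong[OF p(1) O(1,2)] by blast
  have "of_nat p * ?X * ?Y * w \<in> max_pow v k" using p w O by (auto intro!: max_pow_mult_right)
  then have "?S ^ p - (?X + ?Y) ^ p + of_nat p * ?X * ?Y * w \<in> max_pow v k" using 1 max_pow_add by blast
  moreover have "?S ^ p - (?X ^ p + ?Y ^ p) = ?S ^ p - (?X + ?Y) ^ p + of_nat p * ?X * ?Y * w"
    unfolding w(2) by (simp add: algebra_simps)
  ultimately have "?S ^ p - (?X ^ p + ?Y ^ p) \<in> max_pow v k" by (simp only:)
  moreover have "z ^ p ^ Suc m = (z ^ p ^ m) ^ p" for z :: 'a by (simp only: power_Suc2 power_mult)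
  ultimately show ?case by (simp only:)
qed simp

lemma frobenius_diff_cong:
  assumes "prime p" "of_nat p \<in> max_pow v k" "0 \<le> k" "x \<in> max_pow v 0" "y \<in> max_pow v 0"
  shows "x ^ p ^ m - y ^ p ^ m - (x - y) ^ p ^ m \<in> max_pow v k"
  using frobenius_add_cong[OF assms(1-3) max_pow_diff[OF assms(4,5)] assms(5), of m]
  by (simp add: algebra_simps)

lemma in_max_pow_1_of_power:
  assumes "x ^ m \<in> max_pow v 1" "x \<in> max_pow v 0" shows "x \<in> max_pow v 1"
proof (cases "x = 0")
  case False
  then have "int m * v x \<ge> 1" "v x \<ge> 0" using assms by (auto simp: max_pow_def val_power)
  then have "v x \<noteq> 0" by auto
  then show ?thesis using \<open>v x \<ge> 0\<close> by (simp add: max_pow_def)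
qed simp

text \<open>Pigeonhole in a compact neighbourhood of \<open>0\<close>, instead of finiteness of the residue field.\<close>

lemma pigeonhole_residue:
  assumes lc: "local_field v" and s: "\<And>i. s i \<in> max_pow v 0"
  shows "\<exists>i j::nat. i < j \<and> s i - s j \<in> max_pow v 1"
proof -
  interpret M: Metric_space UNIV "vdist v" by (rule Metric_space_vdist[OF nval])
  have "locally_compact_space M.mtopology" using lc by (simp add: local_field_def)
  then have "\<exists>U C. openin M.mtopology U \<and> compactin M.mtopology C \<and> 0 \<in> U \<and> U \<subseteq> C"
    unfolding locally_compact_space_def M.topspace_mtopology by (rule bspec) simp
  then obtain U C where UC: "openin M.mtopology U" "compactin M.mtopology C" "0 \<in> U" "U \<subseteq> C"
    by blast
  then obtain r where r: "r > 0" "M.mball 0 r \<subseteq> U" by (auto simp: M.openin_mtopology)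
  obtain N where N: "(1 / 2) ^ N < r" using real_arch_pow_inv[OF r(1), of "1 / 2"] by auto
  have small: "2 powr (- real_of_int t) < r" if "t \<ge> int N" for t
  proof -
    have "2 powr (- real_of_int t) \<le> (2::real) powr (- real N)" using that by simp
    also have "\<dots> = (1 / 2) ^ N" by (simp add: powr_minus powr_realpow power_one_over inverse_eq_divide)
    finally show ?thesis using N by simp
  qed
  obtain c1 where c1: "c1 \<noteq> 0" "v c1 = 1" using ex_uniformizer by blast
  \<comment> \<open>Scaling by an element of valuation N moves the valuation ring into the compact
    set C, where total boundedness applies.\<close>
  define c where "c = c1 ^ N"
  have c: "c \<noteq> 0" "v c = int N" using c1 by (auto simp: c_def val_power)
  have "c * s i \<in> C" for i
  proof (cases "s i = 0")
    case False
    then have "v (c * s i) \<ge> int N" using s[of i] c by (simp add: max_pow_def val_mult)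
    then have "vdist v 0 (c * s i) < r" using small c False by (simp add: vdist_def)
    then show ?thesis using r UC by auto
  qed (use UC in auto)
  then have rng: "range (\<lambda>i. c * s i) \<subseteq> C" by auto
  \<comment> \<open>Distance below 2^(-N) means valuation at least N + 1, of which 1 remains after
    dividing by c.\<close>
  define \<epsilon> :: real where "\<epsilon> = 2 powr (- real N)"
  have "M.mtotally_bounded C" using UC M.compactin_imp_mtotally_bounded by blast
  moreover have "\<epsilon> > 0" by (simp add: \<epsilon>_def)
  ultimately obtain K where K: "finite K" "C \<subseteq> (\<Union>x\<in>K. M.mball x \<epsilon>)"
    unfolding M.mtotally_bounded_def by blast
  have "\<exists>f. \<forall>i. f i \<in> K \<and> c * s i \<in> M.mball (f i) \<epsilon>" using rng K by (intro choice) blast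
  then obtain f where f: "\<And>i. f i \<in> K" "\<And>i. c * s i \<in> M.mball (f i) \<epsilon>" by blast
  have "\<not> inj f"
  proof
    assume "inj f"
    moreover have "finite (range f)" using K(1) f(1) by (meson finite_subset image_subsetI)
    ultimately show False using finite_imageD by blast
  qed
  then obtain i j where ij: "i < j" "f i = f j" unfolding inj_on_def by (metis linorder_neqE_nat)
  have near: "f i - c * s k \<in> max_pow v (int N + 1)" if "c * s k \<in> M.mball (f i) \<epsilon>" for k
  proof (cases "f i = c * s k")
    case False
    then have "2 powr (- real_of_int (v (f i - c * s k))) < (2::real) powr (- real N)"
      using that by (simp add: vdist_def \<epsilon>_def)
    then show ?thesis by (simp add: max_pow_def)
  qed simp
  have "(f i - c * s j) - (f i - c * s i) \<in> max_pow v (int N + 1)"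
    using near[of i] near[of j] f(2)[of i] f(2)[of j] ij(2) max_pow_diff by metis
  then have "c * (s i - s j) \<in> max_pow v (int N + 1)" by (simp add: algebra_simps)
  then have "s i - s j \<in> max_pow v 1" using c by (cases "s i = s j") (auto simp: max_pow_def val_mult)
  then show ?thesis using ij(1) by blast
qed

text \<open>Among the powers a^(p^i) two agree modulo the maximal ideal. Injectivity of Frobenius on
  residues removes the smaller exponent and leaves a = a^(p^d) there with d \<ge> 1. Hence a =
  a^(p^(dm)), and d m \<ge> m exhibits a p^m-th power.\<close>

lemma residue_perfect:
  assumes lc: "local_field v" and p: "prime p" "of_nat p \<in> max_pow v 1" and a: "a \<in> max_pow v 0"
  shows "\<exists>b\<in>max_pow v 0. a - b ^ p ^ m \<in> max_pow v 1"
proof -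
  obtain i j :: nat where ij: "i < j" "a ^ p ^ i - a ^ p ^ j \<in> max_pow v 1"
    using pigeonhole_residue[OF lc, of "\<lambda>i. a ^ p ^ i"] a val_ring_power by blast
  define d where "d = j - i"
  have d: "d \<ge> 1" "j = d + i" using ij by (auto simp: d_def)
  let ?b = "a ^ p ^ d"
  have b: "?b \<in> max_pow v 0" using a val_ring_power by blast
  have pj: "a ^ p ^ j = ?b ^ p ^ i" by (simp add: d power_add power_mult)
  have "a ^ p ^ i - ?b ^ p ^ i - (a - ?b) ^ p ^ i \<in> max_pow v 1"
    by (rule frobenius_diff_cong[OF p _ a b]) simp
  then have "(a - ?b) ^ p ^ i \<in> max_pow v 1"
    using max_pow_diff[OF ij(2)[unfolded pj], of "a ^ p ^ i - ?b ^ p ^ i - (a - ?b) ^ p ^ i"] by simp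
  then have ab: "a - ?b \<in> max_pow v 1" by (rule in_max_pow_1_of_power) (use max_pow_diff a b in blast)
  have *: "a - a ^ p ^ (d * t) \<in> max_pow v 1" for t
  proof (induction t)
    case (Suc t)
    have "a ^ p ^ (d * t) - ?b ^ p ^ (d * t) \<in> max_pow v 1" by (rule power_cong[OF a b ab])
    then have "(a - a ^ p ^ (d * t)) + (a ^ p ^ (d * t) - ?b ^ p ^ (d * t)) \<in> max_pow v 1"
      using Suc max_pow_add by blast
    then show ?case by (simp add: power_add power_mult)
  qed simp
  have "d * m = (d - 1) * m + m" using d by (simp add: algebra_simps)
  then have "a ^ p ^ (d * m) = (a ^ p ^ ((d - 1) * m)) ^ p ^ m" by (simp add: power_add power_mult)
  then show ?thesis using *[of m] a val_ring_power by (intro bexI[of _ "a ^ p ^ ((d - 1) * m)"]) auto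
qed

end

section \<open>Extensions of valued fields\<close>

lemma field_embedding_simps:
  assumes "field_embedding \<iota>"
  shows "\<iota> 0 = 0" "\<iota> 1 = 1" "\<iota> (x + y) = \<iota> x + \<iota> y" "\<iota> (x * y) = \<iota> x * \<iota> y"
    "\<iota> (- x) = - \<iota> x" "\<iota> (x - y) = \<iota> x - \<iota> y" "\<iota> (x ^ k) = \<iota> x ^ k" "\<iota> (of_nat m) = of_nat m"
    "\<iota> (sum f J) = (\<Sum>j\<in>J. \<iota> (f j))" "\<iota> x = 0 \<longleftrightarrow> x = 0"
proof -
  have add: "\<iota> (x + y) = \<iota> x + \<iota> y" and mult: "\<iota> (x * y) = \<iota> x * \<iota> y" and one: "\<iota> 1 = 1" for x y
    using assms by (simp_all add: field_embedding_def)
  have "\<iota> 0 + \<iota> 0 = \<iota> 0 + 0" using add[of 0 0] by (simp only: add_0_right)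
  then show zero: "\<iota> 0 = 0" by (simp only: add_left_cancel)
  show minus: "\<iota> (- x) = - \<iota> x" for x using add[of x "- x"] zero by (simp add: eq_neg_iff_add_eq_0 add.commute)
  show "\<iota> (x + y) = \<iota> x + \<iota> y" "\<iota> (x * y) = \<iota> x * \<iota> y" "\<iota> 1 = 1" by fact+
  show "\<iota> (x - y) = \<iota> x - \<iota> y" using add[of x "- y"] minus by simp
  show "\<iota> (x ^ k) = \<iota> x ^ k" by (induction k) (simp_all add: one mult)
  show "\<iota> (of_nat m) = of_nat m" by (induction m) (simp_all add: one add zero)
  show "\<iota> (sum f J) = (\<Sum>j\<in>J. \<iota> (f j))" by (induction J rule: infinite_finite_induct) (simp_all add: zero add)
  show "\<iota> x = 0 \<longleftrightarrow> x = 0" using mult[of x "inverse x"] one zero by (cases "x = 0") auto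
qed

text \<open>Serves all three layers Q_p in F, F in K and K in L, so finiteness and degree are left
  to the individual lemmas; equality of \<open>e\<close> with the degree is assumed where total
  ramification provides it.\<close>

locale val_extension = K: nval vK + L: nval vL
  for vK :: "'k::field \<Rightarrow> int" and vL :: "'l::field \<Rightarrow> int" +
  fixes \<iota> :: "'k \<Rightarrow> 'l" and e :: nat
  assumes emb: "field_embedding \<iota>" and e_pos: "0 < e"
    and val_emb: "x \<noteq> 0 \<Longrightarrow> vL (\<iota> x) = int e * vK x"
begin

sublocale V: vector_space "ext_scale \<iota>"
  by (rule vector_space_ext_scale[OF emb])

lemmas emb_simps [simp] = field_embedding_simps[OF emb]

lemma emb_max_pow: "a \<in> max_pow vK i \<Longrightarrow> \<iota> a \<in> max_pow vL (int e * i)"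
  using e_pos by (cases "a = 0") (auto simp: max_pow_def val_emb)

text \<open>The valuations e v(b_j) + j are pairwise distinct because the j are distinct modulo e,
  so no cancellation occurs. The window may start at any m: 0..e-1 serves for power bases, 1..e for
  relations read off an Eisenstein equation.\<close>

lemma val_power_sum:
  assumes pi: "\<pi> \<noteq> 0" "vL \<pi> = 1" and J: "finite J" "J \<noteq> {}" "\<And>j. j \<in> J \<Longrightarrow> b j \<noteq> 0" "J \<subseteq> {m..<m + e}"
  shows "(\<Sum>j\<in>J. \<iota> (b j) * \<pi> ^ j) \<noteq> 0 \<and>
         vL (\<Sum>j\<in>J. \<iota> (b j) * \<pi> ^ j) = Min ((\<lambda>j. int e * vK (b j) + int j) ` J)"
proof -
  have val: "vL (\<iota> (b j) * \<pi> ^ j) = int e * vK (b j) + int j" if "j \<in> J" for j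
    using that J(3) pi by (simp add: L.val_mult L.val_power val_emb)
  have "inj_on (\<lambda>j. vL (\<iota> (b j) * \<pi> ^ j)) J"
  proof (rule inj_onI)
    fix i j assume ij: "i \<in> J" "j \<in> J" "vL (\<iota> (b i) * \<pi> ^ i) = vL (\<iota> (b j) * \<pi> ^ j)"
    then have eq: "int e * vK (b i) + int i = int e * vK (b j) + int j" using val by metis
    then have "int e * (vK (b i) - vK (b j)) = int j - int i" by (simp add: algebra_simps)
    moreover have "\<bar>int j - int i\<bar> < int e" using subsetD[OF J(4) ij(1)] subsetD[OF J(4) ij(2)] by auto
    ultimately have "\<bar>vK (b i) - vK (b j)\<bar> * int e < 1 * int e" by (simp add: abs_mult mult.commute)
    then have "\<bar>vK (b i) - vK (b j)\<bar> < 1" using e_pos mult_right_less_imp_less by (metis of_nat_0_le_iff)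
    then show "i = j" using eq by simp
  qed
  then have "(\<Sum>j\<in>J. \<iota> (b j) * \<pi> ^ j) \<noteq> 0 \<and> vL (\<Sum>j\<in>J. \<iota> (b j) * \<pi> ^ j) = Min ((\<lambda>j. vL (\<iota> (b j) * \<pi> ^ j)) ` J)"
    by (intro L.val_sum_distinct J) (use J pi in auto)
  also have "(\<lambda>j. vL (\<iota> (b j) * \<pi> ^ j)) ` J = (\<lambda>j. int e * vK (b j) + int j) ` J" using val by simp
  finally show ?thesis .
qed

lemma power_sum_eq_0_iff:
  assumes pi: "\<pi> \<noteq> 0" "vL \<pi> = 1"
  shows "(\<Sum>j<e. \<iota> (b j) * \<pi> ^ j) = 0 \<longleftrightarrow> (\<forall>j<e. b j = 0)"
proof
  assume z: "(\<Sum>j<e. \<iota> (b j) * \<pi> ^ j) = 0"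
  show "\<forall>j<e. b j = 0"
  proof (rule ccontr)
    assume "\<not> (\<forall>j<e. b j = 0)"
    then have "{j. j < e \<and> b j \<noteq> 0} \<noteq> {}" by blast
    then have "(\<Sum>j | j < e \<and> b j \<noteq> 0. \<iota> (b j) * \<pi> ^ j) \<noteq> 0"
      by (intro val_power_sum[OF pi, where m = 0, THEN conjunct1]) auto
    moreover have "(\<Sum>j | j < e \<and> b j \<noteq> 0. \<iota> (b j) * \<pi> ^ j) = (\<Sum>j<e. \<iota> (b j) * \<pi> ^ j)"
      by (rule sum.mono_neutral_left) auto
    ultimately show False using z by (simp only: not_False_eq_True simp_thms)
  qed
qed simp

lemma inj_powers: assumes "\<pi> \<noteq> 0" "vL \<pi> = 1" shows "inj_on (\<lambda>j. \<pi> ^ j) A"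
proof (rule inj_onI)
  fix i j assume "\<pi> ^ i = \<pi> ^ j"
  then have "vL (\<pi> ^ i) = vL (\<pi> ^ j)" by simp
  then show "i = j" using assms by (simp add: L.val_power)
qed

lemma powers_independent:
  assumes pi: "\<pi> \<noteq> 0" "vL \<pi> = 1"
  shows "\<not> V.dependent ((\<lambda>j. \<pi> ^ j) ` {..<e})"
proof
  note inj = inj_powers[OF pi, of "{..<e}"]
  assume "V.dependent ((\<lambda>j. \<pi> ^ j) ` {..<e})"
  then obtain u where u: "\<exists>x\<in>(\<lambda>j. \<pi> ^ j) ` {..<e}. u x \<noteq> 0"
    "(\<Sum>x\<in>(\<lambda>j. \<pi> ^ j) ` {..<e}. ext_scale \<iota> (u x) x) = 0"
    using V.dependent_finite[of "(\<lambda>j. \<pi> ^ j) ` {..<e}"] by blast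
  from u(2) have "(\<Sum>j<e. \<iota> (u (\<pi> ^ j)) * \<pi> ^ j) = 0"
    by (simp only: sum.reindex[OF inj] ext_scale_def o_def)
  then show False using power_sum_eq_0_iff[OF pi, of "\<lambda>j. u (\<pi> ^ j)"] u(1) by auto
qed

text \<open>The powers of a uniformizer with exponent below e are independent. This gives the upper
  bound e \<le> p - 1 in the cyclotomic layer.\<close>

lemma ram_index_le_card:
  assumes "finite S" "V.span S = UNIV" shows "e \<le> card S"
proof -
  obtain \<pi> where pi: "\<pi> \<noteq> 0" "vL \<pi> = 1" using L.ex_uniformizer by blast
  have "card ((\<lambda>j. \<pi> ^ j) ` {..<e}) \<le> card S"
    using V.independent_span_bound[OF assms(1) powers_independent[OF pi]] assms(2) by simp
  then show ?thesis using card_image[OF inj_powers[OF pi]] by simp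
qed

lemma ram_index_eq: "ram_index vK vL \<iota> = e"
  unfolding ram_index_def
proof (rule the_equality)
  obtain x where x: "x \<noteq> 0" "vK x = 1" using K.ex_uniformizer by blast
  fix e' assume "\<forall>x. x \<noteq> 0 \<longrightarrow> vL (\<iota> x) = int e' * vK x"
  then show "e' = e" using x val_emb[OF x(1)] by simp
qed (simp add: val_emb)

lemma power_basis:
  assumes pi: "\<pi> \<noteq> 0" "vL \<pi> = 1" and fin: "finite B0" "V.span B0 = UNIV" and deg: "ext_degree \<iota> = e"
  shows "\<exists>c. y = (\<Sum>j<e. \<iota> (c j) * \<pi> ^ j)"
proof -
  let ?P = "(\<lambda>j. \<pi> ^ j) ` {..<e}"
  note inj = inj_powers[OF pi, of "{..<e}"]
  obtain B where B: "\<not> V.dependent B" "UNIV \<subseteq> V.span B" "card B = V.dim UNIV"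
    by (rule V.basis_exists[of UNIV])
  have finB: "finite B"
    by (rule V.independent_span_bound[OF fin(1) B(1), THEN conjunct1]) (simp only: fin(2) subset_UNIV)
  have cB: "card B = e" using B(3) deg by (simp only: ext_degree_def)
  have "y \<in> V.span ?P"
  proof (rule ccontr)
    assume y: "y \<notin> V.span ?P"
    have "\<not> V.dependent (insert y ?P)" by (rule V.independent_insertI[OF y powers_independent[OF pi]])
    then have "card (insert y ?P) \<le> card B"
      by (rule V.independent_span_bound[OF finB, THEN conjunct2]) (use B(2) in blast)
    moreover have "card (insert y ?P) = Suc (card ?P)" by (rule card_insert_disjoint) (use y V.span_base in auto)
    ultimately show False unfolding cB card_image[OF inj] by simp
  qed
  also have "V.span ?P = range (\<lambda>u. \<Sum>x\<in>?P. ext_scale \<iota> (u x) x)" by (rule V.span_finite) simp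
  finally obtain u where "y = (\<Sum>x\<in>?P. ext_scale \<iota> (u x) x)" by (rule rangeE)
  then have "y = (\<Sum>j<e. \<iota> (u (\<pi> ^ j)) * \<pi> ^ j)"
    by (simp only: sum.reindex[OF inj] ext_scale_def o_def)
  then show ?thesis by (rule exI[of _ "\<lambda>j. u (\<pi> ^ j)"])
qed

end

section \<open>The cyclotomic layer\<close>

text \<open>The span W of 1, ..., \<zeta>^(p-2) contains \<zeta>^(p-1) by the vanishing geometric
  sum, so W is a ring; being finite-dimensional without zero divisors it is a field, hence
  everything. This bounds the degree by p - 1 from above; the matching lower bound comes from
  valuations.\<close>

lemma cyclotomic_spanning_set:
  assumes emb: "field_embedding \<iota>" and p: "prime p" and z: "\<zeta> ^ p = 1" "\<zeta> \<noteq> 1"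
    and gen: "adjoin (range \<iota>) \<zeta> = UNIV"
  shows "\<exists>S. finite S \<and> card S \<le> p - 1 \<and> Modules.module.span (ext_scale \<iota>) S = UNIV"
proof -
  interpret V: vector_space "ext_scale \<iota>" by (rule vector_space_ext_scale[OF emb])
  note emb_simps = field_embedding_simps[OF emb]
  have p2: "p \<ge> 2" using p prime_ge_2_nat by blast
  define Z where "Z = (\<lambda>i. \<zeta> ^ i) ` {..<p - 1}"
  let ?W = "V.span Z"
  have finZ: "finite Z" by (simp add: Z_def)
  have "(\<Sum>i<p. \<zeta> ^ i) = 0" using geometric_sum[of \<zeta> p] z by simp
  moreover have "{..<p} = insert (p - 1) {..<p - 1}" using p2 by auto
  ultimately have top: "\<zeta> ^ (p - 1) = - (\<Sum>i<p - 1. \<zeta> ^ i)" by (simp add: eq_neg_iff_add_eq_0)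
  have in_W: "\<zeta> ^ i \<in> ?W" if "i \<le> p - 1" for i
  proof (cases "i = p - 1")
    case True
    have "(\<Sum>i<p - 1. \<zeta> ^ i) \<in> ?W" by (intro V.span_sum V.span_base) (simp add: Z_def)
    then show ?thesis using top True V.span_neg by simp
  qed (use that in \<open>auto simp: Z_def intro!: V.span_base\<close>)
  have scale_W: "\<iota> c * x \<in> ?W" if "x \<in> ?W" for c x
    using V.span_scale[OF that, of c] by (simp add: ext_scale_def)
  have zeta_W: "\<zeta> * x \<in> ?W" if "x \<in> ?W" for x
    using that
  proof (induction rule: V.span_induct_alt)
    case (step c x y)
    then obtain i where i: "i < p - 1" "x = \<zeta> ^ i" by (auto simp: Z_def)
    have "\<zeta> ^ Suc i \<in> ?W" using i by (intro in_W) simp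
    then have "\<iota> c * \<zeta> ^ Suc i + \<zeta> * y \<in> ?W" using step V.span_add scale_W by blast
    moreover have "\<zeta> * (ext_scale \<iota> c x + y) = \<iota> c * \<zeta> ^ Suc i + \<zeta> * y"
      by (simp add: i ext_scale_def algebra_simps)
    ultimately show ?case by (simp only:)
  qed (simp add: V.span_zero)
  have zeta_pow_W: "\<zeta> ^ i * x \<in> ?W" if "x \<in> ?W" for i x
    by (induction i) (use that zeta_W in \<open>simp_all add: mult.assoc\<close>)
  have mult_W: "x * y \<in> ?W" if "x \<in> ?W" "y \<in> ?W" for x y
    using that(1)
  proof (induction rule: V.span_induct_alt)
    case (step c u w)
    then have "u * y \<in> ?W" using zeta_pow_W[OF that(2)] by (auto simp: Z_def)
    then have "\<iota> c * (u * y) + w * y \<in> ?W" using step V.span_add scale_W by blast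
    moreover have "(ext_scale \<iota> c u + w) * y = \<iota> c * (u * y) + w * y"
      by (simp add: ext_scale_def algebra_simps)
    ultimately show ?case by (simp only:)
  qed (simp add: V.span_zero)
  \<comment> \<open>Multiplication by x carries a basis B of W to an independent family of the same
    size inside W. If 1 were outside its span, adjoining it would exceed the dimension; so 1 is x
    times an element of W.\<close>
  have inverse_W: "inverse x \<in> ?W" if x: "x \<in> ?W" "x \<noteq> 0" for x
  proof -
    obtain B where B: "B \<subseteq> ?W" "\<not> V.dependent B" "?W \<subseteq> V.span B" by (rule V.maximal_independent_subset)
    then have finB: "finite B" using V.independent_span_bound[OF finZ B(2)] by simp
    have spanB: "V.span B = ?W" using B V.span_minimal[OF B(1) V.subspace_span] by blast
    have div: "inverse x * y \<in> V.span A" if "y \<in> V.span ((*) x ` A)" for y A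
      using that
    proof (induction rule: V.span_induct_alt)
      case (step c u w)
      then have "inverse x * u \<in> V.span A" using x(2) by (auto intro: V.span_base simp flip: mult.assoc)
      then have "ext_scale \<iota> c (inverse x * u) + inverse x * w \<in> V.span A"
        using step V.span_add V.span_scale by blast
      moreover have "inverse x * (ext_scale \<iota> c u + w) = ext_scale \<iota> c (inverse x * u) + inverse x * w"
        by (simp add: ext_scale_def algebra_simps)
      ultimately show ?case by (simp only:)
    qed (simp add: V.span_zero)
    have indep: "\<not> V.dependent ((*) x ` B)"
    proof
      assume "V.dependent ((*) x ` B)"
      then obtain b where b: "b \<in> B" "x * b \<in> V.span ((*) x ` B - {x * b})"
        unfolding V.dependent_def by blast
      have "(*) x ` B - {x * b} = (*) x ` (B - {b})" using x(2) by auto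
      then have "inverse x * (x * b) \<in> V.span (B - {b})" using div[of "x * b" "B - {b}"] b(2) by simp
      then have "b \<in> V.span (B - {b})" using x(2) by (simp flip: mult.assoc)
      then show False using B(2) b(1) unfolding V.dependent_def by blast
    qed
    have "1 \<in> V.span ((*) x ` B)"
    proof (rule ccontr)
      assume one: "1 \<notin> V.span ((*) x ` B)"
      have "\<not> V.dependent (insert 1 ((*) x ` B))" by (rule V.independent_insertI[OF one indep])
      moreover have "insert 1 ((*) x ` B) \<subseteq> V.span B"
        unfolding spanB using B(1) x(1) mult_W in_W[of 0] by auto
      ultimately have "card (insert 1 ((*) x ` B)) \<le> card B"
        by (intro V.independent_span_bound[OF finB, THEN conjunct2])
      moreover have "card (insert 1 ((*) x ` B)) = Suc (card ((*) x ` B))"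
        by (rule card_insert_disjoint) (use one V.span_base finB in auto)
      moreover have "card ((*) x ` B) = card B" using x(2) by (intro card_image inj_onI) simp
      ultimately show False by simp
    qed
    then show ?thesis using div[of 1 B] spanB by simp
  qed
  have "is_subfield ?W"
    unfolding is_subfield_def
  proof (intro conjI ballI)
    show "1 \<in> ?W" using in_W[of 0] by simp
    show "inverse x \<in> ?W" if "x \<in> ?W" for x
      using inverse_W[OF that] V.span_zero by (cases "x = 0") auto
  qed (auto intro: V.span_diff mult_W)
  moreover have "range \<iota> \<subseteq> ?W" using scale_W[OF in_W[of 0]] by auto
  moreover have "\<zeta> \<in> ?W" using in_W[of 1] p2 by simp
  ultimately have "adjoin (range \<iota>) \<zeta> \<subseteq> ?W" unfolding adjoin_def by blast
  then have "?W = UNIV" using gen by blast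
  moreover have "card Z \<le> p - 1" unfolding Z_def using card_image_le[of "{..<p - 1}"] by simp
  ultimately show ?thesis using finZ by blast
qed

text \<open>With x = \<zeta> - 1, expanding (x + 1)^p = 1 and dividing by x gives x^(p-1) = -p w.
  This shows first v(x) \<ge> 1 and then that w is a unit, so (p - 1) v(x) = e. The bound e \<le> p
  - 1 forces v(x) = 1 and e = p - 1 at the same time.\<close>

lemma (in val_extension) cyclotomic_valuation:
  assumes p: "prime p" and pK: "(of_nat p :: 'k) \<noteq> 0" "vK (of_nat p) = 1"
    and z: "\<zeta> ^ p = 1" "\<zeta> \<noteq> 1" and gen: "adjoin (range \<iota>) \<zeta> = UNIV"
  shows "e = p - 1 \<and> vL (\<zeta> - 1) = 1"
proof -
  have p2: "p \<ge> 2" using p prime_ge_2_nat by blast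
  obtain S where S: "finite S" "card S \<le> p - 1" "V.span S = UNIV"
    using cyclotomic_spanning_set[OF emb p z gen] by blast
  then have e_le: "e \<le> p - 1" using ram_index_le_card by fastforce
  have pL: "vL (of_nat p) = int e" "(of_nat p :: 'l) \<noteq> 0"
    using val_emb[OF pK(1)] pK by (simp, metis emb_simps(8) emb_simps(10))
  define x where "x = \<zeta> - 1"
  have x0: "x \<noteq> 0" using z by (simp add: x_def)
  have "\<zeta> \<noteq> 0" using z p2 by (auto simp: power_0_left)
  then have "vL \<zeta> = 0" using L.val_power[of \<zeta> p] z p2 by simp
  then have xO: "x \<in> max_pow vL 0" unfolding x_def by (intro L.max_pow_diff) (simp_all add: max_pow_def)
  obtain w w' where w: "w \<in> max_pow vL 0" "w' \<in> max_pow vL 0"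
    "(x + 1) ^ p = x ^ p + 1 ^ p + of_nat p * x * 1 * w" "w = 1 ^ (p - 2) + x * w'"
    using L.binomial_prime_cong[OF p xO L.one_in_val_ring] by blast
  have "x ^ p = x * x ^ (p - 1)" using p2 by (simp flip: power_Suc)
  moreover have "(x + 1) ^ p = 1" using z by (simp add: x_def)
  then have "x ^ p + of_nat p * x * w = 0" using w(3) by simp
  ultimately have "x * (x ^ (p - 1) + of_nat p * w) = 0" by (simp add: algebra_simps)
  then have pow: "x ^ (p - 1) = - (of_nat p * w)" using x0 by (simp add: eq_neg_iff_add_eq_0)
  have "of_nat p \<in> max_pow vL 1" using pL e_pos by (simp add: max_pow_def)
  then have "x ^ (p - 1) \<in> max_pow vL 1" unfolding pow using w(1) L.max_pow_mult_right by simp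
  then have x1: "x \<in> max_pow vL 1" using xO L.in_max_pow_1_of_power by blast
  then have "w \<noteq> 0 \<and> vL w = 0" using L.val_add_eq[of 1 "x * w'"] w L.max_pow_mult_right by simp
  then have "int (p - 1) * vL x = int e"
    using arg_cong[OF pow, of vL] pL x0 by (simp add: L.val_power L.val_mult)
  moreover have "vL x \<ge> 1" using x1 x0 by (simp add: max_pow_def)
  moreover have "vL x \<le> 1"
  proof -
    have "int (p - 1) * vL x \<le> int (p - 1) * 1" using \<open>int (p - 1) * vL x = int e\<close> e_le by simp
    moreover have "int (p - 1) > 0" using p2 by simp
    ultimately show ?thesis by (metis mult_le_cancel_left_pos)
  qed
  ultimately have "vL x = 1" by simp
  then show ?thesis using \<open>int (p - 1) * vL x = int e\<close> by (simp add: x_def)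
qed

section \<open>Eisenstein polynomials and the different\<close>

context val_extension
begin

text \<open>If v(\<pi>) \<le> 0, the leading term of g(\<pi>) = 0 would have strictly smallest
  valuation. Once v(\<pi>) \<ge> 1, the constant term, of valuation e, is strictly smallest among
  the lower terms, so v(\<pi>^e) = e.\<close>

lemma eisenstein_root_val:
  assumes g: "eisenstein vK g" and deg: "degree g = e" and root: "poly (map_poly \<iota> g) \<pi> = 0"
  shows "\<pi> \<noteq> 0 \<and> vL \<pi> = 1"
proof -
  have a: "coeff g e = 1" "coeff g 0 \<noteq> 0" "vK (coeff g 0) = 1"
    "\<And>i. i < e \<Longrightarrow> coeff g i \<in> max_pow vK 1"
    using g deg by (auto simp: eisenstein_def)
  have "degree (map_poly \<iota> g) = e" using deg by (subst degree_map_poly) auto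
  then have sum0: "(\<Sum>j\<le>e. \<iota> (coeff g j) * \<pi> ^ j) = 0"
    using root by (simp add: poly_altdef coeff_map_poly)
  have split0: "{..e} = insert 0 {1..e}" by auto
  have a0: "vL (\<iota> (coeff g 0)) = int e" "\<iota> (coeff g 0) \<noteq> 0" using a val_emb by auto
  have pi0: "\<pi> \<noteq> 0"
  proof
    assume "\<pi> = 0"
    then have "(\<Sum>j\<le>e. \<iota> (coeff g j) * \<pi> ^ j) = \<iota> (coeff g 0)"
      by (simp add: split0 power_0_left)
    then show False using sum0 a0 by simp
  qed
  have val_pow: "vL (\<pi> ^ j) = int j * vL \<pi>" for j using L.val_power[OF pi0] by simp
  have aj: "\<iota> (coeff g j) \<in> max_pow vL (int e)" if "j < e" for j
    using emb_max_pow[OF a(4)[OF that]] by simp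
  have pos: "vL \<pi> \<ge> 1"
  proof (rule ccontr)
    assume neg: "\<not> vL \<pi> \<ge> 1"
    have "\<iota> (coeff g j) * \<pi> ^ j \<in> max_pow vL (int e * vL \<pi> + 1)" if "j < e" for j
    proof -
      have "int e * vL \<pi> \<le> int j * vL \<pi>"
        using neg that by (intro mult_right_mono_neg) auto
      then have "\<pi> ^ j \<in> max_pow vL (int e * vL \<pi>)" using val_pow by (simp add: max_pow_def)
      from L.max_pow_mult[OF aj[OF that] this] show ?thesis using e_pos by (rule_tac L.max_pow_anti) auto
    qed
    then have "(\<Sum>j<e. \<iota> (coeff g j) * \<pi> ^ j) \<in> max_pow vL (vL (\<pi> ^ e) + 1)"
      unfolding val_pow by (intro L.max_pow_sum) auto
    then have "\<pi> ^ e + (\<Sum>j<e. \<iota> (coeff g j) * \<pi> ^ j) \<noteq> 0" using L.val_add_eq pi0 by (metis power_not_zero)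
    moreover have "{..e} = insert e {..<e}" by auto
    ultimately show False using sum0 a by simp
  qed
  have "\<iota> (coeff g j) * \<pi> ^ j \<in> max_pow vL (int e + 1)" if "j \<in> {1..<e}" for j
  proof -
    have "1 * 1 \<le> int j * vL \<pi>" using that pos by (intro mult_mono) auto
    then have "\<pi> ^ j \<in> max_pow vL 1" using val_pow by (simp add: max_pow_def)
    then show ?thesis using L.max_pow_mult[OF aj[of j], of "\<pi> ^ j" 1] that by simp
  qed
  then have r: "(\<Sum>j\<in>{1..<e}. \<iota> (coeff g j) * \<pi> ^ j) \<in> max_pow vL (vL (\<iota> (coeff g 0)) + 1)"
    unfolding a0 by (intro L.max_pow_sum) auto
  have "{..e} = insert e (insert 0 {1..<e})" using e_pos by auto
  then have "- (\<pi> ^ e) = \<iota> (coeff g 0) + (\<Sum>j\<in>{1..<e}. \<iota> (coeff g j) * \<pi> ^ j)"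
    using sum0 a e_pos by (simp add: neg_eq_iff_add_eq_0)
  then have "vL (- (\<pi> ^ e)) = vL (\<iota> (coeff g 0))" using L.val_add_eq[OF a0(2) r] by simp
  then have "int e * vL \<pi> = int e * 1" using a0 val_pow by simp
  then show ?thesis using e_pos pi0 by simp
qed

text \<open>Ensures that the description in \<open>Newt\<close> denotes something. Expand \<pi>^e in
  the power basis: the total has valuation e, so every term has valuation at least e, which puts
  each coefficient in the maximal ideal; the term attaining e has index divisible by e, hence index
  0.\<close>

lemma eisenstein_presentation_exists:
  assumes fin: "finite B0" "V.span B0 = UNIV" and deg: "ext_degree \<iota> = e"
  shows "\<exists>g \<pi>. eisenstein_presentation vK \<iota> g \<pi>"
proof -
  obtain \<pi> where pi: "\<pi> \<noteq> 0" "vL \<pi> = 1" using L.ex_uniformizer by blast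
  note basis = power_basis[OF pi fin deg]
  obtain c where c: "\<pi> ^ e = (\<Sum>j<e. \<iota> (c j) * \<pi> ^ j)" using basis by blast
  define J where "J = {j. j < e \<and> c j \<noteq> 0}"
  have "(\<Sum>j\<in>J. \<iota> (c j) * \<pi> ^ j) = (\<Sum>j<e. \<iota> (c j) * \<pi> ^ j)"
    by (rule sum.mono_neutral_left) (auto simp: J_def)
  then have sumJ: "(\<Sum>j\<in>J. \<iota> (c j) * \<pi> ^ j) = \<pi> ^ e" using c by simp
  have Jne: "J \<noteq> {}" using sumJ pi by (metis power_not_zero sum.empty)
  have finJ: "finite J" by (simp add: J_def)
  have Min: "int e = Min ((\<lambda>j. int e * vK (c j) + int j) ` J)"
  proof -
    have "J \<subseteq> {0..<0 + e}" by (auto simp: J_def)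
    moreover have "c j \<noteq> 0" if "j \<in> J" for j using that by (simp add: J_def)
    ultimately have "vL (\<Sum>j\<in>J. \<iota> (c j) * \<pi> ^ j) = Min ((\<lambda>j. int e * vK (c j) + int j) ` J)"
      using val_power_sum[OF pi finJ Jne] by blast
    then show ?thesis
      unfolding sumJ using L.val_power[OF pi(1), of e] pi(2) by simp
  qed
  have ge: "int e \<le> int e * vK (c j) + int j" if "j \<in> J" for j
  proof -
    have "Min ((\<lambda>j. int e * vK (c j) + int j) ` J) \<le> int e * vK (c j) + int j"
      using finJ that by (intro Min_le) auto
    then show ?thesis by (simp only: Min[symmetric])
  qed
  have c1: "c j \<in> max_pow vK 1" if "j < e" for j
  proof (rule ccontr)
    assume "c j \<notin> max_pow vK 1"
    then have j: "j \<in> J" "vK (c j) \<le> 0" using that by (auto simp: J_def max_pow_def)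
    then have "int e * vK (c j) \<le> 0" by (simp add: mult_nonneg_nonpos)
    then show False using ge[OF j(1)] that by simp
  qed
  have "int e \<in> (\<lambda>j. int e * vK (c j) + int j) ` J"
    by (subst Min, rule Min_in) (use Jne finJ in auto)
  then obtain j where j: "j \<in> J" "int e = int e * vK (c j) + int j" by blast
  have "j = 0"
  proof -
    have "int e dvd int j" using j(2) by (metis dvd_add_right_iff dvd_refl dvd_triv_left)
    then show ?thesis using j(1) by (auto simp: J_def dest: dvd_imp_le)
  qed
  then have c0: "c 0 \<noteq> 0" "vK (c 0) = 1" using j e_pos by (auto simp: J_def)
  define g where "g = monom 1 e - (\<Sum>j<e. monom (c j) j)"
  have cg: "coeff g i = (if i = e then 1 else if i < e then - c i else 0)" for i
    by (auto simp: g_def coeff_sum sum.delta' cong: if_cong)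
  have dg: "degree g = e"
  proof (rule antisym)
    show "degree g \<le> e" by (rule degree_le) (auto simp: cg)
    show "e \<le> degree g" by (rule le_degree) (simp add: cg)
  qed
  have eis: "eisenstein vK g" using dg c0 c1 e_pos by (auto simp: eisenstein_def cg)
  have ev: "poly (map_poly \<iota> h) \<pi> = (\<Sum>j<m. \<iota> (coeff h j) * \<pi> ^ j)" if "degree h < m" for h m
  proof -
    have "degree (map_poly \<iota> h) = degree h" by (rule degree_map_poly) simp
    then have "poly (map_poly \<iota> h) \<pi> = (\<Sum>j\<le>degree h. \<iota> (coeff h j) * \<pi> ^ j)"
      by (simp add: poly_altdef coeff_map_poly)
    also have "\<dots> = (\<Sum>j<m. \<iota> (coeff h j) * \<pi> ^ j)"
      by (rule sum.mono_neutral_left) (use that in \<open>auto simp: not_le coeff_eq_0\<close>)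
    finally show ?thesis .
  qed
  have map_add: "map_poly \<iota> (h + k) = map_poly \<iota> h + map_poly \<iota> k" for h k
    by (rule poly_eqI) (simp add: coeff_map_poly)
  have map_mult: "map_poly \<iota> (h * k) = map_poly \<iota> h * map_poly \<iota> k" for h k
    by (rule poly_eqI) (simp add: coeff_map_poly coeff_mult)
  have root: "poly (map_poly \<iota> g) \<pi> = 0"
    using ev[of g "Suc e"] dg c by (simp add: cg sum_negf)
  have "y \<in> range (\<lambda>h. poly (map_poly \<iota> h) \<pi>)" for y
  proof -
    obtain d where d: "y = (\<Sum>j<e. \<iota> (d j) * \<pi> ^ j)" using basis by blast
    define h where "h = (\<Sum>j<e. monom (d j) j)"
    have ch: "coeff h i = (if i < e then d i else 0)" for i by (auto simp: h_def coeff_sum cong: if_cong)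
    then have "degree h < e" using e_pos by (intro degree_lessI) auto
    then have "y = poly (map_poly \<iota> h) \<pi>" using ev[of h e] ch d by simp
    then show ?thesis by (rule range_eqI)
  qed
  moreover have "poly (map_poly \<iota> h) \<pi> = 0 \<longleftrightarrow> g dvd h" for h
  proof
    assume "g dvd h"
    then show "poly (map_poly \<iota> h) \<pi> = 0" using root by (auto simp: map_mult)
  next
    assume h0: "poly (map_poly \<iota> h) \<pi> = 0"
    have g0: "g \<noteq> 0" using dg e_pos by auto
    have "h = g * (h div g) + h mod g" by simp
    then have "poly (map_poly \<iota> (h mod g)) \<pi> = 0"
      using h0 root by (metis add_0 map_add map_mult mult_zero_left poly_add poly_mult)
    moreover have "h mod g = 0 \<or> degree (h mod g) < e" using degree_mod_less[OF g0, of h] dg by simp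
    ultimately have "h mod g = 0"
      using ev[of "h mod g" e] power_sum_eq_0_iff[OF pi, of "coeff (h mod g)"]
      by (auto intro: poly_eqI simp: coeff_eq_0 not_less)
         (metis coeff_eq_0 leading_coeff_0_iff)
    then show "g dvd h" by (simp add: dvd_eq_mod_eq_0)
  qed
  ultimately have "eisenstein_presentation vK \<iota> g \<pi>"
    using eis dg deg by (auto simp: eisenstein_presentation_def)
  then show ?thesis by blast
qed

text \<open>Euler's formula: with \<open>\<lambda>\<close> the coefficient of the top power in the power basis, the bases
  \<open>\<pi> ^ j\<close> and \<open>b i\<close> (the coefficients of \<open>g(X) / (X - \<pi>)\<close>) are dual for \<open>\<lambda>\<close>, so the trace of
  \<open>x\<close> is \<open>\<lambda>(x g'(\<pi>))\<close>.\<close>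

lemma different_val_ge:
  assumes pi: "\<pi> \<noteq> 0" "vL \<pi> = 1"
    and basis: "\<And>y. \<exists>c. y = (\<Sum>j<e. \<iota> (c j) * \<pi> ^ j)"
    and a: "a e = 1" "(\<Sum>j\<le>e. \<iota> (a j) * \<pi> ^ j) = 0"
    and d: "d = (\<Sum>k\<in>{1..e}. of_nat k * \<iota> (a k) * \<pi> ^ (k - 1))" "d \<noteq> 0"
    and z: "z \<in> different vK vL \<iota>" "z \<noteq> 0"
  shows "vL d \<le> vL z"
proof -
  have "\<exists>C. \<forall>y. y = (\<Sum>j<e. \<iota> (C y j) * \<pi> ^ j)" by (rule choice) (use basis in blast)
  then obtain C where C: "\<And>y. y = (\<Sum>j<e. \<iota> (C y j) * \<pi> ^ j)" by blast
  have uniq: "C y j = c j" if "y = (\<Sum>j<e. \<iota> (c j) * \<pi> ^ j)" "j < e" for y c j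
  proof -
    have "(\<Sum>j<e. \<iota> (C y j - c j) * \<pi> ^ j) = (\<Sum>j<e. \<iota> (C y j) * \<pi> ^ j) - (\<Sum>j<e. \<iota> (c j) * \<pi> ^ j)"
      by (simp add: algebra_simps sum_subtractf)
    also have "\<dots> = 0" using C[of y] that(1) by (simp only: diff_self)
    finally show ?thesis using power_sum_eq_0_iff[OF pi, of "\<lambda>j. C y j - c j"] that(2) by auto
  qed
  define l where "l = (\<lambda>y. C y (e - 1))"
  have e1: "e - 1 < e" using e_pos by simp
  have l_add: "l (x + y) = l x + l y" for x y
  proof -
    have "x + y = (\<Sum>j<e. \<iota> (C x j + C y j) * \<pi> ^ j)"
      by (subst C[of x], subst C[of y]) (simp add: distrib_right sum.distrib)
    then show ?thesis unfolding l_def by (rule uniq[OF _ e1])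
  qed
  have l_scale: "l (\<iota> c * x) = c * l x" for c x
  proof -
    have "\<iota> c * x = \<iota> c * (\<Sum>j<e. \<iota> (C x j) * \<pi> ^ j)" by (subst C[of x]) (rule refl)
    also have "\<dots> = (\<Sum>j<e. \<iota> (c * C x j) * \<pi> ^ j)" by (simp add: sum_distrib_left mult.assoc)
    finally show ?thesis unfolding l_def by (rule uniq[OF _ e1])
  qed
  have l_0: "l 0 = 0" using l_scale[of 0 0] by simp
  have l_sum: "l (\<Sum>i\<in>A. f i) = (\<Sum>i\<in>A. l (f i))" for f and A :: "nat set"
    by (induction A rule: infinite_finite_induct) (simp_all add: l_0 l_add)
  have l_sum': "l (\<Sum>i\<in>A. f i) = (\<Sum>i\<in>A. l (f i))" for f and A :: "'l set"
    by (induction A rule: infinite_finite_induct) (simp_all add: l_0 l_add)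
  have l_pow: "l (\<pi> ^ m) = (if m = e - 1 then 1 else 0)" if "m < e" for m
  proof -
    have "\<pi> ^ m = (\<Sum>j<e. \<iota> (if j = m then 1 else 0) * \<pi> ^ j)"
    proof -
      have "(\<Sum>j<e. \<iota> (if j = m then 1 else 0) * \<pi> ^ j) = (\<Sum>j<e. if j = m then \<pi> ^ j else 0)"
        by (rule sum.cong) auto
      then show ?thesis using that by simp
    qed
    from uniq[OF this e1] show ?thesis unfolding l_def by auto
  qed
  \<comment> \<open>The top term of an integral y has valuation e v(l y) + (e - 1) \<ge> 0, and
    since e - 1 < e this already forces v(l y) \<ge> 0.\<close>
  have l_int: "l y \<in> val_ring vK" if y: "y \<in> val_ring vL" for y
  proof (cases "l y = 0")
    case False
    define J where "J = {j. j < e \<and> C y j \<noteq> 0}"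
    have J: "finite J" "J \<subseteq> {0..<0 + e}" "e - 1 \<in> J" using False e1 by (auto simp: J_def l_def)
    have Jnz: "C y j \<noteq> 0" if "j \<in> J" for j using that by (simp add: J_def)
    have "(\<Sum>j\<in>J. \<iota> (C y j) * \<pi> ^ j) = (\<Sum>j<e. \<iota> (C y j) * \<pi> ^ j)"
      by (rule sum.mono_neutral_left) (auto simp: J_def)
    then have sumJ: "(\<Sum>j\<in>J. \<iota> (C y j) * \<pi> ^ j) = y" using C[of y] by (simp only:)
    have "J \<noteq> {}" using J by blast
    have "(\<Sum>j\<in>J. \<iota> (C y j) * \<pi> ^ j) \<noteq> 0 \<and>
        vL (\<Sum>j\<in>J. \<iota> (C y j) * \<pi> ^ j) = Min ((\<lambda>j. int e * vK (C y j) + int j) ` J)"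
      by (rule val_power_sum[OF pi J(1) \<open>J \<noteq> {}\<close> _ J(2)]) (rule Jnz)
    then have "y \<noteq> 0" "vL y = Min ((\<lambda>j. int e * vK (C y j) + int j) ` J)" unfolding sumJ by auto
    then have "0 \<le> Min ((\<lambda>j. int e * vK (C y j) + int j) ` J)" using y by (simp add: max_pow_def)
    also have "\<dots> \<le> int e * vK (l y) + int (e - 1)"
      using J by (intro Min_le) (auto simp: l_def)
    finally have "int e * (- vK (l y)) < int e * 1" using e_pos by simp
    then have "- vK (l y) < 1" by (metis mult_less_cancel_left_pos of_nat_0_less_iff e_pos)
    then show ?thesis by (simp add: max_pow_def)
  qed simp
  define b where "b = (\<lambda>i. \<Sum>k\<in>{Suc i..e}. \<iota> (a k) * \<pi> ^ (k - 1 - i))"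
  \<comment> \<open>For j \<le> i all exponents k - 1 - i + j stay below e and reach e - 1 only for
    k = e and i = j. For j > i they can exceed it, so g(\<pi>) = 0 is used to replace the part k > i
    by minus the part k \<le> i.\<close>
  have dual: "l (b i * \<pi> ^ j) = (if i = j then 1 else 0)" if ij: "i < e" "j < e" for i j
  proof (cases "j \<le> i")
    case True
    have "b i * \<pi> ^ j = (\<Sum>k\<in>{Suc i..e}. \<iota> (a k) * \<pi> ^ (k - 1 - i + j))"
      by (simp only: b_def sum_distrib_right mult.assoc power_add)
    then have "l (b i * \<pi> ^ j) = (\<Sum>k\<in>{Suc i..e}. a k * l (\<pi> ^ (k - 1 - i + j)))"
      by (simp only: l_sum l_scale)
    also have "\<dots> = (\<Sum>k\<in>{Suc i..e}. if k = e \<and> i = j then 1 else 0)"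
    proof (rule sum.cong)
      fix k assume k: "k \<in> {Suc i..e}"
      have "k - 1 - i + j < e" "k - 1 - i + j = e - 1 \<longleftrightarrow> k = e \<and> i = j"
        using k True by auto
      then show "a k * l (\<pi> ^ (k - 1 - i + j)) = (if k = e \<and> i = j then 1 else 0)"
        using l_pow a(1) by auto
    qed simp
    also have "\<dots> = (if i = j then 1 else 0)" using ij by auto
    finally show ?thesis .
  next
    case False
    have "b i * \<pi> ^ j = (\<Sum>k\<in>{Suc i..e}. \<iota> (a k) * (\<pi> ^ (k - 1 - i) * \<pi> ^ j))"
      by (simp add: b_def sum_distrib_right mult.assoc)
    also have "\<dots> = (\<Sum>k\<in>{Suc i..e}. \<iota> (a k) * \<pi> ^ k * \<pi> ^ (j - 1 - i))"
    proof (rule sum.cong)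
      fix k assume k: "k \<in> {Suc i..e}"
      then have "k - 1 - i + j = k + (j - 1 - i)" using False by auto
      then show "\<iota> (a k) * (\<pi> ^ (k - 1 - i) * \<pi> ^ j) = \<iota> (a k) * \<pi> ^ k * \<pi> ^ (j - 1 - i)"
        by (simp only: power_add[symmetric] mult.assoc)
    qed simp
    also have "\<dots> = (\<Sum>k\<in>{Suc i..e}. \<iota> (a k) * \<pi> ^ k) * \<pi> ^ (j - 1 - i)"
      by (simp add: sum_distrib_right)
    also have "(\<Sum>k\<in>{Suc i..e}. \<iota> (a k) * \<pi> ^ k) = - (\<Sum>k\<in>{..i}. \<iota> (a k) * \<pi> ^ k)"
    proof -
      have "{..e} = {..i} \<union> {Suc i..e}" using ij by auto
      then have "(\<Sum>k\<in>{..i}. \<iota> (a k) * \<pi> ^ k) + (\<Sum>k\<in>{Suc i..e}. \<iota> (a k) * \<pi> ^ k) = 0"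
        using a(2) by (subst sum.union_disjoint[symmetric]) auto
      then show ?thesis by (simp add: eq_neg_iff_add_eq_0 add.commute)
    qed
    also have "- (\<Sum>k\<in>{..i}. \<iota> (a k) * \<pi> ^ k) * \<pi> ^ (j - 1 - i)
        = (\<Sum>k\<in>{..i}. \<iota> (- a k) * \<pi> ^ (k + (j - 1 - i)))"
      by (simp add: sum_distrib_right sum_negf power_add mult.assoc)
    finally have "l (b i * \<pi> ^ j) = (\<Sum>k\<in>{..i}. - a k * l (\<pi> ^ (k + (j - 1 - i))))"
      by (simp only: l_sum l_scale)
    also have "\<dots> = 0"
    proof (rule sum.neutral, rule ballI)
      fix k assume "k \<in> {..i}"
      then have "k + (j - 1 - i) < e" "k + (j - 1 - i) \<noteq> e - 1" using False ij by auto
      then show "- a k * l (\<pi> ^ (k + (j - 1 - i))) = 0" using l_pow by simp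
    qed
    finally show ?thesis using False by simp
  qed
  have coef: "y = (\<Sum>i<e. \<iota> (l (b i * y)) * \<pi> ^ i)" for y
  proof -
    have "l (b i * y) = C y i" if i: "i < e" for i
    proof -
      have "b i * y = b i * (\<Sum>j<e. \<iota> (C y j) * \<pi> ^ j)" by (subst C[of y]) (rule refl)
      also have "\<dots> = (\<Sum>j<e. \<iota> (C y j) * (b i * \<pi> ^ j))" by (simp add: sum_distrib_left mult.left_commute)
      finally have "l (b i * y) = (\<Sum>j<e. C y j * l (b i * \<pi> ^ j))" by (simp only: l_sum l_scale)
      also have "\<dots> = (\<Sum>j<e. if j = i then C y j else 0)"
        by (rule sum.cong) (use dual i in auto)
      finally show ?thesis using i by simp
    qed
    then have "(\<Sum>i<e. \<iota> (l (b i * y)) * \<pi> ^ i) = (\<Sum>i<e. \<iota> (C y i) * \<pi> ^ i)" by simp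
    then show ?thesis using C[of y] by (simp only:)
  qed
  have d_eq: "(\<Sum>i<e. b i * \<pi> ^ i) = d"
  proof -
    have "(\<Sum>i<e. b i * \<pi> ^ i) = (\<Sum>i<e. \<Sum>k\<in>{1..e}. if i < k then \<iota> (a k) * \<pi> ^ (k - 1) else 0)"
    proof (rule sum.cong)
      fix i assume "i \<in> {..<e}"
      have "b i * \<pi> ^ i = (\<Sum>k\<in>{Suc i..e}. \<iota> (a k) * \<pi> ^ (k - 1))"
        unfolding b_def sum_distrib_right
        by (rule sum.cong) (auto simp: mult.assoc power_add[symmetric])
      also have "\<dots> = (\<Sum>k\<in>{1..e}. if i < k then \<iota> (a k) * \<pi> ^ (k - 1) else 0)"
        by (rule sum.mono_neutral_cong_left) auto
      finally show "b i * \<pi> ^ i = (\<Sum>k\<in>{1..e}. if i < k then \<iota> (a k) * \<pi> ^ (k - 1) else 0)" .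
    qed simp
    also have "\<dots> = (\<Sum>k\<in>{1..e}. \<Sum>i<e. if i < k then \<iota> (a k) * \<pi> ^ (k - 1) else 0)" by (rule sum.swap)
    also have "\<dots> = d"
      unfolding d(1)
    proof (rule sum.cong)
      fix k assume k: "k \<in> {1..e}"
      have "(\<Sum>i<e. if i < k then \<iota> (a k) * \<pi> ^ (k - 1) else 0) = (\<Sum>i<k. \<iota> (a k) * \<pi> ^ (k - 1))"
        by (rule sum.mono_neutral_cong_right) (use k in auto)
      then show "(\<Sum>i<e. if i < k then \<iota> (a k) * \<pi> ^ (k - 1) else 0) = of_nat k * \<iota> (a k) * \<pi> ^ (k - 1)"
        by (simp add: mult.assoc)
    qed simp
    finally show ?thesis .
  qed
  \<comment> \<open>\<open>ext_trace\<close> uses an arbitrary basis B. Expanding each element of B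
    through the dual family turns the diagonal sum into the sum of l(b_i x \<pi>^i) over i < e,
    which no longer involves B.\<close>
  have trace: "ext_trace \<iota> x = l (x * d)" for x
  proof -
    define B where "B = (SOME B. \<not> V.dependent B \<and> V.span B = UNIV)"
    obtain B' where "\<not> V.dependent B'" "UNIV \<subseteq> V.span B'" by (rule V.maximal_independent_subset[of UNIV])
    then have "\<not> V.dependent B' \<and> V.span B' = UNIV" by blast
    then have "\<not> V.dependent B \<and> V.span B = UNIV" unfolding B_def by (rule someI)
    then have B: "\<not> V.dependent B" "V.span B = UNIV" by auto
    have "y \<in> V.span ((\<lambda>j. \<pi> ^ j) ` {..<e})" for y
    proof -
      have "(\<Sum>j<e. ext_scale \<iota> (C y j) (\<pi> ^ j)) \<in> V.span ((\<lambda>j. \<pi> ^ j) ` {..<e})"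
        by (rule V.span_sum, rule V.span_scale, rule V.span_base) simp
      moreover have "(\<Sum>j<e. ext_scale \<iota> (C y j) (\<pi> ^ j)) = y" by (subst C[of y]) (simp only: ext_scale_def)
      ultimately show ?thesis by (simp only:)
    qed
    then have "B \<subseteq> V.span ((\<lambda>j. \<pi> ^ j) ` {..<e})" by blast
    then have finB: "finite B" using V.independent_span_bound[OF _ B(1)] by blast
    let ?r = "V.representation B"
    have rsum: "(\<Sum>b\<in>B. \<iota> (?r y b) * b) = y" for y
      using V.sum_representation_eq[OF B(1) _ finB, of y] B(2) by (simp add: ext_scale_def)
    have r_expand: "?r (x * c) c = (\<Sum>i<e. l (b i * c) * ?r (x * \<pi> ^ i) c)" for c
    proof -
      have "x * c = (\<Sum>i<e. ext_scale \<iota> (l (b i * c)) (x * \<pi> ^ i))"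
        by (subst coef[of c]) (simp add: sum_distrib_left ext_scale_def mult.left_commute)
      then show ?thesis
        using V.representation_sum[OF B(1), of "{..<e}" "\<lambda>i. ext_scale \<iota> (l (b i * c)) (x * \<pi> ^ i)"]
          V.representation_scale[OF B(1)] B(2) by simp
    qed
    have "ext_trace \<iota> x = (\<Sum>c\<in>B. ?r (x * c) c)" by (simp add: ext_trace_def B_def Let_def)
    also have "\<dots> = (\<Sum>c\<in>B. \<Sum>i<e. l (b i * c) * ?r (x * \<pi> ^ i) c)" using r_expand by simp
    also have "\<dots> = (\<Sum>i<e. \<Sum>c\<in>B. l (b i * c) * ?r (x * \<pi> ^ i) c)" by (rule sum.swap)
    also have "\<dots> = (\<Sum>i<e. l (b i * (x * \<pi> ^ i)))"
    proof (rule sum.cong)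
      fix i
      have "b i * (x * \<pi> ^ i) = b i * (\<Sum>c\<in>B. \<iota> (?r (x * \<pi> ^ i) c) * c)" by (simp only: rsum)
      also have "\<dots> = (\<Sum>c\<in>B. \<iota> (?r (x * \<pi> ^ i) c) * (b i * c))"
        by (simp add: sum_distrib_left mult.left_commute)
      finally have "l (b i * (x * \<pi> ^ i)) = (\<Sum>c\<in>B. ?r (x * \<pi> ^ i) c * l (b i * c))"
        by (simp only: l_sum' l_scale)
      then show "(\<Sum>c\<in>B. l (b i * c) * ?r (x * \<pi> ^ i) c) = l (b i * (x * \<pi> ^ i))"
        by (simp add: mult.commute)
    qed simp
    also have "\<dots> = l (x * (\<Sum>i<e. b i * \<pi> ^ i))" by (simp add: l_sum sum_distrib_left mult.left_commute)
    finally show ?thesis by (simp only: d_eq)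
  qed
  \<comment> \<open>Tr(y/d) = l(y) is integral for integral y, so 1/d is in the codifferent; an
    element z of the different must then have z/d integral.\<close>
  have "inverse d \<in> codifferent vK vL \<iota>"
    unfolding codifferent_def using trace l_int d(2) by (simp add: mult.commute mult.left_commute)
  then have "z * inverse d \<in> val_ring vL" using z(1) by (auto simp: different_def)
  then show ?thesis using z(2) d(2) by (simp add: max_pow_def L.val_mult L.val_inverse)
qed

end

section \<open>Distance to powers in the unit group\<close>

text \<open>Sharpens \<open>frobenius_add_cong\<close> by one: the cross terms carry both p and a
  factor from the maximal ideal. The extra unit of precision covers the boundary case m_s =
  v_L(p).\<close>

lemma (in nval) one_plus_frobenius_cong:
  assumes p: "prime p" "of_nat p \<in> max_pow v k" and k: "0 \<le> k" and y: "y \<in> max_pow v 1"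
  shows "(1 + y) ^ p ^ s - (1 + y ^ p ^ s) \<in> max_pow v (k + 1)"
proof (induction s)
  case (Suc s)
  define z where "z = y ^ p ^ s"
  define r where "r = (1 + y) ^ p ^ s - (1 + z)"
  have r: "r \<in> max_pow v (k + 1)" using Suc by (simp add: r_def z_def)
  then have r1: "r \<in> max_pow v 1" using k by (rule_tac max_pow_anti) auto
  have y0: "y \<in> max_pow v 0" using y by (rule_tac max_pow_anti) auto
  have p0: "p > 0" using p(1) prime_gt_0_nat by blast
  have "y ^ p ^ s = y * y ^ (p ^ s - 1)" using p0 by (simp flip: power_Suc)
  then have z1: "z \<in> max_pow v 1" unfolding z_def using y y0 max_pow_mult_right val_ring_power by simp
  have 10: "t \<in> max_pow v 0" if "t \<in> max_pow v 1" for t using that by (rule_tac max_pow_anti) auto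
  have zr: "z + r \<in> max_pow v 1" using max_pow_add z1 r1 by blast
  obtain w w' where w: "w \<in> max_pow v 0" "(1 + (z + r)) ^ p = 1 ^ p + (z + r) ^ p + of_nat p * 1 * (z + r) * w"
    using binomial_prime_cong[OF p(1) one_in_val_ring 10[OF zr]] by metis
  obtain u u' where u: "u \<in> max_pow v 0" "(z + r) ^ p = z ^ p + r ^ p + of_nat p * z * r * u"
    using binomial_prime_cong[OF p(1) 10[OF z1] 10[OF r1]] by metis
  have 1: "of_nat p * (z + r) * w \<in> max_pow v (k + 1)" using max_pow_mult[OF p(2) zr] w(1) max_pow_mult_right by blast
  have 2: "of_nat p * z * r * u \<in> max_pow v (k + 1)"
    using max_pow_mult_left[of "of_nat p * z" r "k + 1"] r 10[OF z1] u(1) max_pow_mult_right max_pow_mult_left of_nat_in_val_ring by metis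
  have "r ^ p = r * r ^ (p - 1)" using p0 by (simp flip: power_Suc)
  then have 3: "r ^ p \<in> max_pow v (k + 1)" using r max_pow_mult_right val_ring_power 10[OF r1] by simp
  have "(1 + y) ^ p ^ s = 1 + (z + r)" by (simp add: r_def)
  then have "(1 + y) ^ p ^ Suc s = (1 + (z + r)) ^ p" by (simp only: power_Suc2 power_mult)
  moreover have "y ^ p ^ Suc s = z ^ p" by (simp only: power_Suc2 power_mult z_def)
  ultimately have "(1 + y) ^ p ^ Suc s - (1 + y ^ p ^ Suc s) = of_nat p * (z + r) * w + of_nat p * z * r * u + r ^ p"
    using w(2) u(2) by simp
  then show ?case using 1 2 3 max_pow_add by (simp only:)
qed simp

text \<open>The expansion is the Eisenstein equation solved for its constant term and rescaled, with
  x = \<zeta> - 1; so indices run from 1 to e and \<open>c e\<close> is a unit. The exponent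
  \<open>s\<close> is fixed, and \<open>res\<close> is perfectness of the residue field for p^s-th
  powers.\<close>

locale ramified_zeta = val_extension vK vL \<iota> e
  for vK :: "'k::field \<Rightarrow> int" and vL :: "'l::field \<Rightarrow> int" and \<iota> :: "'k \<Rightarrow> 'l" and e :: nat +
  fixes p s :: nat and x :: 'k and c :: "nat \<Rightarrow> 'k" and \<pi> :: 'l
  assumes p: "prime p" and pL: "(of_nat p :: 'l) \<noteq> 0" "vL (of_nat p) = int (e * (p - 1))"
    and pi: "\<pi> \<noteq> 0" "vL \<pi> = 1"
    and x: "x \<noteq> 0" "vK x = 1"
    and res: "\<And>a. a \<in> val_ring vK \<Longrightarrow> \<exists>b\<in>val_ring vK. a - b ^ p ^ s \<in> max_pow vK 1"
    and c: "\<And>j. j \<in> {1..<e} \<Longrightarrow> c j \<in> max_pow vK 1" "c e \<noteq> 0" "vK (c e) = 0"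
    and expansion: "\<iota> x = (\<Sum>j\<in>{1..e}. \<iota> (c j) * \<pi> ^ j)"
begin

definition near_powers :: "nat \<Rightarrow> 'l set" where
  "near_powers k = {t. \<exists>y\<in>val_ring vL. t - y ^ p ^ s \<in> max_pow vL (int k)}"

lemma p_pos: "p > 0"
  using p prime_gt_0_nat by blast

lemma p_in_max_pow: "k \<le> e * (p - 1) \<Longrightarrow> of_nat p \<in> max_pow vL (int k)"
  using pL by (simp add: max_pow_def del: of_nat_mult)

lemma c_val_ring: "j \<in> {1..e} \<Longrightarrow> c j \<in> val_ring vK"
  using c(1)[of j] c(2,3) K.max_pow_anti[of 0 1 "c j"] by (cases "j = e") (auto simp: max_pow_def)

lemma near_powers_power: "y \<in> val_ring vL \<Longrightarrow> y ^ p ^ s \<in> near_powers k"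
  by (auto simp: near_powers_def intro!: bexI[of _ y])

lemma near_powers_cong: "t \<in> near_powers k \<Longrightarrow> t' - t \<in> max_pow vL (int k) \<Longrightarrow> t' \<in> near_powers k"
  unfolding near_powers_def using L.max_pow_add[of "t' - t" "int k"] by fastforce

lemma near_powers_max_pow: "t \<in> max_pow vL (int k) \<Longrightarrow> t \<in> near_powers k"
  using near_powers_cong[OF near_powers_power[of 0 k], of t] p_pos by (simp add: power_0_left)

lemma near_powers_val_ring: "t \<in> near_powers k \<Longrightarrow> t \<in> val_ring vL"
proof -
  assume "t \<in> near_powers k"
  then obtain y where "y \<in> val_ring vL" "t - y ^ p ^ s \<in> max_pow vL (int k)" by (auto simp: near_powers_def)
  then have "y ^ p ^ s \<in> val_ring vL" "t - y ^ p ^ s \<in> val_ring vL"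
    using L.val_ring_power L.max_pow_anti[of 0 "int k"] by auto
  then show ?thesis using L.max_pow_add by fastforce
qed

text \<open>Frobenius makes sums of p^s-th powers into p^s-th powers modulo p; this is why k is
  bounded by v_L(p).\<close>

lemma near_powers_add:
  assumes k: "k \<le> e * (p - 1)" and t: "t \<in> near_powers k" "t' \<in> near_powers k"
  shows "t + t' \<in> near_powers k"
proof -
  obtain y y' where y: "y \<in> val_ring vL" "t - y ^ p ^ s \<in> max_pow vL (int k)"
    "y' \<in> val_ring vL" "t' - y' ^ p ^ s \<in> max_pow vL (int k)" using t by (auto simp: near_powers_def)
  have "(y + y') ^ p ^ s - (y ^ p ^ s + y' ^ p ^ s) \<in> max_pow vL (int k)"
    by (rule L.frobenius_add_cong[OF p p_in_max_pow[OF k]]) (use y in auto)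
  then have "(t - y ^ p ^ s) + (t' - y' ^ p ^ s) - ((y + y') ^ p ^ s - (y ^ p ^ s + y' ^ p ^ s)) \<in> max_pow vL (int k)"
    using L.max_pow_diff L.max_pow_add y by blast
  moreover have "(t - y ^ p ^ s) + (t' - y' ^ p ^ s) - ((y + y') ^ p ^ s - (y ^ p ^ s + y' ^ p ^ s))
     = t + t' - (y + y') ^ p ^ s" by (simp add: algebra_simps)
  ultimately have "t + t' - (y + y') ^ p ^ s \<in> max_pow vL (int k)" by (simp only:)
  then show ?thesis using L.max_pow_add y by (auto simp: near_powers_def)
qed

lemma near_powers_sum:
  assumes "k \<le> e * (p - 1)" "\<And>j. j \<in> J \<Longrightarrow> f j \<in> near_powers k"
  shows "(\<Sum>j\<in>J. f j) \<in> near_powers k"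
  using assms(2) by (induction J rule: infinite_finite_induct) (auto intro: near_powers_add[OF assms(1)] near_powers_max_pow)

lemma near_powers_mult:
  assumes t: "t \<in> near_powers k" "t' \<in> near_powers k" shows "t * t' \<in> near_powers k"
proof -
  obtain y y' where y: "y \<in> val_ring vL" "t - y ^ p ^ s \<in> max_pow vL (int k)"
    "y' \<in> val_ring vL" "t' - y' ^ p ^ s \<in> max_pow vL (int k)" using t by (auto simp: near_powers_def)
  have "t * (t' - y' ^ p ^ s) + (t - y ^ p ^ s) * y' ^ p ^ s \<in> max_pow vL (int k)"
    using y near_powers_val_ring[OF t(1)] by (intro L.max_pow_add L.max_pow_mult_left L.max_pow_mult_right L.val_ring_power)
  then have "t * t' - (y * y') ^ p ^ s \<in> max_pow vL (int k)" by (simp add: algebra_simps power_mult_distrib)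
  then show ?thesis using L.max_pow_mult_left y by (auto simp: near_powers_def)
qed

text \<open>Expand \<open>a\<close> in the uniformizer \<open>x\<close>; the digits can be chosen to be \<open>p ^ s\<close>-th powers
  because the residue field is perfect.\<close>

lemma near_powers_emb:
  assumes k: "k \<le> e * (p - 1)" and xR: "\<iota> x \<in> near_powers k" and a: "a \<in> val_ring vK"
  shows "\<iota> a \<in> near_powers k"
proof -
  have "\<exists>r\<in>near_powers k. \<iota> a - r \<in> max_pow vL (int (e * N))" for N
    using a
  proof (induction N arbitrary: a)
    case 0
    then show ?case using emb_max_pow[of a 0] by (intro bexI[of _ 0] near_powers_max_pow) auto
  next
    case (Suc N)
    obtain b where b: "b \<in> val_ring vK" "a - b ^ p ^ s \<in> max_pow vK 1" using res Suc.prems by blast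
    define d where "d = (a - b ^ p ^ s) / x"
    have "d \<in> val_ring vK" using b(2) x by (cases "d = 0") (auto simp: d_def max_pow_def K.val_divide)
    then obtain r where r: "r \<in> near_powers k" "\<iota> d - r \<in> max_pow vL (int (e * N))" using Suc.IH by blast
    have "a = b ^ p ^ s + x * d" using x by (simp add: d_def)
    then have "\<iota> a - (\<iota> b ^ p ^ s + \<iota> x * r) = \<iota> x * (\<iota> d - r)" by (simp add: algebra_simps)
    moreover have "\<iota> x * (\<iota> d - r) \<in> max_pow vL (int e * 1 + int (e * N))"
      using emb_max_pow[of x 1] x r(2) by (intro L.max_pow_mult) (auto simp: max_pow_def)
    ultimately have "\<iota> a - (\<iota> b ^ p ^ s + \<iota> x * r) \<in> max_pow vL (int (e * Suc N))" by simp
    moreover have "\<iota> b ^ p ^ s + \<iota> x * r \<in> near_powers k"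
      using emb_max_pow[OF b(1)] by (intro near_powers_add[OF k] near_powers_power near_powers_mult xR r) simp
    ultimately show ?case by blast
  qed
  then obtain r where r: "r \<in> near_powers k" "\<iota> a - r \<in> max_pow vL (int (e * k))" by blast
  \<comment> \<open>Stopping the x-adic expansion after k digits is enough, because x has valuation
    e \<ge> 1 in L.\<close>
  have "k \<le> e * k" using e_pos by simp
  then have "int k \<le> int (e * k)" by (simp only: of_nat_le_iff)
  then show ?thesis using near_powers_cong[OF r(1)] L.max_pow_anti r(2) by blast
qed

text \<open>The gain of one step that drives the induction: \<pi>^j is itself a p^s-th power, and
  its positive valuation improves the approximation of \<open>\<iota> a\<close> from k to k +
  1.\<close>

lemma near_powers_emb_mult_power:
  assumes k: "k \<le> e * (p - 1)" "\<iota> x \<in> near_powers k" and a: "a \<in> val_ring vK" and j: "p ^ s dvd j" "1 \<le> j"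
  shows "\<iota> a * \<pi> ^ j \<in> near_powers (Suc k)"
proof -
  obtain y where y: "y \<in> val_ring vL" "\<iota> a - y ^ p ^ s \<in> max_pow vL (int k)"
    using near_powers_emb[OF k a] by (auto simp: near_powers_def)
  obtain i where i: "j = p ^ s * i" using j(1) by blast
  have "\<pi> ^ j \<in> max_pow vL 1" using pi j(2) by (simp add: max_pow_def L.val_power)
  then have "(\<iota> a - y ^ p ^ s) * \<pi> ^ j \<in> max_pow vL (int (Suc k))"
    using L.max_pow_mult[OF y(2)] by (simp add: add.commute)
  moreover have "(y * \<pi> ^ i) ^ p ^ s = y ^ p ^ s * \<pi> ^ j"
    by (simp add: i power_mult_distrib mult.commute flip: power_mult)
  moreover have "y * \<pi> ^ i \<in> val_ring vL" using y(1) pi by (intro L.max_pow_mult_left) (auto simp: max_pow_def L.val_power)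
  ultimately show ?thesis unfolding near_powers_def by (auto simp: left_diff_distrib intro!: bexI[of _ "y * \<pi> ^ i"])
qed

text \<open>\<open>m\<close> is m_s, given by its lower-bound property and a minimising index
  \<open>j0\<close>; \<open>m_le\<close> is what strong separability supplies.\<close>

context
  fixes m :: nat and j0 :: nat
  assumes m_min: "\<And>j. j \<in> {1..e} \<Longrightarrow> \<not> p ^ s dvd j \<Longrightarrow> c j \<noteq> 0 \<Longrightarrow> int m \<le> int e * vK (c j) + int j"
    and j0: "j0 \<in> {1..e}" "\<not> p ^ s dvd j0" "c j0 \<noteq> 0" "int m = int e * vK (c j0) + int j0"
    and m_le: "m \<le> e * (p - 1)"
begin

lemma term_in_max_pow:
  assumes "j \<in> {1..e}" "\<not> p ^ s dvd j" shows "\<iota> (c j) * \<pi> ^ j \<in> max_pow vL (int m)"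
  using m_min[OF assms] pi by (cases "c j = 0") (auto simp: max_pow_def L.val_mult L.val_power val_emb)

lemma e_le_m: "e \<le> m"
proof (cases "j0 = e")
  case False
  then have "vK (c j0) \<ge> 1" using c(1)[of j0] j0 by (auto simp: max_pow_def)
  then have "int e * 1 \<le> int e * vK (c j0)" by (intro mult_left_mono) auto
  then show ?thesis using j0(4) by simp
qed (use j0 c in simp)

text \<open>In the expansion of x, terms with p^s dividing j gain one step from the induction
  hypothesis on x itself. The others already vanish modulo \<pi>^m, which lets the induction run up
  to m.\<close>

lemma x_in_near_powers: "k \<le> m \<Longrightarrow> \<iota> x \<in> near_powers k"
proof (induction k)
  case 0
  show ?case using emb_max_pow[of x 0] x by (intro near_powers_max_pow) (simp add: max_pow_def)
next
  case (Suc k)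
  then have k: "k \<le> e * (p - 1)" "Suc k \<le> e * (p - 1)" "\<iota> x \<in> near_powers k" using m_le by auto
  show ?case
    unfolding expansion
  proof (rule near_powers_sum[OF k(2)])
    fix j assume j: "j \<in> {1..e}"
    show "\<iota> (c j) * \<pi> ^ j \<in> near_powers (Suc k)"
    proof (cases "p ^ s dvd j")
      case True
      then show ?thesis using near_powers_emb_mult_power[OF k(1,3) c_val_ring[OF j]] j by simp
    next
      case False
      then show ?thesis using term_in_max_pow[OF j False] Suc.prems
        by (intro near_powers_max_pow L.max_pow_anti[of "int (Suc k)" "int m"]) auto
    qed
  qed
qed

text \<open>Were x a p^s-th power modulo \<pi>^(m+1), so would be the partial sum over the j not
  divisible by p^s, since the near powers form a ring containing the remaining terms. That sum has
  valuation exactly m = e v(c_j0) + j0, which p^s does not divide because it divides e but not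
  j0.\<close>

lemma x_notin_near_powers:
  assumes dvd: "p ^ s dvd e" shows "\<iota> x \<notin> near_powers (Suc m)"
proof
  assume xR: "\<iota> x \<in> near_powers (Suc m)"
  have nd: "\<not> int (p ^ s) dvd int m"
  proof
    assume "int (p ^ s) dvd int m"
    then have "int (p ^ s) dvd int e * vK (c j0) + int j0" using j0(4) by simp
    moreover have "int (p ^ s) dvd int e * vK (c j0)" using dvd by (metis dvd_mult2 of_nat_dvd_iff)
    ultimately have "int (p ^ s) dvd int j0" by (metis dvd_add_right_iff)
    then show False using j0(2) by (simp only: of_nat_dvd_iff)
  qed
  \<comment> \<open>v_L(p) is divisible by p^s and m is not, so m + 1 \<le> v_L(p) and the ring
    property is available at precision m + 1.\<close>
  have "p ^ s dvd e * (p - 1)" using dvd by (rule dvd_mult2)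
  then have "m \<noteq> e * (p - 1)" using nd by (auto simp only: of_nat_dvd_iff)
  then have k: "Suc m \<le> e * (p - 1)" using m_le by simp
  let ?J = "{j \<in> {1..e}. \<not> p ^ s dvd j}" and ?J' = "{j \<in> {1..e}. p ^ s dvd j}"
  have "{1..e} = ?J \<union> ?J'" by auto
  then have "(\<Sum>j\<in>{1..e}. \<iota> (c j) * \<pi> ^ j) = (\<Sum>j\<in>?J \<union> ?J'. \<iota> (c j) * \<pi> ^ j)" by (simp only:)
  also have "\<dots> = (\<Sum>j\<in>?J. \<iota> (c j) * \<pi> ^ j) + (\<Sum>j\<in>?J'. \<iota> (c j) * \<pi> ^ j)"
    by (rule sum.union_disjoint) auto
  finally have "\<iota> x = (\<Sum>j\<in>?J. \<iota> (c j) * \<pi> ^ j) + (\<Sum>j\<in>?J'. \<iota> (c j) * \<pi> ^ j)"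
    by (simp only: expansion)
  then have "(\<Sum>j\<in>?J. \<iota> (c j) * \<pi> ^ j) = \<iota> x - (\<Sum>j\<in>?J'. \<iota> (c j) * \<pi> ^ j)"
    by (simp only: eq_diff_eq)
  also have "\<dots> = \<iota> x + \<iota> (- 1) * (\<Sum>j\<in>?J'. \<iota> (c j) * \<pi> ^ j)"
    by (simp only: emb_simps(2,5) mult_minus_left mult_1 diff_conv_add_uminus)
  finally have T: "(\<Sum>j\<in>?J. \<iota> (c j) * \<pi> ^ j) = \<iota> x + \<iota> (- 1) * (\<Sum>j\<in>?J'. \<iota> (c j) * \<pi> ^ j)" .
  have "(\<Sum>j\<in>?J'. \<iota> (c j) * \<pi> ^ j) \<in> near_powers (Suc m)"
  proof (rule near_powers_sum[OF k])
    fix j assume j: "j \<in> ?J'"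
    then have "\<iota> (c j) \<in> near_powers (Suc m)" by (intro near_powers_emb[OF k xR] c_val_ring) simp
    moreover have "\<pi> ^ j \<in> near_powers (Suc m)"
    proof -
      obtain i where i: "j = p ^ s * i" using j by blast
      have "(\<pi> ^ i) ^ p ^ s \<in> near_powers (Suc m)" using pi by (intro near_powers_power) (simp add: max_pow_def L.val_power)
      then show ?thesis by (simp add: i mult.commute flip: power_mult)
    qed
    ultimately show "\<iota> (c j) * \<pi> ^ j \<in> near_powers (Suc m)" by (rule near_powers_mult)
  qed
  then have TR: "(\<Sum>j\<in>?J. \<iota> (c j) * \<pi> ^ j) \<in> near_powers (Suc m)"
    unfolding T by (intro near_powers_add[OF k xR] near_powers_mult near_powers_emb[OF k xR]) (simp_all add: max_pow_def)
  define H where "H = {j \<in> ?J. c j \<noteq> 0}"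
  have H: "finite H" "j0 \<in> H" "H \<subseteq> {1..<1 + e}" using j0 by (auto simp: H_def)
  then have "H \<noteq> {}" by blast
  have HJ: "(\<Sum>j\<in>H. \<iota> (c j) * \<pi> ^ j) = (\<Sum>j\<in>?J. \<iota> (c j) * \<pi> ^ j)"
    by (rule sum.mono_neutral_left) (auto simp: H_def)
  have "(\<Sum>j\<in>H. \<iota> (c j) * \<pi> ^ j) \<noteq> 0 \<and>
      vL (\<Sum>j\<in>H. \<iota> (c j) * \<pi> ^ j) = Min ((\<lambda>j. int e * vK (c j) + int j) ` H)"
    by (rule val_power_sum[OF pi H(1) \<open>H \<noteq> {}\<close> _ H(3)]) (simp add: H_def)
  moreover have "Min ((\<lambda>j. int e * vK (c j) + int j) ` H) = int m"
    by (rule Min_eqI) (use H j0 m_min in \<open>auto simp: H_def\<close>)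
  ultimately have val: "(\<Sum>j\<in>?J. \<iota> (c j) * \<pi> ^ j) \<noteq> 0" "vL (\<Sum>j\<in>?J. \<iota> (c j) * \<pi> ^ j) = int m"
    unfolding HJ by auto
  obtain y where y: "(\<Sum>j\<in>?J. \<iota> (c j) * \<pi> ^ j) - y ^ p ^ s \<in> max_pow vL (int (Suc m))"
    using TR by (auto simp: near_powers_def)
  then have "- ((\<Sum>j\<in>?J. \<iota> (c j) * \<pi> ^ j) - y ^ p ^ s) \<in> max_pow vL (vL (\<Sum>j\<in>?J. \<iota> (c j) * \<pi> ^ j) + 1)"
    unfolding val by (simp only: L.max_pow_uminus) (simp add: add.commute)
  from L.val_add_eq[OF val(1) this] have "y ^ p ^ s \<noteq> 0" "vL (y ^ p ^ s) = int m" using val(2) by auto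
  moreover have "y \<noteq> 0" using calculation(1) p_pos by (auto simp: power_0_left)
  ultimately have "int (p ^ s) * vL y = int m" by (metis L.val_power)
  then show False using nd by (metis dvd_triv_left)
qed

lemma ex_unit_power_iff:
  assumes k: "1 \<le> k"
  shows "(\<exists>u\<in>unit_group vL 1. \<iota> (1 + x) * u ^ p ^ s \<in> unit_group vL k) \<longleftrightarrow> k \<le> m"
proof
  have m1: "1 \<le> m" using e_le_m e_pos by simp
  have x1: "\<iota> x \<in> max_pow vL (int e)" "\<iota> x \<noteq> 0" "vL (\<iota> x) = int e"
    using emb_max_pow[of x 1] x val_emb[of x] by (auto simp: max_pow_def)
  have inv: "inverse u \<in> unit_group vL 1" if "u \<in> unit_group vL 1" for u
  proof -
    have u: "u \<noteq> 0" "vL u = 0" using L.unit_group_nonzero[OF _ that] L.unit_group_val[OF _ that] by auto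
    then have "u * inverse u - u = - (u - 1)" by simp
    then show ?thesis using that L.unit_group_iff[OF u, of "inverse u" 1]
      by (simp add: unit_group_def flip: L.max_pow_uminus[of "u - 1"])
  qed
  \<comment> \<open>Dividing by the unit u^(p^s) turns weights in the coset of
    \<open>\<iota> (1 + x)\<close> into distances from it to p^s-th powers.\<close>
  have move: "\<iota> (1 + x) * u ^ p ^ s \<in> unit_group vL i \<longleftrightarrow> \<iota> (1 + x) - inverse u ^ p ^ s \<in> max_pow vL (int i)"
    if "u \<in> unit_group vL 1" for u i
  proof -
    have u: "inverse u ^ p ^ s \<noteq> 0" "vL (inverse u ^ p ^ s) = 0"
      using L.unit_group_nonzero[OF _ inv[OF that]] L.unit_group_val[OF _ inv[OF that]]
        L.val_power[of "inverse u" "p ^ s"] by auto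
    have "inverse u ^ p ^ s * (\<iota> (1 + x) * u ^ p ^ s) = \<iota> (1 + x)"
      using L.unit_group_nonzero[OF _ that] by (simp add: power_inverse)
    then show ?thesis using L.unit_group_iff[OF u, of "\<iota> (1 + x) * u ^ p ^ s" "int i"]
      by (simp only: unit_group_def mem_Collect_eq)
  qed
  {
    assume km: "k \<le> m"
    obtain y where y: "y \<in> val_ring vL" "\<iota> x - y ^ p ^ s \<in> max_pow vL (int m)"
      using x_in_near_powers[of m] by (auto simp: near_powers_def)
    then have "\<iota> x - y ^ p ^ s \<in> max_pow vL 1" "\<iota> x \<in> max_pow vL 1"
      using m1 x1(1) e_pos L.max_pow_anti[of 1 "int m"] L.max_pow_anti[of 1 "int e"] by auto
    then have "y ^ p ^ s \<in> max_pow vL 1" using L.max_pow_cong by blast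
    then have y1: "y \<in> max_pow vL 1" using L.in_max_pow_1_of_power y(1) by blast
    then have U: "1 + y \<in> unit_group vL 1" by (simp add: unit_group_def)
    have "(1 + y) ^ p ^ s - (1 ^ p ^ s + y ^ p ^ s) \<in> max_pow vL (int m)"
      by (rule L.frobenius_add_cong[OF p p_in_max_pow[OF m_le]]) (use y in auto)
    then have "(\<iota> x - y ^ p ^ s) - ((1 + y) ^ p ^ s - (1 ^ p ^ s + y ^ p ^ s)) \<in> max_pow vL (int m)"
      using y(2) L.max_pow_diff by blast
    then have "\<iota> (1 + x) - (1 + y) ^ p ^ s \<in> max_pow vL (int m)" by (simp add: algebra_simps)
    then have "\<iota> (1 + x) - inverse (inverse (1 + y)) ^ p ^ s \<in> max_pow vL (int k)"
      using km L.max_pow_anti[of "int k" "int m"] by simp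
    then show "\<exists>u\<in>unit_group vL 1. \<iota> (1 + x) * u ^ p ^ s \<in> unit_group vL k"
      using move[OF inv[OF U]] inv[OF U] by blast
  }
  assume "\<exists>u\<in>unit_group vL 1. \<iota> (1 + x) * u ^ p ^ s \<in> unit_group vL k"
  then obtain u where u: "u \<in> unit_group vL 1" "\<iota> (1 + x) * u ^ p ^ s \<in> unit_group vL k" by blast
  show "k \<le> m"
  proof (rule ccontr)
    assume "\<not> k \<le> m"
    then have "\<iota> (1 + x) * u ^ p ^ s \<in> unit_group vL (Suc m)" using L.unit_group_anti[OF _ u(2), of "Suc m"] by simp
    then have d: "\<iota> (1 + x) - inverse u ^ p ^ s \<in> max_pow vL (int (Suc m))" using move[OF u(1)] by blast
    define y where "y = inverse u - 1"
    have y1: "y \<in> max_pow vL 1" using inv[OF u(1)] by (simp add: y_def unit_group_def)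
    have y0: "y \<in> val_ring vL" using y1 by (rule_tac L.max_pow_anti) auto
    \<comment> \<open>Precision v_L(p) + 1 instead of v_L(p), since m + 1 is required and m may
      equal v_L(p).\<close>
    have "(1 + y) ^ p ^ s - (1 + y ^ p ^ s) \<in> max_pow vL (int (e * (p - 1)) + 1)"
      by (rule L.one_plus_frobenius_cong[OF p p_in_max_pow _ y1]) auto
    then have "(1 + y) ^ p ^ s - (1 + y ^ p ^ s) \<in> max_pow vL (int (Suc m))"
      by (rule L.max_pow_anti[rotated]) (use m_le in linarith)
    then have "(\<iota> (1 + x) - inverse u ^ p ^ s) + ((1 + y) ^ p ^ s - (1 + y ^ p ^ s)) \<in> max_pow vL (int (Suc m))"
      using d L.max_pow_add by blast
    moreover have "(\<iota> (1 + x) - inverse u ^ p ^ s) + ((1 + y) ^ p ^ s - (1 + y ^ p ^ s)) = \<iota> x - y ^ p ^ s"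
      by (simp add: y_def)
    ultimately have xy: "\<iota> x - y ^ p ^ s \<in> max_pow vL (int (Suc m))" by (simp only:)
    show False
    proof (cases "p ^ s dvd e")
      case True
      then show False using x_notin_near_powers xy y0 by (auto simp: near_powers_def)
    next
      case False
      \<comment> \<open>Now e itself is an admissible index, so m = e is the valuation of x; a
        p^s-th power that close to x would have valuation e, which p^s does not divide.\<close>
      then have "int m \<le> int e * vK (c e) + int e" using m_min[of e] c e_pos by simp
      then have me: "m = e" using c(3) e_le_m by simp
      have "- (\<iota> x - y ^ p ^ s) \<in> max_pow vL (vL (\<iota> x) + 1)"
        using xy unfolding x1 me by (simp only: L.max_pow_uminus) (simp add: add.commute)
      from L.val_add_eq[OF x1(2) this] have "y ^ p ^ s \<noteq> 0" "vL (y ^ p ^ s) = int e" using x1(3) by auto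
      moreover have "y \<noteq> 0" using calculation(1) p_pos by (auto simp: power_0_left)
      ultimately have "int (p ^ s) * vL y = int e" by (metis L.val_power)
      then have "int (p ^ s) dvd int e" by (metis dvd_triv_left)
      then show False using False by (simp only: of_nat_dvd_iff)
    qed
  qed
qed

end

end

section \<open>Newton polygons\<close>

text \<open>The region on or above the hull of T is convex, so it contains the hull of S once it
  contains S.\<close>

lemma convex_hull_below:
  fixes S T :: "(real \<times> real) set"
  assumes "\<And>x y. (x, y) \<in> S \<Longrightarrow> \<exists>y'\<le>y. (x, y') \<in> convex hull T" and "(x, y) \<in> convex hull S"
  shows "\<exists>y'\<le>y. (x, y') \<in> convex hull T"
proof -
  define D where "D = {(x, y). \<exists>y'\<le>y. (x, y') \<in> convex hull T}"
  have "convex D"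
  proof (rule convexI)
    fix P Q :: "real \<times> real" and u v :: real
    assume PQ: "P \<in> D" "Q \<in> D" and uv: "0 \<le> u" "0 \<le> v" "u + v = 1"
    obtain x1 y1 x2 y2 where eq: "P = (x1, y1)" "Q = (x2, y2)" by (cases P, cases Q)
    obtain z1 z2 where z: "z1 \<le> y1" "(x1, z1) \<in> convex hull T" "z2 \<le> y2" "(x2, z2) \<in> convex hull T"
      using PQ unfolding eq D_def by auto
    have "u *\<^sub>R (x1, z1) + v *\<^sub>R (x2, z2) \<in> convex hull T"
      using convexD[OF convex_convex_hull z(2,4) uv] .
    moreover have "u * z1 + v * z2 \<le> u * y1 + v * y2" using z uv by (intro add_mono mult_left_mono)
    ultimately show "u *\<^sub>R P + v *\<^sub>R Q \<in> D" unfolding eq D_def by auto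
  qed
  moreover have "S \<subseteq> D" using assms(1) by (auto simp: D_def)
  ultimately have "convex hull S \<subseteq> D" by (rule hull_minimal[rotated])
  then show ?thesis using assms(2) by (auto simp: D_def)
qed

text \<open>Mutual domination of S and T; the hypotheses are symmetric, so applying it both ways
  yields equality.\<close>

lemma lower_convex_hull_subset:
  assumes "\<And>x y. (x, y) \<in> S \<Longrightarrow> \<exists>y'\<le>y. (x, y') \<in> convex hull T"
    and "\<And>x y. (x, y) \<in> T \<Longrightarrow> \<exists>y'\<le>y. (x, y') \<in> convex hull S"
  shows "lower_convex_hull S \<subseteq> lower_convex_hull T"
proof
  fix P assume P: "P \<in> lower_convex_hull S"
  obtain x y where eq: "P = (x, y)" by (cases P)
  have xy: "(x, y) \<in> convex hull S" and min: "\<And>y'. (x, y') \<in> convex hull S \<Longrightarrow> y \<le> y'"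
    using P by (auto simp: eq lower_convex_hull_def)
  have ge: "y \<le> z" if z: "(x, z) \<in> convex hull T" for z
    using convex_hull_below[of T S, OF assms(2) z] min by force
  obtain y' where y': "y' \<le> y" "(x, y') \<in> convex hull T"
    using convex_hull_below[of S T, OF assms(1) xy] by blast
  then have "y' = y" using ge by force
  then show "P \<in> lower_convex_hull T" using y' ge by (auto simp: eq lower_convex_hull_def)
qed

text \<open>A chord never rises above the higher of its two ends. Both polygon comparisons use this
  with (e, e) as the right end.\<close>

lemma convex_hull_segment_below:
  fixes S :: "(real \<times> real) set"
  assumes S: "(x1, y1) \<in> S" "(x2, y2) \<in> S" and x: "x1 \<le> x" "x \<le> x2" and y: "y1 \<le> y" "y2 \<le> y"
  shows "\<exists>y'\<le>y. (x, y') \<in> convex hull S"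
proof (cases "x1 = x2")
  case True
  then show ?thesis using S x y hull_inc[OF S(1), of convex] by auto
next
  case False
  define t where "t = (x - x1) / (x2 - x1)"
  have "x1 < x2" using x False by simp
  then have t: "0 \<le> t" "0 \<le> 1 - t" "1 - t + t = 1" using x by (auto simp: t_def divide_le_eq_1)
  have "(1 - t) *\<^sub>R (x1, y1) + t *\<^sub>R (x2, y2) \<in> convex hull S"
    by (rule convexD[OF convex_convex_hull _ _ t(2,1,3)]) (auto intro: hull_inc S)
  moreover have "(1 - t) * x1 + t * x2 = x"
  proof -
    have "t * (x2 - x1) = x - x1" using False by (simp add: t_def)
    then show ?thesis by (simp add: algebra_simps)
  qed
  moreover have "(1 - t) * y1 + t * y2 \<le> (1 - t) * y + t * y" using t y by (intro add_mono mult_left_mono) auto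
  ultimately show ?thesis by (intro exI[of _ "(1 - t) * y1 + t * y2"]) (auto simp: algebra_simps)
qed

section \<open>Twist coefficients, iterates of the shift, binomials modulo p\<close>

lemma coeff_twist:
  assumes "field_embedding \<iota>"
  shows "coeff (twist \<iota> g \<pi>) k = (\<Sum>j\<le>degree g. of_nat (j choose k) * \<iota> (coeff g j) * \<pi> ^ j)"
proof -
  note emb = field_embedding_simps[OF assms]
  have lin: "coeff ([:\<pi>, \<pi>:] ^ j) k = of_nat (j choose k) * \<pi> ^ j" for j
  proof (cases "k \<le> j")
    case True
    then show ?thesis by (simp add: coeff_linear_poly_power mult.assoc flip: power_add)
  next
    case False
    have "degree ([:\<pi>, \<pi>:] ^ j) \<le> degree [:\<pi>, \<pi>:] * j" by (rule degree_power_le)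
    also have "\<dots> \<le> 1 * j" by (intro mult_right_mono) auto
    finally show ?thesis using False by (simp add: coeff_eq_0 binomial_eq_0)
  qed
  have "map_poly (\<lambda>x. [:x:]) (map_poly \<iota> g) = map_poly (\<lambda>x. [:\<iota> x:]) g"
    by (rule poly_eqI) (simp add: coeff_map_poly emb)
  moreover have "degree (map_poly (\<lambda>x. [:\<iota> x:]) g) = degree g"
    by (rule degree_map_poly) (simp add: emb)
  ultimately have "twist \<iota> g \<pi> = (\<Sum>j\<le>degree g. Polynomial.smult (\<iota> (coeff g j)) ([:\<pi>, \<pi>:] ^ j))"
    by (simp add: twist_def pcompose_altdef poly_altdef coeff_map_poly emb)
  then show ?thesis by (simp add: coeff_sum lin mult_ac)
qed

lemma rho_funpow_le: "1 \<le> p \<Longrightarrow> (rho e p ^^ k) i \<le> p ^ k * i"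
proof (induction k)
  case (Suc k)
  have "(rho e p ^^ Suc k) i \<le> p * (rho e p ^^ k) i" by (simp add: rho_def)
  also have "\<dots> \<le> p * (p ^ k * i)" using Suc by (intro mult_left_mono) auto
  finally show ?case by (simp add: mult.assoc)
qed simp

text \<open>Here v_L(p) = n(p - 1), so p t \<le> t + v_L(p) exactly when t \<le> n. A value at most
  n p forces the previous iterate to be at most n, so every step was multiplication by p.\<close>

lemma rho_funpow_eq:
  assumes "1 < p" and "(rho (n * (p - 1)) p ^^ k) i \<le> n * p"
  shows "(rho (n * (p - 1)) p ^^ k) i = p ^ k * i"
  using assms(2)
proof (induction k)
  case (Suc k)
  let ?t = "(rho (n * (p - 1)) p ^^ k) i"
  obtain q where q: "p = Suc q" "q > 0" using assms(1) by (cases p) auto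
  have step: "(rho (n * (p - 1)) p ^^ Suc k) i = min (?t + n * (p - 1)) (p * ?t)"
    using rho_def[of "n * (p - 1)" p ?t] by (simp only: funpow.simps o_apply)
  have le: "min (?t + n * q) (Suc q * ?t) \<le> n * Suc q" using Suc.prems unfolding step by (simp add: q)
  have t: "?t \<le> n"
  proof (rule ccontr)
    assume "\<not> ?t \<le> n"
    then have "n < ?t" by simp
    then have "Suc q * n < Suc q * ?t" by (simp only: mult_less_cancel1) simp
    then show False using le \<open>n < ?t\<close> by (simp add: min_def split: if_splits)
  qed
  have "q * ?t \<le> n * q" using t by (simp add: mult.commute)
  then have "min (?t + n * q) (Suc q * ?t) = Suc q * ?t" by simp
  then have "(rho (n * (p - 1)) p ^^ Suc k) i = p * ?t" unfolding step by (simp add: q)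
  moreover have "?t \<le> n * p" using t q by simp
  ultimately show ?case using Suc.IH by (simp only: power_Suc mult.assoc)
qed simp

lemma rho_strict_mono:
  assumes "1 < p" "i < j" shows "rho e p i < rho e p j"
proof -
  have "min (i + e) a < min (j + e) b" if "a < b" for a b :: nat using that assms(2) by auto
  moreover have "p * i < p * j" using assms by simp
  ultimately show ?thesis unfolding rho_def by blast
qed

text \<open>The counting fact behind Sylow's theorem: (p^a u choose p^a) and u have the same
  multiplicity of p, here with u prime to p. It makes p^a, the exact power of p in j, a position
  where the j-th term enters with a unit coefficient.\<close>

lemma prime_not_dvd_choose_multiplicity:
  fixes p j :: nat
  assumes p: "prime p" and j: "j > 0"
  shows "\<not> p dvd (j choose p ^ multiplicity p j)"
proof -
  obtain u where u: "j = p ^ multiplicity p j * u" using multiplicity_dvd[of p j] by blast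
  have "u > 0" using u j by (cases u) auto
  have "\<not> p dvd u"
  proof
    assume "p dvd u"
    then have "p ^ Suc (multiplicity p j) dvd j" by (subst (2) u) simp
    then have "Suc (multiplicity p j) \<le> multiplicity p j"
      by (rule multiplicity_geI[rotated 2]) (use j p not_prime_unit in auto)
    then show False by simp
  qed
  then have "multiplicity p (j choose p ^ multiplicity p j) = 0"
    using const_p_fac[OF \<open>u > 0\<close> p, of "multiplicity p j"] u by (simp add: not_dvd_imp_multiplicity_0)
  moreover have "j choose p ^ multiplicity p j \<noteq> 0"
    using dvd_imp_le[OF multiplicity_dvd j] by (simp add: not_less)
  ultimately show ?thesis using p by (metis multiplicity_eq_zero_iff not_prime_unit)
qed

text \<open>From k (j choose k) = j (j-1 choose k-1): if p does not divide the binomial, the power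
  of p in j must go into k. A term j entering position k with a unit coefficient thus forces k \<ge>
  p^t.\<close>

lemma power_dvd_of_not_dvd_choose:
  fixes p j k :: nat
  assumes p: "prime p" and k: "1 \<le> k" and "\<not> p dvd (j choose k)" and "p ^ t dvd j"
  shows "p ^ t dvd k"
proof -
  have "p ^ t dvd k * (j choose k)" using assms(4) k by (simp add: times_binomial_minus1_eq)
  moreover have "coprime (p ^ t) (j choose k)" using p assms(3) by (simp add: prime_imp_coprime)
  ultimately show ?thesis by (simp add: coprime_dvd_mult_left_iff)
qed

text \<open>A jump i with s = \<beta>(i) has ordinate at least m_s, the valuation of some a_j
  \<pi>^j with p^t exactly dividing j and t < s; the coefficient at p^t is no higher. Conversely, a
  coefficient at k has valuation at least m_s for some s with p^(s-1) \<le> k, and m_s is the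
  ordinate of a jump i with \<beta>(i) \<le> s.\<close>

lemma (in val_extension) newton_polygon_eq:
  fixes g :: "'k poly" and p :: nat and x :: 'k and I :: "nat set" and \<beta> :: "nat \<Rightarrow> nat"
  defines "\<rho> \<equiv> rho (e * (p - 1)) p"
  assumes pres: "eisenstein_presentation vK \<iota> g \<pi>"
    and fin: "finite B0" "V.span B0 = UNIV" and deg: "ext_degree \<iota> = e"
    and p: "prime p" and pK: "vK (of_nat p) = int (p - 1)"
    and char0: "\<And>m. m > 0 \<Longrightarrow> (of_nat m :: 'k) \<noteq> 0"
    and lf: "local_field vK"
    and x: "x \<noteq> 0" "vK x = 1"
    and ssep: "strongly_separable p vK vL \<iota>"
    and ejs: "extended_jump_set \<rho> I \<beta>" "\<And>i. i \<in> I \<Longrightarrow> 1 \<le> i"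
    and jump: "\<And>s k. 1 \<le> s \<Longrightarrow> 1 \<le> k \<Longrightarrow>
        (\<exists>u\<in>unit_group vL 1. \<iota> (1 + x) * u ^ p ^ s \<in> unit_group vL k) \<longleftrightarrow>
        (\<forall>i\<in>I. \<beta> i \<le> s \<longrightarrow> k \<le> (\<rho> ^^ (\<beta> i - 1)) i)"
  shows "lower_convex_hull
           ({(real (p ^ (\<beta> i - 1)), real (p ^ (\<beta> i - 1) * i)) | i. i \<in> I} \<union> {(real e, real e)})
         = newton_polygon vL (twist \<iota> g \<pi>)"
proof -
  have p2: "p \<ge> 2" using p prime_ge_2_nat by blast
  have g: "eisenstein vK g" "degree g = e" "poly (map_poly \<iota> g) \<pi> = 0"
    using pres deg by (auto simp: eisenstein_presentation_def)
  have pi: "\<pi> \<noteq> 0" "vL \<pi> = 1" using eisenstein_root_val[OF g] by auto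
  define a where "a = coeff g"
  have a: "a e = 1" "a 0 \<noteq> 0" "vK (a 0) = 1" "\<And>i. i < e \<Longrightarrow> a i \<in> max_pow vK 1"
    using g by (auto simp: eisenstein_def a_def)
  have "degree (map_poly \<iota> g) = e" using g(2) by (subst degree_map_poly) auto
  then have a_sum: "(\<Sum>j\<le>e. \<iota> (a j) * \<pi> ^ j) = 0"
    using g(3) by (simp add: poly_altdef coeff_map_poly a_def)
  have charL: "(of_nat m :: 'l) \<noteq> 0" if "m > 0" for m
    using char0[OF that] emb_simps(8,10) by metis
  have pnz: "(of_nat p :: 'k) \<noteq> 0" "(of_nat p :: 'l) \<noteq> 0" using char0 charL p2 by auto
  have pL: "vL (of_nat p) = int (e * (p - 1))" using val_emb[OF pnz(1)] pK by simp
  have pK1: "of_nat p \<in> max_pow vK 1" using pK p2 by (simp add: max_pow_def)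
  have val_of_nat: "vK (of_nat m) \<ge> int (p - 1)" if m: "p dvd m" "m > 0" for m
  proof -
    obtain m' where m': "m = p * m'" using m(1) by blast
    then have "(of_nat m' :: 'k) \<noteq> 0" using m(2) char0 by simp
    moreover have "of_nat m' \<in> val_ring vK" by simp
    ultimately show ?thesis using pK pnz m' by (simp add: K.val_mult max_pow_def)
  qed
  have val_of_nat0: "vK (of_nat m) \<ge> 0" if "m > 0" for m
    using K.of_nat_in_val_ring[of m] char0[OF that] by (simp add: max_pow_def)
  define w where "w = (\<lambda>j. int e * vK (a j) + int j)"
  have a_val: "vK (a j) \<ge> 0" if "j \<le> e" "a j \<noteq> 0" for j
    using that a(1) a(4)[of j] by (cases "j = e") (auto simp: max_pow_def)
  have w_ge: "int e \<le> w j" if "j \<in> {1..e}" "a j \<noteq> 0" for j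
  proof (cases "j = e")
    case False
    then have "vK (a j) \<ge> 1" using that a(4)[of j] by (auto simp: max_pow_def)
    then have "int e * 1 \<le> int e * vK (a j)" by (intro mult_left_mono) auto
    then show ?thesis by (simp add: w_def)
  qed (simp add: w_def a)
  have w_e: "w e = int e" by (simp add: w_def a)
  \<comment> \<open>Integer weights m j stay in K, so the window argument for valuations still
    applies; used with m j = j for \<pi> g'(\<pi>) and with binomials for the twist.\<close>
  have val_sum: "\<exists>j\<in>{1..e}. m j > 0 \<and> a j \<noteq> 0 \<and>
        vL (\<Sum>j\<in>{1..e}. of_nat (m j) * \<iota> (a j) * \<pi> ^ j) = int e * vK (of_nat (m j)) + w j"
      "(\<Sum>j\<in>{1..e}. of_nat (m j) * \<iota> (a j) * \<pi> ^ j) \<noteq> 0"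
      "\<And>i. i \<in> {1..e} \<Longrightarrow> m i > 0 \<Longrightarrow> a i \<noteq> 0 \<Longrightarrow>
        vL (\<Sum>j\<in>{1..e}. of_nat (m j) * \<iota> (a j) * \<pi> ^ j) \<le> int e * vK (of_nat (m i)) + w i"
    if ex: "\<exists>j\<in>{1..e}. m j > 0 \<and> a j \<noteq> 0" for m
  proof -
    define H where "H = {j \<in> {1..e}. m j > 0 \<and> a j \<noteq> 0}"
    let ?b = "\<lambda>j. of_nat (m j) * a j" and ?W = "\<lambda>j. int e * vK (of_nat (m j)) + w j"
    let ?S = "\<Sum>j\<in>{1..e}. of_nat (m j) * \<iota> (a j) * \<pi> ^ j"
    have H: "finite H" "H \<noteq> {}" "H \<subseteq> {1..<1 + e}" using ex by (auto simp: H_def)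
    have b: "?b j \<noteq> 0" if "j \<in> H" for j using that char0 by (simp add: H_def)
    have eq: "(\<Sum>j\<in>H. \<iota> (?b j) * \<pi> ^ j) = ?S"
      by (rule sum.mono_neutral_cong_left) (auto simp: H_def intro!: gr0I)
    have W: "(\<lambda>j. int e * vK (?b j) + int j) ` H = ?W ` H"
      by (rule image_cong) (use char0 in \<open>auto simp: H_def w_def K.val_mult algebra_simps\<close>)
    have "(\<Sum>j\<in>H. \<iota> (?b j) * \<pi> ^ j) \<noteq> 0 \<and> vL (\<Sum>j\<in>H. \<iota> (?b j) * \<pi> ^ j) = Min ((\<lambda>j. int e * vK (?b j) + int j) ` H)"
      by (rule val_power_sum[OF pi H(1,2) _ H(3)]) (rule b)
    then have S: "?S \<noteq> 0" "vL ?S = Min (?W ` H)" unfolding eq W by auto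
    show "?S \<noteq> 0" by (rule S)
    have "Min (?W ` H) \<in> ?W ` H" using H by (intro Min_in) auto
    then obtain j where "j \<in> H" "vL ?S = ?W j" using S by auto
    then show "\<exists>j\<in>{1..e}. m j > 0 \<and> a j \<noteq> 0 \<and> vL ?S = ?W j" by (auto simp: H_def)
    show "vL ?S \<le> ?W i" if "i \<in> {1..e}" "m i > 0" "a i \<noteq> 0" for i
      unfolding S(2) using H that by (intro Min_le) (auto simp: H_def)
  qed
  have e1: "e \<in> {1..e}" using e_pos by simp

  \<comment> \<open>Through the different, strong separability bounds v(g'(\<pi>)) by v(p) - 1,
    hence v(\<pi> g'(\<pi>)) by v(p). The term attaining the latter has j prime to p: otherwise the
    factor j alone would contribute v(p), on top of w j \<ge> e > 0.\<close>
  obtain j1 where j1: "j1 \<in> {1..e}" "\<not> p dvd j1" "a j1 \<noteq> 0" "w j1 \<le> int (e * (p - 1))"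
  proof -
    define d where "d = (\<Sum>k\<in>{1..e}. of_nat k * \<iota> (a k) * \<pi> ^ (k - 1))"
    let ?D = "\<Sum>j\<in>{1..e}. of_nat j * \<iota> (a j) * \<pi> ^ j"
    have D: "?D = \<pi> * d"
      unfolding d_def sum_distrib_left
    proof (rule sum.cong)
      fix k assume "k \<in> {1..e}"
      then have "\<pi> ^ k = \<pi> * \<pi> ^ (k - 1)" by (cases k) auto
      then show "of_nat k * \<iota> (a k) * \<pi> ^ k = \<pi> * (of_nat k * \<iota> (a k) * \<pi> ^ (k - 1))" by (simp add: mult_ac)
    qed simp
    have ex: "\<exists>j\<in>{1..e}. j > 0 \<and> a j \<noteq> 0" using e1 a by (intro bexI[of _ e]) auto
    obtain z where z: "z \<in> different vK vL \<iota>" "val_ext vL z < val_ext vL (of_nat p)"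
      using ssep by (auto simp: strongly_separable_def INF_less_iff)
    have z0: "z \<noteq> 0" "vL z < vL (of_nat p)"
      using z(2) pnz by (auto simp: val_ext_def split: if_splits)
    have d0: "d \<noteq> 0" using val_sum(2)[OF ex] D by auto
    have "vL d \<le> vL z"
      by (rule different_val_ge[OF pi power_basis[OF pi fin deg] a(1) a_sum d_def d0 z(1) z0(1)])
    then have "vL ?D \<le> int (e * (p - 1))" using z0(2) pL D d0 pi by (simp add: L.val_mult)
    then obtain j where j: "j \<in> {1..e}" "a j \<noteq> 0" "int e * vK (of_nat j) + w j \<le> int (e * (p - 1))"
      using val_sum(1)[OF ex] by auto
    have "\<not> p dvd j"
    proof
      assume "p dvd j"
      then have "int e * int (p - 1) \<le> int e * vK (of_nat j)" using j by (intro mult_left_mono val_of_nat) auto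
      then show False using j(3) w_ge[OF j(1,2)] e_pos unfolding of_nat_mult by linarith
    qed
    moreover have "0 \<le> int e * vK (of_nat j)" using j val_of_nat0 by simp
    ultimately show ?thesis using that j by auto
  qed

  \<comment> \<open>\<open>j1\<close> lies in \<open>Ms s\<close> for every s \<ge> 1, so the minima
    exist and are all bounded by v(p).\<close>
  define Ms where "Ms = (\<lambda>s. {j \<in> {1..e}. a j \<noteq> 0 \<and> \<not> p ^ s dvd j})"
  define m where "m = (\<lambda>s. nat (Min (w ` Ms s)))"
  have j1_Ms: "j1 \<in> Ms s" if "1 \<le> s" for s
  proof -
    have "p dvd p ^ s" using that by simp
    then have "\<not> p ^ s dvd j1" using j1(2) dvd_trans by blast
    then show ?thesis using j1 by (simp add: Ms_def)
  qed
  have finMs: "finite (w ` Ms s)" for s by (simp add: Ms_def)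
  have m_att: "\<exists>j0\<in>Ms s. int (m s) = w j0" and m_min: "\<And>j. j \<in> Ms s \<Longrightarrow> int (m s) \<le> w j"
    if s: "1 \<le> s" for s
  proof -
    have "Min (w ` Ms s) \<in> w ` Ms s" using j1_Ms[OF s] finMs by (intro Min_in) auto
    then obtain j0 where j0: "j0 \<in> Ms s" "Min (w ` Ms s) = w j0" by blast
    then have "0 \<le> w j0" using w_ge[of j0] by (simp add: Ms_def)
    then have mM: "int (m s) = Min (w ` Ms s)" using j0 by (simp add: m_def)
    then show "\<exists>j0\<in>Ms s. int (m s) = w j0" using j0 by auto
    show "int (m s) \<le> w j" if "j \<in> Ms s" for j unfolding mM using finMs that by (intro Min_le) auto
  qed
  have m_ge: "e \<le> m s" if "1 \<le> s" for s
    using m_att[OF that] w_ge by (force simp: Ms_def)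
  have m_le: "m s \<le> e * (p - 1)" if "1 \<le> s" for s
    using order_trans[OF m_min[OF that j1_Ms[OF that]] j1(4)] by (simp only: of_nat_le_iff)

  \<comment> \<open>x / a_0 is a unit, as both are uniformizers of K, so the c j have the valuations
    of the a j.\<close>
  define c where "c = (\<lambda>j. - (x / a 0) * a j)"
  have xa: "x / a 0 \<noteq> 0" "vK (x / a 0) = 0" using x a by (auto simp: K.val_divide)
  have c0: "c j \<noteq> 0 \<longleftrightarrow> a j \<noteq> 0" for j using xa by (simp add: c_def)
  have cv: "vK (c j) = vK (a j)" if "a j \<noteq> 0" for j
    using that xa K.val_mult[of "- (x / a 0)" "a j"] K.val_uminus[of "x / a 0"] by (simp add: c_def)
  have expansion: "\<iota> x = (\<Sum>j\<in>{1..e}. \<iota> (c j) * \<pi> ^ j)"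
  proof -
    have "{..e} = insert 0 {1..e}" by auto
    then have "(\<Sum>j\<in>{1..e}. \<iota> (a j) * \<pi> ^ j) = - \<iota> (a 0)"
      using a_sum by (simp add: eq_neg_iff_add_eq_0 add.commute)
    then have "\<iota> (- (x / a 0)) * (\<Sum>j\<in>{1..e}. \<iota> (a j) * \<pi> ^ j) = \<iota> (- (x / a 0)) * \<iota> (- a 0)" by simp
    also have "\<dots> = \<iota> (- (x / a 0) * (- a 0))" by (simp only: emb_simps(4))
    also have "- (x / a 0) * (- a 0) = x" using a by simp
    finally show ?thesis by (simp only: c_def emb_simps(4) sum_distrib_left mult.assoc)
  qed
  have m_iff: "(\<forall>i\<in>I. \<beta> i \<le> s \<longrightarrow> k \<le> (\<rho> ^^ (\<beta> i - 1)) i) \<longleftrightarrow> k \<le> m s" if s: "1 \<le> s" and k: "1 \<le> k" for s k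
  proof -
    interpret ramified_zeta vK vL \<iota> e p s x c \<pi>
    proof unfold_locales
      show "\<exists>b\<in>val_ring vK. y - b ^ p ^ s \<in> max_pow vK 1" if "y \<in> val_ring vK" for y
        by (rule K.residue_perfect[OF lf p pK1 that])
      show "c j \<in> max_pow vK 1" if "j \<in> {1..<e}" for j
        using a(4)[of j] cv[of j] c0[of j] that by (auto simp: max_pow_def)
      show "c e \<noteq> 0" "vK (c e) = 0" using c0[of e] cv[of e] a by auto
    qed (use p pnz pL pi x expansion in auto)
    obtain j0 where j0: "j0 \<in> Ms s" "int (m s) = w j0" using m_att[OF s] by blast
    have "(\<exists>u\<in>unit_group vL 1. \<iota> (1 + x) * u ^ p ^ s \<in> unit_group vL k) \<longleftrightarrow> k \<le> m s"
    proof (rule ex_unit_power_iff[OF _ _ _ _ _ m_le[OF s] k])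
      show "int (m s) \<le> int e * vK (c j) + int j" if "j \<in> {1..e}" "\<not> p ^ s dvd j" "c j \<noteq> 0" for j
        using m_min[OF s, of j] that c0 cv by (simp add: Ms_def w_def)
      show "j0 \<in> {1..e}" "\<not> p ^ s dvd j0" "c j0 \<noteq> 0" "int (m s) = int e * vK (c j0) + int j0"
        using j0 c0 cv by (auto simp: Ms_def w_def)
    qed
    then show ?thesis using jump[OF s k] by blast
  qed
  have I_ge: "m s \<le> (\<rho> ^^ (\<beta> i - 1)) i" if "1 \<le> s" "i \<in> I" "\<beta> i \<le> s" for s i
    using m_iff[OF that(1), of "m s"] m_ge[OF that(1)] e_pos that by auto
  \<comment> \<open>Testing \<open>m_iff\<close> at m_s + 1 produces a jump whose iterate equals
    m_s. As m_s \<le> e(p - 1) \<le> e p, the iterate is in the linear range of \<rho> and equals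
    p^(\<beta>(i)-1) i.\<close>
  have I_att: "\<exists>i\<in>I. \<beta> i \<le> s \<and> p ^ (\<beta> i - 1) * i = m s" if s: "1 \<le> s" for s
  proof -
    obtain i where i: "i \<in> I" "\<beta> i \<le> s" "\<not> Suc (m s) \<le> (\<rho> ^^ (\<beta> i - 1)) i"
      using m_iff[OF s, of "Suc (m s)"] by auto
    then have eq: "(\<rho> ^^ (\<beta> i - 1)) i = m s" using I_ge[OF s i(1,2)] by simp
    moreover have "e * (p - 1) \<le> e * p" by simp
    ultimately have "(\<rho> ^^ (\<beta> i - 1)) i \<le> e * p" using m_le[OF s] by linarith
    then have "(\<rho> ^^ (\<beta> i - 1)) i = p ^ (\<beta> i - 1) * i"
      unfolding \<rho>_def using p2 by (intro rho_funpow_eq) auto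
    then show ?thesis using i eq by auto
  qed
  have I_low: "m s \<le> p ^ (\<beta> i - 1) * i" if "1 \<le> s" "i \<in> I" "\<beta> i \<le> s" for s i
    using I_ge[OF that] rho_funpow_le[of p "\<beta> i - 1" "e * (p - 1)" i] p2 by (simp add: \<rho>_def)
  have beta1: "1 \<le> \<beta> i" if "i \<in> I" for i using ejs(1) that by (auto simp: extended_jump_set_def)
  have e_lt: "e < p ^ s" if "e \<le> s" for s
  proof -
    have "s < p ^ s" using p2 by (intro power_gt_expt) auto
    then show ?thesis using that by simp
  qed
  have m_large: "m s = e" if s: "e \<le> s" for s
  proof -
    have "\<not> p ^ s dvd e" using e_lt[OF s] e_pos by (auto dest: dvd_imp_le)
    then have "e \<in> Ms s" using e1 a by (simp add: Ms_def)
    then show ?thesis using m_min[of s e] m_ge[of s] w_e s e_pos by simp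
  qed
  \<comment> \<open>p^e exceeds e and so does not divide it, hence m_e = e; the corresponding jump
    has the least possible ordinate.\<close>
  obtain i0 where i0: "i0 \<in> I" "p ^ (\<beta> i0 - 1) * i0 = e"
    using I_att[of e] m_large[of e] e_pos by auto
  have i0_rho: "(\<rho> ^^ (\<beta> i0 - 1)) i0 \<le> e"
    using rho_funpow_le[of p "\<beta> i0 - 1" "e * (p - 1)" i0] p2 i0 by (simp add: \<rho>_def)
  \<comment> \<open>No jump point may lie to the right of (e, e). If \<beta>(i) > \<beta>(i0), then
    i < i0, so \<open>(\<rho> ^^ \<beta> i) i\<close> is smaller than
    \<open>(\<rho> ^^ \<beta> i0) i0\<close>; but one step earlier the iterate of i is at least e
    and that of i0 at most e, and \<rho> is increasing.\<close>
  have pow_le: "p ^ (\<beta> i - 1) \<le> e" if i: "i \<in> I" for i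
  proof -
    have "\<beta> i \<le> \<beta> i0"
    proof (rule ccontr)
      assume lt: "\<not> \<beta> i \<le> \<beta> i0"
      have "i < i0"
      proof (rule ccontr)
        assume "\<not> i < i0"
        then have "i0 < i \<or> i0 = i" by auto
        moreover have "monotone_on I (<) (>) \<beta>" using ejs(1) by (auto simp: extended_jump_set_def)
        ultimately show False using lt i i0(1) monotone_onD[of I "(<)" "(>)" \<beta> i0 i] by auto
      qed
      moreover have "monotone_on I (<) (<) (\<lambda>i. (\<rho> ^^ \<beta> i) i)" using ejs(1) by (auto simp: extended_jump_set_def)
      ultimately have less: "(\<rho> ^^ \<beta> i) i < (\<rho> ^^ \<beta> i0) i0"
        using monotone_onD[of I "(<)" "(<)" "\<lambda>i. (\<rho> ^^ \<beta> i) i" i i0] i i0(1) by simp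
      have step: "(\<rho> ^^ \<beta> k) k = \<rho> ((\<rho> ^^ (\<beta> k - 1)) k)" if "k \<in> I" for k
        using beta1[OF that] by (cases "\<beta> k") auto
      have "e \<le> (\<rho> ^^ (\<beta> i - 1)) i"
        using I_ge[of "max e (\<beta> i)" i] m_large[of "max e (\<beta> i)"] i e_pos by auto
      then have "(\<rho> ^^ (\<beta> i0 - 1)) i0 \<le> (\<rho> ^^ (\<beta> i - 1)) i" using i0_rho by simp
      then have "\<rho> ((\<rho> ^^ (\<beta> i0 - 1)) i0) \<le> \<rho> ((\<rho> ^^ (\<beta> i - 1)) i)"
        using rho_strict_mono[of p "(\<rho> ^^ (\<beta> i0 - 1)) i0" "(\<rho> ^^ (\<beta> i - 1)) i" "e * (p - 1)"] p2
        by (cases "(\<rho> ^^ (\<beta> i0 - 1)) i0 = (\<rho> ^^ (\<beta> i - 1)) i") (auto simp: \<rho>_def)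
      then show False using less step i i0(1) by simp
    qed
    then have "p ^ (\<beta> i - 1) \<le> p ^ (\<beta> i0 - 1)" using p2 by (intro power_increasing) auto
    also have "\<dots> \<le> p ^ (\<beta> i0 - 1) * i0" using ejs(2)[OF i0(1)] by simp
    finally show ?thesis using i0(2) by simp
  qed

  let ?h = "twist \<iota> g \<pi>"
  have coeff_h: "coeff ?h k = (\<Sum>j\<in>{1..e}. of_nat (j choose k) * \<iota> (a j) * \<pi> ^ j)" if "k > 0" for k
  proof -
    have "{..e} = insert 0 {1..e}" by auto
    then show ?thesis using that by (simp add: coeff_twist[OF emb] g(2) a_def binomial_eq_0)
  qed
  have coeff_h0: "coeff ?h 0 = 0"
    using a_sum by (simp add: coeff_twist[OF emb] g(2) a_def)
  have h_e: "coeff ?h e \<noteq> 0" "vL (coeff ?h e) = int e"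
  proof -
    have "(\<Sum>j\<in>{1..e}. of_nat (j choose e) * \<iota> (a j) * \<pi> ^ j) = (\<Sum>j\<in>{1..e}. if j = e then \<pi> ^ e else 0)"
      by (rule sum.cong) (auto simp: a binomial_eq_0)
    then have "coeff ?h e = \<pi> ^ e" using coeff_h[OF e_pos] e1 by simp
    then show "coeff ?h e \<noteq> 0" "vL (coeff ?h e) = int e" using pi L.val_power by auto
  qed
  let ?S = "{(real (p ^ (\<beta> i - 1)), real (p ^ (\<beta> i - 1) * i)) | i. i \<in> I} \<union> {(real e, real e)}"
  let ?N = "{(real k, real_of_int (vL (coeff ?h k))) | k. coeff ?h k \<noteq> 0}"
  have S_e: "(real e, real e) \<in> ?S" by simp
  have N_e: "(real e, real e) \<in> ?N" using h_e by (auto intro!: exI[of _ e])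
  have SN: "\<exists>y'\<le>y. (X, y') \<in> convex hull ?N" if Xy: "(X, y) \<in> ?S" for X y
  proof (cases "(X, y) = (real e, real e)")
    case True
    then show ?thesis using convex_hull_segment_below[OF N_e N_e, of X y] by simp
  next
    case False
    then obtain i where i: "i \<in> I" "X = real (p ^ (\<beta> i - 1))" "y = real (p ^ (\<beta> i - 1) * i)"
      using Xy by auto
    note s = beta1[OF i(1)]
    obtain j0 where j0: "j0 \<in> Ms (\<beta> i)" "int (m (\<beta> i)) = w j0" using m_att[OF s] by blast
    have j0': "j0 \<in> {1..e}" "a j0 \<noteq> 0" "\<not> p ^ \<beta> i dvd j0" using j0 by (auto simp: Ms_def)
    define t where "t = multiplicity p j0"
    have t: "p ^ t dvd j0" by (simp add: t_def multiplicity_dvd)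
    have "t < \<beta> i"
    proof (rule ccontr)
      assume "\<not> t < \<beta> i"
      then have "p ^ \<beta> i dvd p ^ t" by (intro le_imp_power_dvd) simp
      then show False using t j0'(3) dvd_trans by blast
    qed
    have nd: "\<not> p dvd (j0 choose p ^ t)"
      unfolding t_def using prime_not_dvd_choose_multiplicity[OF p] j0'(1) by simp
    then have ch: "j0 choose p ^ t > 0" by (intro gr0I) auto
    have pt: "p ^ t > 0" using p2 by simp
    have ex: "\<exists>j\<in>{1..e}. (j choose p ^ t) > 0 \<and> a j \<noteq> 0" using j0' ch by blast
    \<comment> \<open>An integer prime to p is a unit by Bezout, since p lies in the maximal
      ideal.\<close>
    have "vK (of_nat (j0 choose p ^ t)) = 0"
    proof -
      have "coprime p (j0 choose p ^ t)" using p nd by (rule prime_imp_coprime)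
      then have "gcd (int (j0 choose p ^ t)) (int p) = 1" by (simp add: gcd.commute coprime_iff_gcd_eq_1)
      then obtain u v where uv: "u * int (j0 choose p ^ t) + v * int p = 1"
        using bezout_int[of "int (j0 choose p ^ t)" "int p"] by auto
      have of_int_O: "of_int z \<in> val_ring vK" for z
      proof (cases z rule: int_cases2)
        case (nonneg n) then show ?thesis by simp
      next
        case (nonpos n) then show ?thesis by simp
      qed
      show ?thesis
      proof (rule ccontr)
        assume "vK (of_nat (j0 choose p ^ t)) \<noteq> 0"
        then have "of_nat (j0 choose p ^ t) \<in> max_pow vK 1" using val_of_nat0[OF ch] by (simp add: max_pow_def)
        then have "of_int u * of_nat (j0 choose p ^ t) + of_int v * of_nat p \<in> max_pow vK 1"
          using pK1 of_int_O by (intro K.max_pow_add K.max_pow_mult_left)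
        moreover have "of_int u * of_nat (j0 choose p ^ t) + of_int v * of_nat p = (1 :: 'k)"
          using arg_cong[OF uv, of "of_int :: int \<Rightarrow> 'k"] by simp
        ultimately show False by (simp add: max_pow_def)
      qed
    qed
    then have val: "vL (coeff ?h (p ^ t)) \<le> w j0" "coeff ?h (p ^ t) \<noteq> 0"
      using val_sum(3)[OF ex j0'(1) ch j0'(2)] val_sum(2)[OF ex] coeff_h[OF pt] by simp_all
    have low: "m (\<beta> i) \<le> p ^ (\<beta> i - 1) * i" using I_low[OF s i(1)] by simp
    have "vL (coeff ?h (p ^ t)) \<le> int (p ^ (\<beta> i - 1) * i)"
      using val(1) j0(2) low by (metis order_trans of_nat_le_iff)
    then have y1: "real_of_int (vL (coeff ?h (p ^ t))) \<le> y" unfolding i(3) by (metis of_int_le_iff of_int_of_nat_eq)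
    have y2: "real e \<le> y" unfolding i(3) of_nat_le_iff using m_ge[OF s] low by linarith
    have "p ^ t \<le> p ^ (\<beta> i - 1)" using p2 \<open>t < \<beta> i\<close> by (intro power_increasing) auto
    then have x1: "real (p ^ t) \<le> X" unfolding i(2) of_nat_le_iff .
    have x2: "X \<le> real e" unfolding i(2) of_nat_le_iff by (rule pow_le[OF i(1)])
    have "(real (p ^ t), real_of_int (vL (coeff ?h (p ^ t)))) \<in> ?N" using val(2) by blast
    from convex_hull_segment_below[OF this N_e x1 x2 y1 y2] show ?thesis .
  qed
  have NS: "\<exists>y'\<le>y. (X, y') \<in> convex hull ?S" if Xy: "(X, y) \<in> ?N" for X y
  proof -
    obtain k where k: "X = real k" "y = real_of_int (vL (coeff ?h k))" "coeff ?h k \<noteq> 0" using Xy by blast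
    have k0: "k > 0" using coeff_h0 k(3) by (cases k) auto
    have ex: "\<exists>j\<in>{1..e}. (j choose k) > 0 \<and> a j \<noteq> 0"
    proof (rule ccontr)
      assume no: "\<not> ?thesis"
      have "(\<Sum>j\<in>{1..e}. of_nat (j choose k) * \<iota> (a j) * \<pi> ^ j) = 0"
      proof (rule sum.neutral, rule ballI)
        fix j assume "j \<in> {1..e}"
        then have "(j choose k) = 0 \<or> a j = 0" using no gr0I by blast
        then show "of_nat (j choose k) * \<iota> (a j) * \<pi> ^ j = 0" by (elim disjE) (simp_all add: binomial_eq_0)
      qed
      then show False using k(3) coeff_h[OF k0] by simp
    qed
    obtain j where j: "j \<in> {1..e}" "(j choose k) > 0" "a j \<noteq> 0"
      "vL (coeff ?h k) = int e * vK (of_nat (j choose k)) + w j"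
      using val_sum(1)[OF ex] coeff_h[OF k0] by auto
    have kj: "k \<le> j" using j(2) by (metis binomial_eq_0 less_numeral_extra(3) not_le)
    then have x2: "X \<le> real e" using j(1) k(1) by simp
    \<comment> \<open>If p divides the binomial, its valuation alone is at least v(p) \<ge> m_1, and
      s = 1 serves every k \<ge> 1. Otherwise s - 1 is the exponent of p in j.\<close>
    obtain s where s: "1 \<le> s" "p ^ (s - 1) \<le> k" "int (m s) \<le> vL (coeff ?h k)"
    proof (cases "p dvd (j choose k)")
      case True
      have "int e * int (p - 1) \<le> int e * vK (of_nat (j choose k))"
        using val_of_nat[OF True j(2)] by (intro mult_left_mono) auto
      then have "int (m 1) \<le> vL (coeff ?h k)"
        using j(4) m_le[of 1] w_ge[OF j(1,3)] by (simp flip: of_nat_mult)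
      then show ?thesis using that[of 1] k0 by simp
    next
      case False
      define t where "t = multiplicity p j"
      have "p ^ t dvd j" by (simp add: t_def multiplicity_dvd)
      then have "p ^ t dvd k" using power_dvd_of_not_dvd_choose[OF p _ False] k0 by simp
      then have "p ^ t \<le> k" using k0 dvd_imp_le by blast
      moreover have "\<not> p ^ Suc t dvd j"
      proof
        assume "p ^ Suc t dvd j"
        then have "Suc t \<le> multiplicity p j" by (rule multiplicity_geI[rotated 2]) (use j(1) p in auto)
        then show False by (simp add: t_def)
      qed
      then have "int (m (Suc t)) \<le> w j" using m_min[of "Suc t" j] j by (simp add: Ms_def)
      moreover have "0 \<le> int e * vK (of_nat (j choose k))" using val_of_nat0[OF j(2)] by simp
      ultimately show ?thesis using that[of "Suc t"] j(4) by simp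
    qed
    obtain i where i: "i \<in> I" "\<beta> i \<le> s" "p ^ (\<beta> i - 1) * i = m s" using I_att[OF s(1)] by blast
    have "p ^ (\<beta> i - 1) \<le> p ^ (s - 1)" using p2 i(2) by (intro power_increasing) auto
    then have x1: "real (p ^ (\<beta> i - 1)) \<le> X" unfolding k(1) of_nat_le_iff using s(2) by linarith
    have y1: "real (p ^ (\<beta> i - 1) * i) \<le> y" unfolding k(2) i(3) using s(3) by (metis of_int_le_iff of_int_of_nat_eq)
    have "int e \<le> vL (coeff ?h k)" using s(3) m_ge[OF s(1)] by linarith
    then have y2: "real e \<le> y" unfolding k(2) by (metis of_int_le_iff of_int_of_nat_eq)
    have "(real (p ^ (\<beta> i - 1)), real (p ^ (\<beta> i - 1) * i)) \<in> ?S" using i(1) by blast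
    from convex_hull_segment_below[OF this S_e x1 x2 y1 y2] show ?thesis .
  qed
  show ?thesis
    unfolding newton_polygon_def
    by (intro equalityI lower_convex_hull_subset) (rule SN NS, assumption)+
qed

section \<open>The tower Q_p, F, K, L and the final identity\<close>

lemma local_field_ext_val_extension:
  assumes "local_field_ext vK vL \<iota>"
  shows "\<exists>e. val_extension vK vL \<iota> e"
proof -
  obtain e :: nat where e: "0 < e" "\<forall>x. x \<noteq> 0 \<longrightarrow> vL (\<iota> x) = int e * vK x"
    using assms by (auto simp: local_field_ext_def)
  have "val_extension vK vL \<iota> e"
    using assms e
    by (auto simp: local_field_ext_def local_field_def val_extension_def val_extension_axioms_def nval_def)
  then show ?thesis by blast
qed

theorem theorem1p13:
  fixes p f n :: nat
    and vQ :: "'q::field_char_0 \<Rightarrow> int"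
    and vF :: "'f::field \<Rightarrow> int"
    and vK :: "'k::field \<Rightarrow> int"
    and vL :: "'l::field \<Rightarrow> int"
    and \<iota>F :: "'q \<Rightarrow> 'f" and \<iota>K :: "'f \<Rightarrow> 'k" and \<iota> :: "'k \<Rightarrow> 'l"
    and \<zeta> :: 'k
    and I :: "nat set" and \<beta> :: "nat \<Rightarrow> nat"
  assumes "prime p" and "1 \<le> f"
    \<comment> \<open>\<open>Q = Q_p\<close>, \<open>F = Q_{p^f}\<close>, \<open>K = F(\<zeta>_p)\<close>\<close>
    and "is_Qp p vQ"
    and "unramified_ext vQ vF \<iota>F" and "ext_degree \<iota>F = f"
    and "local_field_ext vF vK \<iota>K"
    and "\<zeta> ^ p = 1" and "\<zeta> \<noteq> 1" and "adjoin (range \<iota>K) \<zeta> = UNIV"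
    and "totally_ramified_ext vK vL \<iota>"
    and "strongly_separable p vK vL \<iota>"
    and "n = ext_degree \<iota>"
    and "is_jump_set_of p vQ vL I \<beta>"
  shows "lower_convex_hull
           ({(real (p ^ (\<beta> i - 1)), real (p ^ (\<beta> i - 1) * i)) | i. i \<in> I} \<union> {(real n, real n)})
         = Newt vK vL \<iota>"
proof -
  let ?\<rho> = "rho (nat (vL (of_nat p))) p"
  have p2: "p \<ge> 2" using assms(1) prime_ge_2_nat by blast
  have Qp: "normalized_valuation vQ" "\<And>m::int. m \<noteq> 0 \<Longrightarrow> vQ (of_int m) = int (multiplicity (int p) m)"
    using assms(3) by (auto simp: is_Qp_def)
  have "multiplicity (int p) (int p) = 1" using p2 by (intro multiplicity_self) auto
  then have vQp: "vQ (of_nat p) = 1" using Qp(2)[of "int p"] p2 by simp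
  obtain e0 where e0: "val_extension vQ vF \<iota>F e0"
    using assms(4) local_field_ext_val_extension unfolding unramified_ext_def by blast
  obtain e1 where e1: "val_extension vF vK \<iota>K e1" using assms(6) local_field_ext_val_extension by blast
  obtain e2 where e2: "val_extension vK vL \<iota> e2"
    using assms(10) local_field_ext_val_extension unfolding totally_ramified_ext_def by blast
  interpret F: val_extension vQ vF \<iota>F e0 by (rule e0)
  interpret K: val_extension vF vK \<iota>K e1 by (rule e1)
  interpret L: val_extension vK vL \<iota> e2 by (rule e2)
  have "e0 = 1" using assms(4) F.ram_index_eq by (simp add: unramified_ext_def)
  have "e2 = ext_degree \<iota>" using assms(10) L.ram_index_eq by (simp add: totally_ramified_ext_def)
  then have n: "ext_degree \<iota> = e2" "n = e2" using assms(12) by simp_all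
  have charF: "(of_nat m :: 'f) \<noteq> 0" if "m > 0" for m
    using F.emb_simps(8,10)[of "of_nat m"] that by (metis F.emb_simps(8) F.emb_simps(10) of_nat_eq_0_iff neq0_conv)
  have charK: "(of_nat m :: 'k) \<noteq> 0" if "m > 0" for m
    using charF[OF that] by (metis K.emb_simps(8) K.emb_simps(10))
  \<comment> \<open>p stays a uniformizer in the unramified layer; the cyclotomic layer contributes
    the factor p - 1 and L over K the factor \<open>e2\<close>, so v_L(p) = n(p - 1).\<close>
  have vFp: "vF (of_nat p) = 1"
    using F.val_emb[of "of_nat p"] vQp p2 \<open>e0 = 1\<close> by simp
  have cyc: "e1 = p - 1" "vK (\<zeta> - 1) = 1"
    using K.cyclotomic_valuation[OF assms(1) charF vFp assms(7,8,9)] p2 by auto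
  have vKp: "vK (of_nat p) = int (p - 1)"
    using K.val_emb[OF charF, of p] vFp cyc(1) p2 by simp
  have vLp: "vL (of_nat p) = int (e2 * (p - 1))"
    using L.val_emb[OF charK, of p] vKp p2 by simp
  define x where "x = \<zeta> - 1"
  have x: "x \<noteq> 0" "vK x = 1" "\<zeta> = 1 + x" using assms(8) cyc by (auto simp: x_def)
  have jump: "extended_jump_set ?\<rho> I \<beta>"
    "fmod_iso (val_ring vQ) (U_mod vQ vL)
        (fmod_sum (fmod_prod {..<residue_degree p vL - 1} (\<lambda>_. M_rho vQ ?\<rho>))
           (fmod_quot (M_rho_star vQ ?\<rho>)
             (cyclic_submodule (val_ring vQ) (M_rho_star vQ ?\<rho>) (jump_vector p ?\<rho> I \<beta>))))"
    using assms(13) by (simp_all add: is_jump_set_of_def Let_def)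
  have rho: "?\<rho> = rho (e2 * (p - 1)) p" unfolding vLp by (simp only: nat_int)
  have z: "(\<iota> \<zeta>) ^ p = 1" "\<iota> \<zeta> \<noteq> 1" "\<iota> \<zeta> \<in> unit_group vL 1"
  proof -
    show "(\<iota> \<zeta>) ^ p = 1" using assms(7) by (metis L.emb_simps(2) L.emb_simps(7))
    have "\<iota> x \<noteq> 0" using x by simp
    then show "\<iota> \<zeta> \<noteq> 1" using x(3) by simp
    show "\<iota> \<zeta> \<in> unit_group vL 1"
      using L.val_emb[OF x(1)] x L.e_pos by (simp add: unit_group_def max_pow_def)
  qed
  have I_pos: "1 \<le> i" if "i \<in> I" for i
    using jump(1) that by (auto simp: extended_jump_set_def T_star_def T_set_def e_star_def)
  have A: "(\<exists>u\<in>unit_group vL 1. \<iota> (1 + x) * u ^ p ^ s \<in> unit_group vL k) \<longleftrightarrow>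
        (\<forall>i\<in>I. \<beta> i \<le> s \<longrightarrow> k \<le> ((rho (e2 * (p - 1)) p) ^^ (\<beta> i - 1)) i)" if "1 \<le> s" "1 \<le> k" for s k
    using jump_module_iff[OF Qp(1) L.L.nval vQp assms(1) z jump that(2), of s] unfolding rho x(3) .
  obtain B0 where B0: "finite B0" "L.V.span B0 = UNIV"
    using assms(10) by (auto simp: totally_ramified_ext_def local_field_ext_def)
  have lf: "local_field vK" using assms(6) by (simp add: local_field_ext_def)
  \<comment> \<open>The right-hand side mentions neither g nor \<pi>, so all presentations give the
    same polygon, which is the uniqueness that the description in \<open>Newt\<close>
    requires.\<close>
  have *: "newton_polygon vL (twist \<iota> g \<pi>) = lower_convex_hull
           ({(real (p ^ (\<beta> i - 1)), real (p ^ (\<beta> i - 1) * i)) | i. i \<in> I} \<union> {(real n, real n)})"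
    if "eisenstein_presentation vK \<iota> g \<pi>" for g \<pi>
    unfolding n(2)
    by (rule L.newton_polygon_eq[OF that B0 n(1) assms(1) vKp charK lf x(1,2) assms(11)
          jump(1)[unfolded rho] I_pos A, symmetric])
  obtain g \<pi> where "eisenstein_presentation vK \<iota> g \<pi>"
    using L.eisenstein_presentation_exists[OF B0 n(1)] by blast
  then show ?thesis
    unfolding Newt_def using *[symmetric] by (intro the_equality[symmetric]) blast+
qed

end
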